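(* Let $\theta>\frac13\left(\frac34\right)^{3/4}$ be a fixed number. The eigenvalues of the problem $$-i\varepsilon y''=(x-\lambda)y,\qquad y(-1)=y(1)=0,$$ are symmetric with respect to the imaginary axis, and in a neighbourhood of the segment $\left[-1,-\frac{i}{\sqrt3}\right]$ they have the asymptotics $$\lambda_k=(e^{-i\frac{\pi}{6}}t_k-1)\left(1+O\left(e^{-\varepsilon^{-1/2}\varphi(t_k)}\right)\right),\qquad \varphi(t)=\frac43\operatorname{Re}\,(2e^{i\frac{\pi}{6}}-t)^{3/2},$$ where $t_k$ are the zeros of the Airy--Fock function, $v(-\varepsilon^{-1/3}t)=0$, when $t\in\left[0,\frac{2}{\sqrt3}-\varepsilon^{1/2}\ln\varepsilon^{-\theta}\right)$. Moreover, $$\left(\varepsilon^{-1/3}t_k\right)^{3/2}=\frac{3\pi}{2}\left(k-\frac14\right)+O\left(\frac1k\right),\qquad k=1,2,\ldots.$$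
   Context: The equation is considered on the interval $-1<x<1$; $\lambda\in\mathbb C$ is the spectral parameter and $\varepsilon>0$ is a small parameter (the asymptotics are for $\varepsilon\to+0$). Here $\ln\varepsilon^{-\theta}=\theta\ln(1/\varepsilon)$. The Airy--Fock function $v$ is the solution of the Airy equation $v''(\xi)=\xi v(\xi)$ which in the sector $|\arg\xi|\le\pi-\delta_0$ ($\delta_0>0$ an arbitrary fixed number) has the asymptotics $v(\xi)=\frac{e^{-\frac23\xi^{3/2}}}{2\sqrt\pi\,\xi^{1/4}}\left(1+O(|\xi|^{-3/2})\right)$ as $\xi\to\infty$, where the branches of the roots are the principal ones (positive for $\xi>0$); that is, $v=\mathrm{Ai}$. *)

theory Defs
  imports "HOL-Complex_Analysis.Complex_Analysis" "HOL-Library.Landau_Symbols"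
begin

(* The defining property of the Airy-Fock function; it determines v uniquely, namely v = Ai.
   The case \<delta>\<^sub>0 \<ge> pi adds nothing. *)
definition airy_fock :: "(complex \<Rightarrow> complex) \<Rightarrow> bool" where
  "airy_fock v \<longleftrightarrow>
     v holomorphic_on UNIV \<and>
     (\<forall>\<xi>. deriv (deriv v) \<xi> = \<xi> * v \<xi>) \<and>
     (\<forall>\<delta>\<^sub>0>0.
        (\<lambda>\<xi>. v \<xi> / (exp (- (2/3) * \<xi> powr (3/2)) / (2 * of_real (sqrt pi) * \<xi> powr (1/4))) - 1)
          \<in> O[inf at_infinity (principal {\<xi>. \<bar>Arg \<xi>\<bar> \<le> pi - \<delta>\<^sub>0})](\<lambda>\<xi>. of_real (cmod \<xi> powr (-3/2))))"

definition eigenvalue :: "real \<Rightarrow> complex \<Rightarrow> bool" where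
  "eigenvalue \<epsilon> \<mu> \<longleftrightarrow>
     (\<exists>y y' y'' :: real \<Rightarrow> complex.
        continuous_on {-1..1} y \<and>
        (\<forall>x\<in>{-1<..<1}.
           (y has_vector_derivative y' x) (at x) \<and>
           (y' has_vector_derivative y'' x) (at x) \<and>
           - \<i> * of_real \<epsilon> * y'' x = (of_real x - \<mu>) * y x) \<and>
        y (-1) = 0 \<and> y 1 = 0 \<and>
        (\<exists>x\<in>{-1..1}. y x \<noteq> 0))"

definition \<phi> :: "real \<Rightarrow> real" where
  "\<phi> t = 4/3 * Re ((2 * exp (\<i> * of_real (pi / 6)) - of_real t) powr (3/2))"

(* The right end of the admissible range of t; ln (\<epsilon> powr - \<theta>) = \<theta> * ln (1/\<epsilon>). *)
definition t_max :: "real \<Rightarrow> real \<Rightarrow> real" where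
  "t_max \<theta> \<epsilon> = 2 / sqrt 3 - \<epsilon> powr (1/2) * ln (\<epsilon> powr (- \<theta>))"

(* tau 1 < tau 2 < ... are all the zeros t >= 0 of v(- \<epsilon> powr (-1/3) * t); the value tau 0 is irrelevant. *)
definition enumerates_zeros :: "(complex \<Rightarrow> complex) \<Rightarrow> real \<Rightarrow> (nat \<Rightarrow> real) \<Rightarrow> bool" where
  "enumerates_zeros v \<epsilon> \<tau> \<longleftrightarrow>
     strict_mono_on {1..} \<tau> \<and>
     \<tau> ` {1..} = {t. 0 \<le> t \<and> v (of_real (- (\<epsilon> powr (-1/3)) * t)) = 0}"

(* The coordinate along the segment [-1, -i/sqrt 3]: the point exp(-i pi/6) t - 1, t real, has
   coordinate t, and the lines of constant coordinate are orthogonal to the segment. *)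
definition seg_coord :: "complex \<Rightarrow> real" where
  "seg_coord \<mu> = Re (exp (\<i> * of_real (pi / 6)) * (\<mu> + 1))"

(* The eigenvalues near the segment for one value of \<epsilon>, with error constant C. They are lam 1, ..., lam n,
   where the index set contains every k with t_k in [0, t_max) and at most one further index n.
   That index cannot be avoided: an eigenvalue with coordinate just below t_max may belong to a
   zero t_n just above it. *)
definition segment_asymptotics ::
    "complex set \<Rightarrow> real \<Rightarrow> real \<Rightarrow> real \<Rightarrow> (nat \<Rightarrow> real) \<Rightarrow> bool" where
  "segment_asymptotics U C \<theta> \<epsilon> \<tau> \<longleftrightarrow>
     (\<exists>(n :: nat) (lam :: nat \<Rightarrow> complex) (r :: nat \<Rightarrow> complex).
        (\<forall>k\<ge>1. \<tau> k < t_max \<theta> \<epsilon> \<longrightarrow> k \<le> n) \<and>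
        (\<forall>k\<in>{1..<n}. \<tau> k < t_max \<theta> \<epsilon>) \<and>
        inj_on lam {1..n} \<and>
        (\<forall>k\<in>{1..n}.
           eigenvalue \<epsilon> (lam k) \<and> lam k \<in> U \<and>
           lam k = (exp (- \<i> * of_real (pi / 6)) * of_real (\<tau> k) - 1) * (1 + r k) \<and>
           cmod (r k) \<le> C * exp (- (\<epsilon> powr (-1/2)) * \<phi> (\<tau> k))) \<and>
        (\<forall>\<mu>\<in>U. eigenvalue \<epsilon> \<mu> \<and> seg_coord \<mu> < t_max \<theta> \<epsilon> \<longrightarrow> \<mu> \<in> lam ` {1..n}))"

end

theory Submission
  imports Defs
begin

text \<open>
  Put \<open>p = \<epsilon> powr (-1/3)\<close>, \<open>\<lambda> = exp (-i pi/6) t - 1\<close>, \<open>z = p t\<close>, \<open>b = p (2 exp (i pi/6) - t)\<close>,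
  \<open>\<alpha> = exp (i pi/3)\<close> and \<open>\<beta> = exp (-i pi/3)\<close>. In terms of the independent solutions \<open>v(\<xi>)\<close> and
  \<open>v(-\<alpha>\<xi>)\<close> the eigenvalue condition is \<open>v(-z) v(-\<alpha>b) = v(b) v(\<alpha>z)\<close>. Since
  \<open>v(-z) = \<alpha> v(\<alpha>z) + \<beta> v(\<beta>z)\<close>, this reads \<open>exp \<Psi>(z) = \<beta> (1 + \<alpha>\<^sup>2 h)\<close>, where
  \<open>\<Psi>(z) = log v(\<beta>z) - log v(\<alpha>z)\<close>, and \<open>h = v(b) / v(-\<alpha>b)\<close> has size
  \<open>exp (- \<epsilon> powr (-1/2) * \<phi> t)\<close>. The zeros of \<open>v(-z)\<close> are the solutions for \<open>h = 0\<close>.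

  By constancy of the Wronskian \<open>\<Psi>' = i \<kappa> / (v(\<alpha>z) v(\<beta>z))\<close> with \<open>\<kappa> > 0\<close>. Hence \<open>\<Psi> / i\<close>
  increases along the positive axis, which counts the zeros, and it is expanding on a thin cone
  around the axis, so that every zero persists as exactly one eigenvalue at distance \<open>O(h)\<close>.
  Off the cone, and below the axis where \<open>h\<close> may be large, the two sides of the equation have
  different sizes.
\<close>

subsection \<open>The Airy-Fock function on the right half plane\<close>

text \<open>The difficulty is uniformity: \<open>U\<close> and \<open>C\<close> are independent of
  \<epsilon>, while in the variable z the region grows like \<open>\<epsilon> powr (-1/3)\<close>.
  The asymptotics of v control large z; bounded z are treated by compactness, which works because v
  has no zeros off the negative axis. Derivatives of v enter the estimates through constant
  Wronskians, so the asymptotics of v itself suffice.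

  Near the end \<open>t_max\<close> the perturbation h is only a power of \<epsilon>: \<phi> has
  slope at most -1 and \<theta> >= 1/4, so h is O(\<open>\<epsilon> powr (1/4)\<close>), whereas
  consecutive zeros there are about \<open>\<epsilon> powr (1/6)\<close> apart in z. Discs of radius
  \<open>K * \<epsilon> powr (1/4)\<close> therefore separate them, and the logarithm of the
  equation tells which zero an eigenvalue belongs to.

  Below the axis h is bounded a priori only by \<open>\<epsilon> powr (1/4) * exp (2 * X)\<close>
  with X = \<open>\<epsilon> powr (-1/2)\<close> times |Im t|. For Re t >= 1 the modulus of exp
  \<Psi> grows at least like exp (2 X) without a small factor, so the equation itself bounds X; for
  Re t < 1 the exponent \<phi> has room to spare.\<close>

definition lead :: "complex \<Rightarrow> complex" where
  "lead \<xi> = exp (- (2/3) * \<xi> powr (3/2)) / (2 * of_real (sqrt pi) * \<xi> powr (1/4))"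

lemma norm_lead:
  "cmod (lead \<xi>) = exp (- (2/3) * Re (\<xi> powr (3/2))) / (2 * sqrt pi * cmod \<xi> powr (1/4))"
proof -
  have "cmod (\<xi> powr (1/4)) = cmod \<xi> powr (1/4)"
    by (simp add: norm_powr_real_powr')
  then show ?thesis
    by (simp add: lead_def norm_divide norm_mult)
qed

lemma lead_nz: "\<xi> \<noteq> 0 \<Longrightarrow> lead \<xi> \<noteq> 0"
  by (simp add: lead_def)

section \<open>Principal powers under rotation, and derivatives along lines\<close>

lemma powr_three_halves_eq: "\<xi> powr (3/2) = \<xi> * csqrt (\<xi> :: complex)"
proof (cases "\<xi> = 0")
  case False
  have "\<xi> powr (3/2) = \<xi> powr (1 + 1/2)" by simp
  also have "\<dots> = \<xi> powr 1 * \<xi> powr (1/2)" by (rule powr_add)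
  finally show ?thesis using False by (simp add: csqrt_conv_powr)
qed simp

text \<open>The bounds on the argument keep the rotation from crossing the branch cut, so principal
  logarithms and powers transform without a jump.\<close>

lemma Ln_cis_times:
  assumes "z \<noteq> 0" "-pi < Arg z + \<theta>" "Arg z + \<theta> \<le> pi"
  shows "Ln (cis \<theta> * z) = Ln z + \<i> * \<theta>"
proof (rule Ln_unique)
  show "exp (Ln z + \<i> * \<theta>) = cis \<theta> * z"
    using assms by (simp add: exp_add cis_conv_exp mult.commute)
qed (use assms in \<open>auto simp: Arg_eq_Im_Ln\<close>)

lemma cis_times_powr:
  assumes "z \<noteq> 0" "-pi < Arg z + \<theta>" "Arg z + \<theta> \<le> pi"
  shows "(cis \<theta> * z) powr (of_real p) = cis (p * \<theta>) * z powr (of_real p)"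
  using assms Ln_cis_times[OF assms]
  by (auto simp: powr_def cis_conv_exp algebra_simps simp flip: exp_add)

lemma Arg_cis_times:
  assumes "z \<noteq> 0" "-pi < Arg z + \<theta>" "Arg z + \<theta> \<le> pi"
  shows "Arg (cis \<theta> * z) = Arg z + \<theta>"
  using assms Ln_cis_times[OF assms] by (simp add: Arg_eq_Im_Ln)

text \<open>Both numbers have cube -1, so \<open>v (al * z)\<close>, \<open>v (be * z)\<close> and
  \<open>v (- z)\<close> solve the same equation f'' = - z f. In turn \<open>- al\<close> is a cube
  root of unity, so \<open>v (- al * b)\<close> solves the same equation as
  \<open>v b\<close>.\<close>

abbreviation al :: complex where "al \<equiv> cis (pi/3)"
abbreviation be :: complex where "be \<equiv> cis (- (pi/3))"

lemma al_eq: "al = Complex (1/2) (sqrt 3 / 2)" and be_eq: "be = Complex (1/2) (- (sqrt 3 / 2))"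
  by (auto simp: complex_eq_iff cos_60 sin_60)

lemma al_be: "al * be = 1" "be * al = 1" "al + be = 1" "al ^ 3 = - 1" "be ^ 3 = -1" "al^2 = - be" "be^2 = - al"
  "al * al = - be" "be * be = - al"
  by (auto simp: al_eq be_eq complex_eq_iff power3_eq_cube power2_eq_square)

lemma norm_al_mult [simp]: "cmod (al * z) = cmod z" "cmod (be * z) = cmod z"
  by (auto simp: norm_mult)

lemma has_real_derivative_Re:
  assumes "(f has_vector_derivative f') (at x)"
  shows "((\<lambda>x. Re (f x)) has_real_derivative Re f') (at x)"
  using bounded_linear.has_vector_derivative[OF bounded_linear_Re assms]
  by (simp add: has_real_derivative_iff_has_vector_derivative)

lemma has_real_derivative_Im:
  assumes "(f has_vector_derivative f') (at x)"
  shows "((\<lambda>x. Im (f x)) has_real_derivative Im f') (at x)"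
  using bounded_linear.has_vector_derivative[OF bounded_linear_Im assms]
  by (simp add: has_real_derivative_iff_has_vector_derivative)

lemma has_vector_derivative_line:
  fixes f :: "complex \<Rightarrow> complex"
  assumes "(f has_field_derivative f') (at (a + of_real x * w))"
  shows "((\<lambda>x. f (a + of_real x * w)) has_vector_derivative (w * f')) (at x)"
proof -
  have "((\<lambda>x. a + of_real x * w) has_vector_derivative w) (at x)"
    by (auto intro!: derivative_eq_intros)
  from field_vector_diff_chain_at[OF this assms]
  show ?thesis by (simp add: o_def)
qed

locale airy =
  fixes v :: "complex \<Rightarrow> complex"
  assumes airy_fock: "airy_fock v"
begin

definition vd :: "complex \<Rightarrow> complex" where "vd = deriv v"

lemma v_deriv: "(v has_field_derivative vd \<xi>) (at \<xi>)"
  using airy_fock unfolding airy_fock_def vd_def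
  by (auto intro: holomorphic_derivI[of _ UNIV])

lemma vd_deriv: "(vd has_field_derivative \<xi> * v \<xi>) (at \<xi>)"
proof -
  have "deriv v holomorphic_on UNIV"
    using airy_fock unfolding airy_fock_def by (auto intro: holomorphic_deriv)
  from holomorphic_derivI[OF this, of \<xi>] show ?thesis
    using airy_fock unfolding airy_fock_def vd_def by auto
qed

lemma v_holo: "v holomorphic_on S"
  using v_deriv by (meson field_differentiable_at_within field_differentiable_def holomorphic_on_def)

lemma v_cont [continuous_intros]: "continuous_on S f \<Longrightarrow> continuous_on S (\<lambda>x. v (f x))"
  using holomorphic_on_imp_continuous_on[OF v_holo, of UNIV]
  by (metis continuous_on_compose2 subset_UNIV)

lemma v_vector_deriv:
  "((\<lambda>x. v (a + of_real x * w)) has_vector_derivative w * vd (a + of_real x * w)) (at x)"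
  by (rule has_vector_derivative_line[OF v_deriv])

lemma vd_vector_deriv:
  "((\<lambda>x. vd (a + of_real x * w)) has_vector_derivative
      w * ((a + of_real x * w) * v (a + of_real x * w))) (at x)"
  by (rule has_vector_derivative_line[OF vd_deriv])

text \<open>Enlarging the radius turns the O-statement into two explicit bounds: the rate of decay,
  and a relative error 1/16 that is small enough for products and quotients of two such factors to
  stay close to 1.\<close>

lemma asymp:
  assumes "\<delta> > 0"
  obtains R C where "R \<ge> 1" "C > 0"
    "\<And>\<xi>. cmod \<xi> \<ge> R \<Longrightarrow> \<bar>Arg \<xi>\<bar> \<le> pi - \<delta> \<Longrightarrow>
        cmod (v \<xi> / lead \<xi> - 1) \<le> C * cmod \<xi> powr (-3/2) \<and> cmod (v \<xi> / lead \<xi> - 1) \<le> 1/16"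
proof -
  have "(\<lambda>\<xi>. v \<xi> / lead \<xi> - 1)
          \<in> O[inf at_infinity (principal {\<xi>. \<bar>Arg \<xi>\<bar> \<le> pi - \<delta>})](\<lambda>\<xi>. of_real (cmod \<xi> powr (-3/2)))"
    using airy_fock assms unfolding airy_fock_def lead_def by auto
  then obtain C where C: "C > 0" "eventually (\<lambda>\<xi>. cmod (v \<xi> / lead \<xi> - 1) \<le> C * cmod (of_real (cmod \<xi> powr (-3/2)) :: complex))
      (inf at_infinity (principal {\<xi>. \<bar>Arg \<xi>\<bar> \<le> pi - \<delta>}))"
    unfolding bigo_def by auto
  then obtain b where b: "\<And>\<xi>. cmod \<xi> \<ge> b \<Longrightarrow> \<bar>Arg \<xi>\<bar> \<le> pi - \<delta> \<Longrightarrow> 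
      cmod (v \<xi> / lead \<xi> - 1) \<le> C * cmod \<xi> powr (-3/2)"
    unfolding eventually_inf_principal eventually_at_infinity by auto
  define R where "R = max b (max 1 (16 * C))"
  show ?thesis
  proof (rule that[of R C])
    fix \<xi> assume \<xi>: "cmod \<xi> \<ge> R" "\<bar>Arg \<xi>\<bar> \<le> pi - \<delta>"
    have "cmod \<xi> powr (-3/2) \<le> cmod \<xi> powr (-1)"
      using \<xi> by (intro powr_mono) (auto simp: R_def)
    also have "\<dots> = 1 / cmod \<xi>" using \<xi> by (simp add: R_def powr_minus divide_simps)
    finally have "C * cmod \<xi> powr (-3/2) \<le> C / cmod \<xi>"
      using mult_left_mono[of _ "1 / cmod \<xi>" C] C by simp
    also have "\<dots> \<le> 1 / 16"
      using \<xi> C by (subst pos_divide_le_eq) (auto simp: R_def)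
    finally show "cmod (v \<xi> / lead \<xi> - 1) \<le> C * cmod \<xi> powr (-3/2) \<and> cmod (v \<xi> / lead \<xi> - 1) \<le> 1/16"
      using b[of \<xi>] \<xi> by (auto simp: R_def)
  qed (use C in \<open>auto simp: R_def\<close>)
qed

text \<open>Here the argument of \<xi> is at most pi/4 in absolute value, that of its 3/2 power at
  most 3 pi/8, so the exponential is bounded by 1. The factor \<open>cmod \<xi> powr (-1/4)\<close>
  alone makes v small, whence the fourth power of 1/e in \<open>X\<close>.\<close>

lemma v_small_at_right:
  assumes "e > 0"
  obtains X where "X > 0" "\<And>\<xi>. Re \<xi> \<ge> X \<Longrightarrow> \<bar>Im \<xi>\<bar> \<le> Re \<xi> \<Longrightarrow> cmod (v \<xi>) < e \<and> v \<xi> \<noteq> 0"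
proof -
  obtain R C where RC: "R \<ge> 1" "C > 0" 
    "\<And>\<xi>. cmod \<xi> \<ge> R \<Longrightarrow> \<bar>Arg \<xi>\<bar> \<le> pi - pi/2 \<Longrightarrow>
        cmod (v \<xi> / lead \<xi> - 1) \<le> C * cmod \<xi> powr (-3/2) \<and> cmod (v \<xi> / lead \<xi> - 1) \<le> 1/16"
    using asymp[of "pi/2"] pi_gt_zero by auto
  define X where "X = max R ((1/e) powr 4 + 1)"
  show ?thesis
  proof (rule that[of X])
    fix \<xi> assume \<xi>: "Re \<xi> \<ge> X" "\<bar>Im \<xi>\<bar> \<le> Re \<xi>"
    have n: "cmod \<xi> \<ge> X" using \<xi> complex_Re_le_cmod[of \<xi>] by linarith
    have X1: "X \<ge> 1" using RC by (auto simp: X_def)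
    have nz: "\<xi> \<noteq> 0" using n X1 by auto
    have E: "cmod (v \<xi> / lead \<xi> - 1) \<le> 1/16"
      using RC(3)[of \<xi>] n \<xi> X1 Arg_Re_nonneg[of \<xi>] by (auto simp: X_def)
    then have "v \<xi> / lead \<xi> \<noteq> 0" by auto
    then have v: "v \<xi> \<noteq> 0" by auto
    have "Re (\<xi> powr (3/2)) = Re \<xi> * Re (csqrt \<xi>) - Im \<xi> * Im (csqrt \<xi>)"
      by (simp add: powr_three_halves_eq)
    also have "\<dots> \<ge> 0"
    proof -
      have "\<bar>Im (csqrt \<xi>)\<bar> \<le> Re (csqrt \<xi>)"
        using \<xi> X1 complex_Re_le_cmod[of \<xi>] by (auto simp: abs_mult)
      then have "\<bar>Im \<xi>\<bar> * \<bar>Im (csqrt \<xi>)\<bar> \<le> Re \<xi> * Re (csqrt \<xi>)"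
        using \<xi> by (intro mult_mono) auto
      moreover have "Im \<xi> * Im (csqrt \<xi>) \<le> \<bar>Im \<xi>\<bar> * \<bar>Im (csqrt \<xi>)\<bar>"
        by (metis abs_ge_self abs_mult)
      ultimately show ?thesis by linarith
    qed
    finally have "exp (- (2/3) * Re (\<xi> powr (3/2))) \<le> 1" by simp
    then have "cmod (lead \<xi>) \<le> 1 / (2 * sqrt pi * cmod \<xi> powr (1/4))"
      unfolding norm_lead by (intro divide_right_mono) auto
    also have "\<dots> \<le> 1 / (2 * cmod \<xi> powr (1/4))"
    proof (rule divide_left_mono)
      have "1 \<le> sqrt pi" using pi_ge_two by (simp add: real_le_rsqrt)
      then show "2 * cmod \<xi> powr (1/4) \<le> 2 * sqrt pi * cmod \<xi> powr (1/4)"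
        by (simp add: mult_right_mono)
    qed (use nz in auto)
    finally have l: "cmod (lead \<xi>) \<le> 1 / (2 * cmod \<xi> powr (1/4))" .
    have "cmod (v \<xi> / lead \<xi>) \<le> 2"
      using norm_triangle_ineq[of "v \<xi> / lead \<xi> - 1" 1] E by simp
    then have "cmod (v \<xi>) \<le> 2 * cmod (lead \<xi>)"
      using lead_nz[OF nz] by (simp add: norm_divide field_simps)
    also have "\<dots> \<le> 1 / cmod \<xi> powr (1/4)" using l by simp
    also have "\<dots> < e"
    proof -
      have "((1/e) powr 4) powr (1/4) < cmod \<xi> powr (1/4)"
        using n by (intro powr_less_mono2) (auto simp: X_def)
      then have "1/e < cmod \<xi> powr (1/4)" using assms powr_powr[of "1/e" 4 "1/4"] by simp
      then show ?thesis using assms nz by (simp add: field_simps)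
    qed
    finally show "cmod (v \<xi>) < e \<and> v \<xi> \<noteq> 0" using v by auto
  qed (use RC in \<open>auto simp: X_def\<close>)
qed

lemma v_tendsto_0: "((\<lambda>x. v (a + of_real x)) \<longlongrightarrow> 0) at_top"
proof (rule tendstoI)
  fix e :: real assume "e > 0"
  obtain X where X: "X > 0" "\<And>\<xi>. Re \<xi> \<ge> X \<Longrightarrow> \<bar>Im \<xi>\<bar> \<le> Re \<xi> \<Longrightarrow> cmod (v \<xi>) < e \<and> v \<xi> \<noteq> 0"
    using v_small_at_right[OF \<open>e > 0\<close>] by auto
  show "\<forall>\<^sub>F x in at_top. dist (v (a + of_real x)) 0 < e"
    using eventually_ge_at_top[of "X + \<bar>Re a\<bar> + \<bar>Im a\<bar>"]
    by eventually_elim (use X in auto)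
qed

text \<open>Cauchy's estimate on unit discs transfers the decay from v to its derivative; the
  summand 2 in the threshold leaves room for the disc.\<close>

lemma vd_tendsto_0: "((\<lambda>x. vd (a + of_real x)) \<longlongrightarrow> 0) at_top"
proof (rule tendstoI)
  fix e :: real assume "e > 0"
  obtain X where X: "X > 0" "\<And>\<xi>. Re \<xi> \<ge> X \<Longrightarrow> \<bar>Im \<xi>\<bar> \<le> Re \<xi> \<Longrightarrow> cmod (v \<xi>) < e/2 \<and> v \<xi> \<noteq> 0"
    using v_small_at_right[of "e/2"] \<open>e > 0\<close> by auto
  show "\<forall>\<^sub>F x in at_top. dist (vd (a + of_real x)) 0 < e"
    using eventually_ge_at_top[of "X + \<bar>Re a\<bar> + \<bar>Im a\<bar> + 2"]
  proof eventually_elim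
    case (elim x)
    have "cmod ((deriv ^^ 1) v (a + of_real x)) \<le> fact 1 * (e/2) / 1 ^ 1"
    proof (rule Cauchy_higher_deriv_bound[where y = 0])
      fix w assume "w \<in> ball (a + of_real x) 1"
      then have "cmod (a + of_real x - w) < 1" by (simp add: dist_norm)
      then have "\<bar>Re a + x - Re w\<bar> < 1" "\<bar>Im a - Im w\<bar> < 1"
        using abs_Re_le_cmod[of "a + of_real x - w"] abs_Im_le_cmod[of "a + of_real x - w"] by auto
      then show "v w \<in> ball 0 (e/2)" using X(2)[of w] elim X(1) by auto
    qed (auto intro: v_holo v_cont)
    then show ?case using \<open>e > 0\<close> by (simp add: vd_def)
  qed
qed

lemma v_nz_eventually: "\<forall>\<^sub>F x in at_top. v (a + of_real x) \<noteq> 0"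
proof -
  obtain X where X: "X > 0" "\<And>\<xi>. Re \<xi> \<ge> X \<Longrightarrow> \<bar>Im \<xi>\<bar> \<le> Re \<xi> \<Longrightarrow> cmod (v \<xi>) < 1 \<and> v \<xi> \<noteq> 0"
    using v_small_at_right[of 1] by auto
  show ?thesis
    using eventually_ge_at_top[of "X + \<bar>Re a\<bar> + \<bar>Im a\<bar>"]
    by eventually_elim (use X in auto)
qed

text \<open>Along the positive axis \<open>\<bar>v\<bar>\<^sup>2\<close> is convex and tends to \<open>0\<close>.\<close>

lemma Re_cnj_v_vd_neg:
  assumes "x0 \<ge> 0"
  shows "Re (cnj (v (of_real x0)) * vd (of_real x0)) < 0"
proof (rule ccontr)
  assume "\<not> ?thesis"
  define G where "G = (\<lambda>x. Re (cnj (v (of_real x)) * vd (of_real x)))"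
  define g where "g = (\<lambda>x. Re (cnj (v (of_real x)) * v (of_real x)))"
  note dv = v_vector_deriv[of 0 1, simplified] and dvd = vd_vector_deriv[of 0 1, simplified]
  have dG: "(G has_real_derivative ((cmod (vd (of_real x)))\<^sup>2 + x * (cmod (v (of_real x)))\<^sup>2)) (at x)" for x
  proof -
    have "((\<lambda>x. cnj (v (of_real x)) * vd (of_real x)) has_vector_derivative 
        (cnj (v (of_real x)) * (of_real x * v (of_real x)) + cnj (vd (of_real x)) * vd (of_real x))) (at x)"
      by (intro has_vector_derivative_mult has_vector_derivative_cnj dv dvd)
    from has_real_derivative_Re[OF this] show ?thesis
      unfolding G_def cmod_power2 by (rule back_subst) (simp add: power2_eq_square algebra_simps)
  qed
  have dg: "(g has_real_derivative 2 * G x) (at x)" for x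
  proof -
    have "((\<lambda>x. cnj (v (of_real x)) * v (of_real x)) has_vector_derivative 
        (cnj (v (of_real x)) * vd (of_real x) + cnj (vd (of_real x)) * v (of_real x))) (at x)"
      by (intro has_vector_derivative_mult has_vector_derivative_cnj dv dvd)
    from has_real_derivative_Re[OF this] show ?thesis
      unfolding G_def g_def by (rule back_subst) (simp add: algebra_simps)
  qed
  have G: "G x \<ge> 0" if "x \<ge> x0" for x
  proof -
    have "G x0 \<le> G x"
      by (rule DERIV_nonneg_imp_nondecreasing[OF that]) (use dG assms in \<open>force intro!: add_nonneg_nonneg mult_nonneg_nonneg\<close>)
    then show ?thesis using \<open>\<not> _\<close> by (simp add: G_def)
  qed
  have g_mono: "g x \<le> g y" if "x0 \<le> x" "x \<le> y" for x y
    by (rule DERIV_nonneg_imp_nondecreasing[OF that(2)]) (use dg G that in \<open>force\<close>)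
  have g_eq: "g x = (cmod (v (of_real x)))\<^sup>2" for x
    unfolding cmod_power2 by (simp add: g_def power2_eq_square)
  have "(g \<longlongrightarrow> (cmod 0)\<^sup>2) at_top"
    unfolding g_eq[abs_def] using v_tendsto_0[of 0] by (intro tendsto_intros) simp
  then have lim: "(g \<longlongrightarrow> 0) at_top" by simp
  obtain x where x: "x \<ge> x0" "v (of_real x) \<noteq> 0"
    using eventually_happens[OF eventually_conj[OF v_nz_eventually[of 0] eventually_ge_at_top[of x0]]] by auto
  have "g x \<le> 0"
    by (rule tendsto_lowerbound[OF lim]) (use eventually_ge_at_top[of x] in \<open>eventually_elim, use g_mono x in auto\<close>)
  then show False using x by (simp add: g_eq)
qed

lemma v_nz_nonneg: "x \<ge> 0 \<Longrightarrow> v (of_real x) \<noteq> 0"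
  using Re_cnj_v_vd_neg[of x] by auto

text \<open>Along \<open>a + x\<close> the function \<open>Im (cnj v * v')\<close> is strictly monotone and tends to \<open>0\<close>, so it cannot
  vanish at \<open>x = 0\<close>.\<close>

lemma v_nz_nonreal:
  assumes "Im a \<noteq> 0"
  shows "v a \<noteq> 0"
proof
  assume va: "v a = 0"
  \<comment> \<open>The extra factor \<open>Im a\<close> makes the derivative a square, hence
    nonnegative for either sign of \<open>Im a\<close>.\<close>
  define Q where "Q = (\<lambda>x. Im a * Im (cnj (v (a + of_real x)) * vd (a + of_real x)))"
  note dv = v_vector_deriv[of a 1, simplified] and dvd = vd_vector_deriv[of a 1, simplified]
  have dQ: "(Q has_real_derivative (Im a)\<^sup>2 * (cmod (v (a + of_real x)))\<^sup>2) (at x)" for x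
  proof -
    have "((\<lambda>x. cnj (v (a + of_real x)) * vd (a + of_real x)) has_vector_derivative 
        (cnj (v (a + of_real x)) * ((a + of_real x) * v (a + of_real x)) + cnj (vd (a + of_real x)) * vd (a + of_real x))) (at x)"
      by (intro has_vector_derivative_mult has_vector_derivative_cnj dv dvd)
    from DERIV_cmult[OF has_real_derivative_Im[OF this], of "Im a"] show ?thesis
      unfolding Q_def cmod_power2 by (rule back_subst) (simp add: power2_eq_square algebra_simps)
  qed
  have Q_mono: "Q x \<le> Q y" if "x \<le> y" for x y
    by (rule DERIV_nonneg_imp_nondecreasing[OF that]) (use dQ in force)
  have "(Q \<longlongrightarrow> Im a * Im (cnj 0 * 0)) at_top"
    unfolding Q_def by (intro tendsto_intros v_tendsto_0 vd_tendsto_0)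
  then have lim: "(Q \<longlongrightarrow> 0) at_top" by simp
  have up: "Q x \<le> 0" for x
    by (rule tendsto_lowerbound[OF lim]) (use eventually_ge_at_top[of x] in \<open>eventually_elim, use Q_mono in auto\<close>)
  have Q0: "Q 0 = 0" using va by (simp add: Q_def)
  \<comment> \<open>Q is nondecreasing, at most 0, and 0 at the start, so it vanishes on the half
    line. Its derivative is then 0 at an interior point where v is nonzero.\<close>
  have Qz: "Q x = 0" if "x \<ge> 0" for x
    using up[of x] Q_mono[OF that] Q0 by linarith
  obtain x where x: "x > 0" "v (a + of_real x) \<noteq> 0"
    using eventually_happens[OF eventually_conj[OF v_nz_eventually[of a] eventually_gt_at_top[of 0]]] by auto
  have "(Im a)\<^sup>2 * (cmod (v (a + of_real x)))\<^sup>2 = 0"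
  proof (rule DERIV_local_min[OF dQ x(1)])
    show "\<forall>y. \<bar>x - y\<bar> < x \<longrightarrow> Q x \<le> Q y" using Qz x by auto
  qed
  then show False using x assms by auto
qed

end

subsection \<open>Wronskians, connection formula and the phase\<close>

context airy
begin

lemma v_deriv' [derivative_intros]:
  "(f has_field_derivative f') (at z) \<Longrightarrow> ((\<lambda>z. v (f z)) has_field_derivative vd (f z) * f') (at z)"
  by (rule DERIV_chain2[OF v_deriv])

lemma vd_deriv' [derivative_intros]:
  "(f has_field_derivative f') (at z) \<Longrightarrow> ((\<lambda>z. vd (f z)) has_field_derivative (f z * v (f z)) * f') (at z)"
  by (rule DERIV_chain2[OF vd_deriv])

lemma lead_of_real_pos: "x > 0 \<Longrightarrow> \<exists>y>0. lead (of_real x) = of_real y"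
proof -
  assume "x > 0"
  then have "lead (of_real x) = of_real (exp (- (2/3) * x powr (3/2)) / (2 * sqrt pi * x powr (1/4)))"
    using powr_of_real[of x "3/2"] powr_of_real[of x "1/4"]
    by (simp add: lead_def flip: exp_of_real)
  moreover have "exp (- (2/3) * x powr (3/2)) / (2 * sqrt pi * x powr (1/4)) > 0"
    using \<open>x > 0\<close> by simp
  ultimately show ?thesis by blast
qed

lemma v_over_lead_tendsto: "((\<lambda>x. v (of_real x) / lead (of_real x)) \<longlongrightarrow> 1) at_top"
proof -
  obtain R C where RC: "R \<ge> 1" "C > 0" 
    "\<And>\<xi>. cmod \<xi> \<ge> R \<Longrightarrow> \<bar>Arg \<xi>\<bar> \<le> pi - pi/2 \<Longrightarrow>
        cmod (v \<xi> / lead \<xi> - 1) \<le> C * cmod \<xi> powr (-3/2) \<and> cmod (v \<xi> / lead \<xi> - 1) \<le> 1/16"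
    using asymp[of "pi/2"] pi_gt_zero by auto
  have "((\<lambda>x. v (of_real x) / lead (of_real x) - 1) \<longlongrightarrow> 0) at_top"
  proof (rule Lim_null_comparison)
    show "\<forall>\<^sub>F x in at_top. cmod (v (of_real x) / lead (of_real x) - 1) \<le> C * x powr (-3/2)"
      using eventually_ge_at_top[of "R"]
    proof eventually_elim
      case (elim x)
      then show ?case using RC(3)[of "of_real x"] RC(1) by auto
    qed
    have "((\<lambda>x::real. C * x powr (-3/2)) \<longlongrightarrow> C * 0) at_top"
      by (intro tendsto_intros tendsto_neg_powr filterlim_ident) auto
    then show "((\<lambda>x::real. C * x powr (-3/2)) \<longlongrightarrow> 0) at_top" by simp
  qed
  then show ?thesis by (rule LIM_zero_cancel)
qed

text \<open>The reflected function \<open>w\<close> solves the same equation, and its Wronskian with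
  v is constant and tends to 0 along the real axis. So v / w is constant on the right half plane.
  The constant is 1 because \<open>lead\<close> is positive on the axis and v / \<open>lead\<close>
  tends to 1 there; the identity theorem does the rest.\<close>

lemma v_cnj: "v (cnj \<xi>) = cnj (v \<xi>)"
proof -
  define w where "w = cnj \<circ> v \<circ> cnj"
  define wd where "wd = cnj \<circ> vd \<circ> cnj"
  have dw: "(w has_field_derivative wd z) (at z)" for z
    using has_field_derivative_cnj_cnj[OF v_deriv[of "cnj z"]] by (simp add: w_def wd_def)
  have dwd: "(wd has_field_derivative z * w z) (at z)" for z
    using has_field_derivative_cnj_cnj[OF vd_deriv[of "cnj z"]] by (simp add: w_def wd_def)
  define W where "W z = v z * wd z - vd z * w z" for z
  have "(W has_field_derivative 0) (at z within UNIV)" for z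
    unfolding W_def
    by (rule derivative_eq_intros dw dwd v_deriv vd_deriv refl | simp)+
  then obtain c where c: "\<And>z. W z = c"
    using has_field_derivative_zero_constant[of UNIV W] by auto
  have "((\<lambda>x. W (of_real x)) \<longlongrightarrow> 0 * cnj 0 - 0 * cnj 0) at_top"
    unfolding W_def w_def wd_def o_def complex_cnj_complex_of_real
    by (intro tendsto_intros) (use v_tendsto_0[of 0] vd_tendsto_0[of 0] in simp_all)
  then have "((\<lambda>x::real. c) \<longlongrightarrow> 0) at_top" by (simp add: c)
  then have "c = 0" by (simp add: tendsto_const_iff)
  then have W0: "v z * wd z = vd z * w z" for z using c[of z] by (simp add: W_def)
  have nz: "v z \<noteq> 0" if "Re z > 0" for z
    using v_nz_nonreal[of z] v_nz_nonneg[of "Re z"] that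
    by (cases "Im z = 0") (auto simp: complex_is_Real_iff of_real_Re complex_eq_iff)
  have wnz: "w z \<noteq> 0" if "Re z > 0" for z
    using nz[of "cnj z"] that by (auto simp: w_def)
  have "((\<lambda>z. v z / w z) has_field_derivative 0) (at z within {z. Re z > 0})" if "Re z > 0" for z
    by (rule has_field_derivative_at_within)
       (rule derivative_eq_intros dw v_deriv refl | use W0[of z] wnz[OF that] in \<open>simp add: divide_simps mult.commute\<close>)+
  then obtain k where k: "\<And>z. Re z > 0 \<Longrightarrow> v z / w z = k"
    using has_field_derivative_zero_constant[OF convex_halfspace_Re_gt, of 0 "\<lambda>z. v z / w z"] by auto
  have "((\<lambda>x. (v (of_real x) / lead (of_real x)) / cnj (v (of_real x) / lead (of_real x))) \<longlongrightarrow> 1 / cnj 1) at_top"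
    by (intro tendsto_intros v_over_lead_tendsto) auto
  moreover have "\<forall>\<^sub>F x in at_top. (v (of_real x) / lead (of_real x)) / cnj (v (of_real x) / lead (of_real x)) = k"
    using eventually_gt_at_top[of 0]
  proof eventually_elim
    case (elim x)
    obtain y where "y > 0" "lead (of_real x) = of_real y" using lead_of_real_pos[OF elim] by auto
    then show ?case using k[of "of_real x"] elim by (simp add: w_def)
  qed
  ultimately have "((\<lambda>x::real. k) \<longlongrightarrow> 1) at_top"
    using tendsto_cong by fastforce
  then have "k = 1" by (simp add: tendsto_const_iff)
  then have eq: "v z = w z" if "Re z > 0" for z
    using k[OF that] wnz[OF that] by (simp add: field_simps)
  have "v z = w z" for z
  proof (rule analytic_continuation_open[where s = "{z. Re z > 0}" and s' = UNIV and f = v and g = w])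
    show "{z. Re z > 0} \<noteq> {}" by (rule ex_in_conv[THEN iffD1]) (rule exI[of _ 1], simp)
    show "w holomorphic_on UNIV" using dw by (metis DERIV_subset holomorphic_on_def field_differentiable_def UNIV_I subset_UNIV has_field_derivative_at_within)
  qed (auto simp: open_halfspace_Re_gt v_holo eq)
  from this[of "cnj \<xi>"] show ?thesis by (simp add: w_def)
qed

lemma v_of_real_real: "Im (v (of_real x)) = 0"
  using v_cnj[of "of_real x"] by (simp add: complex_eq_iff)

lemma vd_of_real_real: "Im (vd (of_real x)) = 0"
proof -
  have "((\<lambda>x. Im (v (of_real x))) has_real_derivative Im (vd (of_real x))) (at x)"
    by (rule has_real_derivative_Im) (use v_vector_deriv[of 0 1 x] in simp)
  moreover have "((\<lambda>x. Im (v (of_real x))) has_real_derivative 0) (at x)"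
    by (simp add: v_of_real_real)
  ultimately show ?thesis using DERIV_unique by blast
qed

text \<open>The Wronskian of \<open>v (al * z)\<close> and \<open>v (be * z)\<close> divided by the
  imaginary unit; for Ai it equals 1 / (2 pi). Its sign comes from \<open>Re_cnj_v_vd_neg\<close> at
  0.\<close>

definition kappa :: real where "kappa = - sqrt 3 * Re (v 0 * vd 0)"

lemma v0_vd0: "v 0 * vd 0 = of_real (- kappa / sqrt 3)" and kappa_pos: "kappa > 0"
proof -
  have im: "Im (v 0) = 0" "Im (vd 0) = 0" using v_of_real_real[of 0] vd_of_real_real[of 0] by auto
  then show "v 0 * vd 0 = of_real (- kappa / sqrt 3)" by (simp add: kappa_def complex_eq_iff)
  have "Re (v 0 * vd 0) < 0" using Re_cnj_v_vd_neg[of 0] im by simp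
  then show "kappa > 0" by (simp add: kappa_def mult_pos_neg)
qed

lemma v0_nz: "v 0 \<noteq> 0" using v_nz_nonneg[of 0] by simp

text \<open>The derivative is a multiple of \<open>be^3 - al^3\<close>, which is 0; the value at 0
  is \<open>be - al\<close> times \<open>v 0 * vd 0\<close>.\<close>

lemma wronskian_al_be:
  "be * vd (be * z) * v (al * z) - al * vd (al * z) * v (be * z) = \<i> * kappa"
proof -
  define W where "W z = be * vd (be * z) * v (al * z) - al * vd (al * z) * v (be * z)" for z
  have "(W has_field_derivative 0) (at z within UNIV)" for z
  proof -
    have "(W has_field_derivative (be^3 - al^3) * z * v (be * z) * v (al * z)) (at z)"
      unfolding W_def
      by (rule derivative_eq_intros refl)+ (simp add: algebra_simps power3_eq_cube)
    then show ?thesis by (simp add: al_be)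
  qed
  then obtain c where c: "\<And>z. W z = c"
    using has_field_derivative_zero_constant[of UNIV W] by auto
  have "W 0 = (be - al) * (v 0 * vd 0)" by (simp add: W_def algebra_simps)
  also have "\<dots> = \<i> * kappa"
    by (simp add: v0_vd0 complex_eq_iff al_eq be_eq)
  finally show ?thesis using c[of z] c[of 0] by (simp add: W_def)
qed

lemma wronskian_al:
  "vd b * v (- al * b) + al * v b * vd (- al * b) = (1 + al) * (v 0 * vd 0)"
proof -
  define W where "W z = vd z * v (- al * z) + al * v z * vd (- al * z)" for z
  have "(W has_field_derivative 0) (at z within UNIV)" for z
  proof -
    have "(W has_field_derivative (1 + al^3) * z * v z * v (- al * z)) (at z)"
      unfolding W_def
      by (rule derivative_eq_intros v_deriv vd_deriv refl)+ (simp add: algebra_simps power3_eq_cube)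
    then show ?thesis by (simp add: al_be)
  qed
  then obtain c where c: "\<And>z. W z = c"
    using has_field_derivative_zero_constant[of UNIV W] by auto
  have "W 0 = (1 + al) * (v 0 * vd 0)" by (simp add: W_def algebra_simps)
  then show ?thesis using c[of b] c[of 0] by (simp add: W_def)
qed

lemma wronskian_al_nz: "(1 + al) * (v 0 * vd 0) \<noteq> 0"
  using kappa_pos by (auto simp: v0_vd0 al_eq complex_eq_iff)

text \<open>The difference f of the two sides satisfies f'' = - z f with zero data at 0, so its
  Wronskians with \<open>v (al * z)\<close> and with \<open>v (be * z)\<close> both vanish. As these
  two solutions have a nonzero Wronskian, f is 0 by Cramer's rule.\<close>

lemma connection: "v (- z) = al * v (al * z) + be * v (be * z)"
proof -
  define f where "f z = al * v (al * z) + be * v (be * z) - v (- z)" for z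
  define fd where "fd z = al^2 * vd (al * z) + be^2 * vd (be * z) + vd (- z)" for z
  have df: "(f has_field_derivative fd z) (at z)" for z
    unfolding f_def fd_def
    by (rule derivative_eq_intros refl)+ (simp add: power2_eq_square)
  have dfd: "(fd has_field_derivative - z * f z) (at z)" for z
  proof -
    have "(fd has_field_derivative al^3 * z * (al * v (al * z)) + be^3 * z * (be * v (be * z)) + z * v (- z)) (at z)"
      unfolding fd_def
      by (rule derivative_eq_intros refl)+ (simp add: power2_eq_square power3_eq_cube algebra_simps)
    then show ?thesis
      by (rule back_subst) (unfold f_def al_be, simp add: algebra_simps)
  qed
  have f0: "f 0 = 0"
  proof -
    have "f 0 = (al + be - 1) * v 0" by (simp add: f_def algebra_simps)
    then show ?thesis unfolding al_be(3) by simp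
  qed
  have fd0: "fd 0 = 0"
  proof -
    have "fd 0 = (1 - (al + be)) * vd 0" unfolding fd_def al_be(6,7) by (simp add: algebra_simps)
    then show ?thesis unfolding al_be(3) by simp
  qed
  have W: "f z * (c * vd (c * z)) = fd z * v (c * z)" if "c ^ 3 = -1" for c z
  proof -
    define W where "W z = f z * (c * vd (c * z)) - fd z * v (c * z)" for z
    have "(W has_field_derivative 0) (at z within UNIV)" for z
    proof -
      have "(W has_field_derivative (c^3 + 1) * z * f z * v (c * z)) (at z)"
        unfolding W_def
        by (rule derivative_eq_intros df dfd refl)+ (simp add: algebra_simps power3_eq_cube)
      then show ?thesis by (simp add: that)
    qed
    then obtain k where k: "\<And>z. W z = k"
      using has_field_derivative_zero_constant[of UNIV W] by auto
    have "W 0 = 0" by (simp add: W_def f0 fd0)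
    then show ?thesis using k[of 0] k[of z] by (simp add: W_def)
  qed
  have "f z * (be * vd (be * z) * v (al * z) - al * vd (al * z) * v (be * z)) = 
        (f z * (be * vd (be * z))) * v (al * z) - (f z * (al * vd (al * z))) * v (be * z)"
    by (simp add: algebra_simps)
  also have "\<dots> = 0"
    unfolding W[OF al_be(4)] W[OF al_be(5)] by simp
  finally have "f z = 0" using kappa_pos by (simp add: wronskian_al_be)
  then show ?thesis by (simp add: f_def)
qed

text \<open>A logarithm of v is wanted on an open convex set that contains \<open>al * z\<close> and
  \<open>be * z\<close> for all z in the cone, including z = 0; this forces a half plane reaching
  slightly beyond the imaginary axis.\<close>

lemma exists_halfplane:
  obtains d where "d > 0" "\<And>\<xi>. Re \<xi> > - d \<Longrightarrow> v \<xi> \<noteq> 0"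
proof -
  have "isCont v 0" using v_deriv DERIV_isCont by blast
  then obtain d where d: "d > 0" "\<And>\<xi>. cmod \<xi> < d \<Longrightarrow> v \<xi> \<noteq> 0"
    using continuous_at_avoid[of 0 v 0] v0_nz by (auto simp: dist_norm)
  show ?thesis
  proof (rule that[OF d(1)])
    fix \<xi> assume \<xi>: "Re \<xi> > - d"
    show "v \<xi> \<noteq> 0"
    proof (cases "Im \<xi> = 0")
      case True
      then have eq: "\<xi> = of_real (Re \<xi>)" by (simp add: complex_eq_iff)
      show ?thesis
      proof (cases "Re \<xi> \<ge> 0")
        case True
        then show ?thesis using v_nz_nonneg[of "Re \<xi>"] eq by simp
      next
        case False
        have "cmod \<xi> = \<bar>Re \<xi>\<bar>" by (subst eq) (simp only: norm_of_real)
        then show ?thesis using d(2)[of \<xi>] \<xi> False by auto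
      qed
    qed (rule v_nz_nonreal)
  qed
qed

text \<open>The slope 1/2 is below 1 / sqrt 3, the tangent of 30 degrees, so a rotation by 60
  degrees either way stays in the closed right half plane.\<close>

definition cone :: "complex set" where "cone = {z. \<bar>Im z\<bar> \<le> Re z / 2}"

lemma Re_al_be_cone:
  assumes "z \<in> cone" shows "Re (al * z) \<ge> 0" "Re (be * z) \<ge> 0"
proof -
  have "sqrt 3 \<le> 2" by (rule real_le_lsqrt) auto
  then have "sqrt 3 / 2 * \<bar>Im z\<bar> \<le> 1 * \<bar>Im z\<bar>" by (intro mult_right_mono) auto
  then have "\<bar>sqrt 3 / 2 * Im z\<bar> \<le> Re z / 2" using assms by (simp add: abs_mult cone_def)
  then show "Re (al * z) \<ge> 0" "Re (be * z) \<ge> 0" by (auto simp: al_eq be_eq)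
qed

lemma v_al_be_cone_nz: "z \<in> cone \<Longrightarrow> v (al * z) \<noteq> 0" "z \<in> cone \<Longrightarrow> v (be * z) \<noteq> 0"
  using exists_halfplane Re_al_be_cone by (metis neg_0_less_iff_less less_le_trans neg_less_0_iff_less)+

lemma of_real_cone: "x \<ge> 0 \<Longrightarrow> of_real x \<in> cone" by (simp add: cone_def)

text \<open>\<open>\<Psi>\<close> is the logarithm of the quotient that vanishes at 0. In the last
  clause 4/3 is the sum of the two exponents 2/3 of \<open>lead\<close>, and pi/6 is the phase
  difference of the reciprocal quarter powers at \<open>be * s\<close> and
  \<open>al * s\<close>.\<close>

definition is_Psi :: "(complex \<Rightarrow> complex) \<Rightarrow> bool" where
  "is_Psi \<Psi> \<longleftrightarrow> \<Psi> 0 = 0 \<and>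
     (\<forall>z\<in>cone. (\<Psi> has_field_derivative \<i> * kappa / (v (al * z) * v (be * z))) (at z) \<and>
        exp (\<Psi> z) = v (be * z) / v (al * z)) \<and>
     (\<exists>R\<ge>1. \<exists>C. \<forall>s\<ge>R. cmod (\<Psi> (of_real s) - \<i> * of_real (4/3 * s powr (3/2) + pi/6)) \<le> C * s powr (-3/2))"

text \<open>The logarithm of \<open>v\<close> is known at infinity only up to a constant multiple of \<open>2 pi i\<close>; it cancels
  in the difference \<open>\<Psi>\<close>, so that the zeros are counted from the correct index.\<close>

lemma exists_Psi: "\<exists>\<Psi>. is_Psi \<Psi>"
proof -
  obtain d where d: "d > 0" "\<And>\<xi>. Re \<xi> > - d \<Longrightarrow> v \<xi> \<noteq> 0" using exists_halfplane by blast
  define H where "H = {\<xi>. Re \<xi> > - d}"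
  have H: "open H" "convex H" unfolding H_def by (auto simp: open_halfspace_Re_gt convex_halfspace_Re_gt)
  obtain L where L: "L holomorphic_on H" "\<And>\<xi>. \<xi> \<in> H \<Longrightarrow> v \<xi> = exp (L \<xi>)"
    using contractible_imp_holomorphic_log[OF v_holo convex_imp_contractible[OF H(2)]] d(2) unfolding H_def by auto
  have dL: "(L has_field_derivative vd \<xi> / v \<xi>) (at \<xi>)" if "\<xi> \<in> H" for \<xi>
  proof -
    have 1: "(L has_field_derivative deriv L \<xi>) (at \<xi>)"
      using holomorphic_derivI[OF L(1) H(1) that] .
    have "(v has_field_derivative exp (L \<xi>) * deriv L \<xi>) (at \<xi>)"
    proof (rule has_field_derivative_transform_within_open[OF _ H(1) that])
      show "((\<lambda>z. exp (L z)) has_field_derivative exp (L \<xi>) * deriv L \<xi>) (at \<xi>)"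
        by (rule derivative_eq_intros 1 refl)+
    qed (simp add: L(2))
    then have "vd \<xi> = v \<xi> * deriv L \<xi>" using v_deriv DERIV_unique L(2)[OF that] by metis
    then show ?thesis using 1 d(2)[of \<xi>] that by (simp add: H_def)
  qed
  define \<Psi> where "\<Psi> z = L (be * z) - L (al * z)" for z
  have inH: "al * z \<in> H" "be * z \<in> H" if "z \<in> cone" for z
    using Re_al_be_cone[OF that] d(1) by (auto simp: H_def)
  show ?thesis
  proof (rule exI[of _ \<Psi>], unfold is_Psi_def, intro conjI ballI)
    show "\<Psi> 0 = 0" by (simp add: \<Psi>_def)
  next
    fix z assume z: "z \<in> cone"
    have "(\<Psi> has_field_derivative (vd (be * z) / v (be * z) * be - vd (al * z) / v (al * z) * al)) (at z)"
      unfolding \<Psi>_def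
      by (rule derivative_eq_intros DERIV_chain2[OF dL] inH z refl)+ simp
    moreover have "vd (be * z) / v (be * z) * be - vd (al * z) / v (al * z) * al = \<i> * kappa / (v (al * z) * v (be * z))"
      using v_al_be_cone_nz[OF z] unfolding wronskian_al_be[of z, symmetric] by (simp add: field_simps)
    ultimately show "(\<Psi> has_field_derivative \<i> * kappa / (v (al * z) * v (be * z))) (at z)" by simp
    show "exp (\<Psi> z) = v (be * z) / v (al * z)"
      using L(2)[OF inH(1)[OF z]] L(2)[OF inH(2)[OF z]] by (simp add: \<Psi>_def exp_diff)
  next
    obtain R C where RC: "R \<ge> 1" "C > 0" 
      "\<And>\<xi>. cmod \<xi> \<ge> R \<Longrightarrow> \<bar>Arg \<xi>\<bar> \<le> pi - pi/2 \<Longrightarrow>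
        cmod (v \<xi> / lead \<xi> - 1) \<le> C * cmod \<xi> powr (-3/2) \<and> cmod (v \<xi> / lead \<xi> - 1) \<le> 1/16"
      using asymp[of "pi/2"] pi_gt_zero by auto
    define T where "T = {\<xi>. Re \<xi> > R}"
    have T: "open T" "convex T" unfolding T_def by (auto simp: open_halfspace_Re_gt convex_halfspace_Re_gt)
    have E: "cmod (v \<xi> / lead \<xi> - 1) \<le> C * cmod \<xi> powr (-3/2)" "cmod (v \<xi> / lead \<xi> - 1) \<le> 1/16"
      if "\<xi> \<in> T" for \<xi>
      using RC(3)[of \<xi>] RC(1) that Arg_Re_nonneg[of \<xi>] complex_Re_le_cmod[of \<xi>] by (auto simp: T_def)
    have Tnp: "\<xi> \<notin> \<real>\<^sub>\<le>\<^sub>0" "\<xi> \<noteq> 0" "\<xi> \<in> H" if "\<xi> \<in> T" for \<xi>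
      using that RC(1) d(1) by (auto simp: T_def H_def complex_nonpos_Reals_iff)
    define \<rho> where "\<rho> \<xi> = v \<xi> / lead \<xi>" for \<xi>
    have \<rho>pos: "Re (\<rho> \<xi>) > 0" if "\<xi> \<in> T" for \<xi>
      using E(2)[OF that] abs_Re_le_cmod[of "\<rho> \<xi> - 1"] by (auto simp: \<rho>_def)
    have \<rho>np: "\<rho> \<xi> \<notin> \<real>\<^sub>\<le>\<^sub>0" "\<rho> \<xi> \<noteq> 0" if "\<xi> \<in> T" for \<xi>
      using \<rho>pos[OF that] by (auto simp: complex_nonpos_Reals_iff)
    \<comment> \<open>\<open>N\<close> compares the global logarithm \<open>L\<close> with the
      explicit principal logarithms of the factors of v. Since exp N = 1 on the convex set
      \<open>T\<close>, it is constant there, and the constant cancels in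
      \<open>\<Psi>\<close>.\<close>
    define N where "N \<xi> = L \<xi> + 2/3 * \<xi> powr (3/2) + 1/4 * Ln \<xi> + Ln (2 * of_real (sqrt pi)) - Ln (\<rho> \<xi>)" for \<xi>
    have holo\<rho>: "\<rho> holomorphic_on T"
      unfolding \<rho>_def lead_def by (intro holomorphic_intros v_holo) (use Tnp in auto)
    have holo: "N holomorphic_on T"
      unfolding N_def
      by (intro holomorphic_intros holo\<rho> holomorphic_on_subset[OF L(1)]) (use Tnp \<rho>np in auto)
    have expN: "exp (N \<xi>) = 1" if "\<xi> \<in> T" for \<xi>
    proof -
      have "exp (1/4 * Ln \<xi>) = \<xi> powr (1/4)" using Tnp[OF that] by (simp add: powr_def)
      then have "exp (N \<xi>) = v \<xi> * exp (2/3 * \<xi> powr (3/2)) * \<xi> powr (1/4) * (2 * of_real (sqrt pi)) / \<rho> \<xi>"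
        using Tnp[OF that] \<rho>np[OF that] L(2) by (simp add: N_def exp_add exp_diff)
      also have "\<dots> = 1"
        using Tnp[OF that] \<rho>np[OF that] d(2)[of \<xi>] by (simp add: \<rho>_def lead_def exp_minus field_simps H_def)
      finally show ?thesis .
    qed
    have "(N has_field_derivative 0) (at \<xi> within T)" if "\<xi> \<in> T" for \<xi>
    proof -
      have 1: "(N has_field_derivative deriv N \<xi>) (at \<xi>)"
        using holomorphic_derivI[OF holo T(1) that] .
      have "((\<lambda>_. 1) has_field_derivative exp (N \<xi>) * deriv N \<xi>) (at \<xi>)"
      proof (rule has_field_derivative_transform_within_open[OF _ T(1) that])
        show "((\<lambda>z. exp (N z)) has_field_derivative exp (N \<xi>) * deriv N \<xi>) (at \<xi>)"
          by (rule derivative_eq_intros 1 refl)+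
      qed (simp add: expN)
      then have "exp (N \<xi>) * deriv N \<xi> = 0" using DERIV_unique DERIV_const by blast
      then show ?thesis using 1 by (simp add: has_field_derivative_at_within)
    qed
    then obtain N0 where N0: "\<And>\<xi>. \<xi> \<in> T \<Longrightarrow> N \<xi> = N0"
      using has_field_derivative_zero_constant[OF T(2), of N] by auto
    have Leq: "L \<xi> = N0 + Ln (\<rho> \<xi>) - 2/3 * \<xi> powr (3/2) - 1/4 * Ln \<xi> - Ln (2 * of_real (sqrt pi))" if "\<xi> \<in> T" for \<xi>
      using N0[OF that] by (simp add: N_def algebra_simps)
    have Ln\<rho>: "cmod (Ln (\<rho> \<xi>)) \<le> 2 * (C * cmod \<xi> powr (-3/2))" if "\<xi> \<in> T" for \<xi>
      using norm_Ln_le[of "\<rho> \<xi> - 1"] E[OF that] by (simp add: \<rho>_def)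
    show "\<exists>R\<ge>1. \<exists>C. \<forall>s\<ge>R. cmod (\<Psi> (of_real s) - \<i> * of_real (4/3 * s powr (3/2) + pi/6)) \<le> C * s powr (-3/2)"
    \<comment> \<open>\<open>al * s\<close> and \<open>be * s\<close> have real part s/2, so s >= 2
      R + 1 puts both into \<open>T\<close>.\<close>
    proof (rule exI[of _ "2 * R + 1"], intro conjI exI[of _ "4 * C"] allI impI)
      fix s assume s: "s \<ge> 2 * R + 1"
      then have s0: "s > 0" using RC(1) by auto
      have T1: "al * of_real s \<in> T" "be * of_real s \<in> T" using s by (auto simp: T_def al_eq be_eq)
      have Arg: "Arg (of_real s) = 0" using s0 by simp
      have pal: "(al * of_real s) powr (3/2) = \<i> * of_real (s powr (3/2))"
        using cis_times_powr[of "of_real s" "pi/3" "3/2"] s0 powr_of_real[of s "3/2"] by (simp add: Arg)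
      have pbe: "(be * of_real s) powr (3/2) = - \<i> * of_real (s powr (3/2))"
        using cis_times_powr[of "of_real s" "-(pi/3)" "3/2"] s0 powr_of_real[of s "3/2"] pi_gt_zero
        by (simp add: Arg complex_eq_iff)
      have lal: "Ln (al * of_real s) = Ln (of_real s) + \<i> * of_real (pi/3)"
        using Ln_cis_times[of "of_real s" "pi/3"] s0 by (simp add: Arg)
      have lbe: "Ln (be * of_real s) = Ln (of_real s) - \<i> * of_real (pi/3)"
        using Ln_cis_times[of "of_real s" "-(pi/3)"] s0 pi_gt_zero by (simp add: Arg)
      have "\<Psi> (of_real s) = (Ln (\<rho> (be * of_real s)) - Ln (\<rho> (al * of_real s)))
          - 2/3 * ((be * of_real s) powr (3/2) - (al * of_real s) powr (3/2))
          - 1/4 * (Ln (be * of_real s) - Ln (al * of_real s))"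
        unfolding \<Psi>_def Leq[OF T1(1)] Leq[OF T1(2)] by (simp add: algebra_simps)
      also have "\<dots> = (Ln (\<rho> (be * of_real s)) - Ln (\<rho> (al * of_real s))) + \<i> * of_real (4/3 * s powr (3/2) + pi/6)"
        unfolding pal pbe lal lbe by (simp add: algebra_simps)
      finally have "cmod (\<Psi> (of_real s) - \<i> * of_real (4/3 * s powr (3/2) + pi/6)) \<le> 
         cmod (Ln (\<rho> (be * of_real s))) + cmod (Ln (\<rho> (al * of_real s)))"
        using norm_triangle_ineq4[of "Ln (\<rho> (be * of_real s))" "Ln (\<rho> (al * of_real s))"] by simp
      also have "\<dots> \<le> 2 * (C * s powr (-3/2)) + 2 * (C * s powr (-3/2))"
        using Ln\<rho>[OF T1(1)] Ln\<rho>[OF T1(2)] s0 by (simp add: norm_mult)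
      finally show "cmod (\<Psi> (of_real s) - \<i> * of_real (4/3 * s powr (3/2) + pi/6)) \<le> 4 * C * s powr (-3/2)"
        by simp
    qed (use RC(1) in auto)
  qed
qed

end

subsection \<open>The zeros\<close>

context airy
begin

definition Psi :: "complex \<Rightarrow> complex" where "Psi = (SOME \<Psi>. is_Psi \<Psi>)"

lemma is_Psi: "is_Psi Psi"
  unfolding Psi_def using exists_Psi by (rule someI_ex)

lemma Psi_0 [simp]: "Psi 0 = 0"
  using is_Psi by (simp add: is_Psi_def)

lemma Psi_deriv:
  "z \<in> cone \<Longrightarrow> (Psi has_field_derivative \<i> * kappa / (v (al * z) * v (be * z))) (at z)"
  using is_Psi by (simp add: is_Psi_def)

lemma exp_Psi: "z \<in> cone \<Longrightarrow> exp (Psi z) = v (be * z) / v (al * z)"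
  using is_Psi by (simp add: is_Psi_def)

definition phase :: "real \<Rightarrow> real" where "phase s = Im (Psi (of_real s))"

lemma v_be_of_real: "v (be * of_real s) = cnj (v (al * of_real s))"
  using v_cnj[of "al * of_real s"] by (simp add: cis_cnj)

lemma Psi_vector_deriv_real:
  assumes "s \<ge> 0"
  shows "((\<lambda>s. Psi (of_real s)) has_vector_derivative \<i> * of_real (kappa / (cmod (v (al * of_real s)))\<^sup>2)) (at s)"
proof -
  have "v (al * of_real s) * v (be * of_real s) = of_real ((cmod (v (al * of_real s)))\<^sup>2)"
    unfolding v_be_of_real by (simp only: complex_norm_square)
  then show ?thesis
    using has_vector_derivative_line[of Psi _ 0 s 1] Psi_deriv[OF of_real_cone[OF assms]] by simp
qed

lemma phase_deriv:
  assumes "s \<ge> 0"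
  shows "(phase has_real_derivative kappa / (cmod (v (al * of_real s)))\<^sup>2) (at s)"
  using has_real_derivative_Im[OF Psi_vector_deriv_real[OF assms]] by (simp add: phase_def[abs_def])

lemma Psi_of_real:
  assumes "s \<ge> 0"
  shows "Psi (of_real s) = \<i> * phase s"
proof -
  have "((\<lambda>s. Re (Psi (of_real s))) has_real_derivative 0) (at x within {0..})" if "x \<ge> 0" for x
    using has_real_derivative_Re[OF Psi_vector_deriv_real[OF that]] has_field_derivative_at_within by simp blast
  then obtain c where "\<And>x. x \<ge> 0 \<Longrightarrow> Re (Psi (of_real x)) = c"
    using has_field_derivative_zero_constant[of "{0..}" "\<lambda>s. Re (Psi (of_real s))"] by auto
  from this[of s] this[of 0] assms show ?thesis by (simp add: complex_eq_iff phase_def)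
qed

lemma phase_0 [simp]: "phase 0 = 0" by (simp add: phase_def)

lemma phase_strict:
  assumes "0 \<le> s" "s < t"
  shows "phase s < phase t"
proof (rule DERIV_pos_imp_increasing[OF assms(2)])
  fix x assume "s \<le> x" "x \<le> t"
  then show "\<exists>y. (phase has_real_derivative y) (at x) \<and> 0 < y"
    using phase_deriv[of x] assms kappa_pos v_al_be_cone_nz[OF of_real_cone[of x]]
    by (intro exI[of _ "kappa / (cmod (v (al * of_real x)))\<^sup>2"]) auto
qed

lemma phase_strict_iff: "0 \<le> s \<Longrightarrow> 0 \<le> t \<Longrightarrow> phase s < phase t \<longleftrightarrow> s < t"
  by (metis phase_strict linorder_neqE less_asym)

lemma phase_cont: "continuous_on {0..} phase"
  using phase_deriv by (meson atLeast_iff continuous_at_imp_continuous_on DERIV_isCont)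

text \<open>The expansion is known only for large s. On the remaining compact interval the
  difference is bounded, and the denominator with 1 added lets one constant serve all s >=
  0.\<close>

lemma phase_asymp:
  obtains B where "B > 0" "\<And>s. s \<ge> 0 \<Longrightarrow> \<bar>phase s - (4/3 * s powr (3/2) + pi/6)\<bar> \<le> B / (1 + s powr (3/2))"
proof -
  obtain R C where R: "R \<ge> 1" 
    and C: "\<And>s. s \<ge> R \<Longrightarrow> cmod (Psi (of_real s) - \<i> * of_real (4/3 * s powr (3/2) + pi/6)) \<le> C * s powr (-3/2)"
    using is_Psi unfolding is_Psi_def by blast
  define f where "f s = phase s - (4/3 * s powr (3/2) + pi/6)" for s
  have "continuous_on {0..R} f"
    unfolding f_def by (intro continuous_intros continuous_on_subset[OF phase_cont] continuous_on_powr') auto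
  then have "bounded (f ` {0..R})"
    using compact_continuous_image compact_imp_bounded by blast
  then obtain B1 where B1: "B1 > 0" "\<And>s. 0 \<le> s \<Longrightarrow> s \<le> R \<Longrightarrow> \<bar>f s\<bar> \<le> B1"
    unfolding bounded_pos by auto
  define B where "B = B1 * (1 + R powr (3/2)) + 2 * \<bar>C\<bar>"
  show ?thesis
  proof (rule that[of B])
    show "B > 0" using B1 by (auto simp: B_def intro!: add_pos_nonneg mult_pos_pos)
    fix s :: real assume s: "s \<ge> 0"
    have pos: "1 + s powr (3/2) > 0" by (simp add: add_pos_nonneg)
    have "\<bar>f s\<bar> * (1 + s powr (3/2)) \<le> B"
    proof (cases "s \<le> R")
      case True
      have "s powr (3/2) \<le> R powr (3/2)" using True s by (intro powr_mono2) auto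
      then have "\<bar>f s\<bar> * (1 + s powr (3/2)) \<le> B1 * (1 + R powr (3/2))"
        using B1(2)[OF s True] by (intro mult_mono) auto
      then show ?thesis by (simp add: B_def)
    next
      case False
      have s1: "s powr (3/2) \<ge> 1" using False R by (intro ge_one_powr_ge_zero) auto
      have "\<bar>f s\<bar> = \<bar>Im (Psi (of_real s) - \<i> * of_real (4/3 * s powr (3/2) + pi/6))\<bar>"
        by (simp add: f_def phase_def)
      also have "\<dots> \<le> C * s powr (-3/2)" using C[of s] abs_Im_le_cmod False by (meson le_cases order_trans)
      also have "\<dots> \<le> \<bar>C\<bar> * s powr (-3/2)" by (intro mult_right_mono) auto
      finally have "\<bar>f s\<bar> * (1 + s powr (3/2)) \<le> (\<bar>C\<bar> * s powr (-3/2)) * (2 * s powr (3/2))"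
        using s1 by (intro mult_mono) auto
      also have "\<dots> = 2 * \<bar>C\<bar> * (s powr (-3/2) * s powr (3/2))" by simp
      also have "\<dots> = 2 * \<bar>C\<bar>" using False R by (simp flip: powr_add)
      also have "\<dots> \<le> B" using B1 by (simp add: B_def)
      finally show ?thesis .
    qed
    then show "\<bar>phase s - (4/3 * s powr (3/2) + pi/6)\<bar> \<le> B / (1 + s powr (3/2))"
      using pos by (simp add: f_def pos_le_divide_eq)
  qed
qed

lemma phase_surj:
  assumes "x \<ge> 0"
  shows "\<exists>s\<ge>0. phase s = x"
proof -
  obtain B where B: "B > 0" "\<And>s. s \<ge> 0 \<Longrightarrow> \<bar>phase s - (4/3 * s powr (3/2) + pi/6)\<bar> \<le> B / (1 + s powr (3/2))"
    using phase_asymp by blast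
  define S where "S = 1 + x + B"
  have S: "S \<ge> 1" using B assms by (simp add: S_def)
  have "B / (1 + S powr (3/2)) \<le> B / 1" using B by (intro divide_left_mono) (auto intro: add_pos_nonneg)
  then have "phase S \<ge> S powr (3/2) - B" using B(2)[of S] S pi_gt_zero powr_ge_zero[of S "3/2"] by linarith
  moreover have "S powr 1 \<le> S powr (3/2)" using S by (intro powr_mono) auto
  ultimately have "phase S \<ge> x" using S by (simp add: S_def)
  then have "\<exists>s. 0 \<le> s \<and> s \<le> S \<and> phase s = x"
    using assms S by (intro IVT' continuous_on_subset[OF phase_cont]) auto
  then show ?thesis by blast
qed

text \<open>By \<open>connection\<close>, \<open>v (- s)\<close> vanishes exactly if exp (i phase)
  equals \<open>be\<close>, that is, if the phase is - pi/3 modulo 2 pi. The phase starts at 0, so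
  the first admissible value is 5 pi/3, attained for k = 1.\<close>

definition airy_zero :: "nat \<Rightarrow> real" where
  "airy_zero k = (SOME s. s \<ge> 0 \<and> phase s = 2 * pi * real k - pi / 3)"

lemma airy_zero: assumes "k \<ge> 1" shows "airy_zero k \<ge> 0" "phase (airy_zero k) = 2 * pi * real k - pi / 3"
proof -
  have "2 * pi * 1 \<le> 2 * pi * real k" using assms by (intro mult_left_mono) auto
  then have "2 * pi * real k - pi / 3 \<ge> 0" using pi_gt_zero by linarith
  from someI_ex[OF phase_surj[OF this]] show "airy_zero k \<ge> 0" "phase (airy_zero k) = 2 * pi * real k - pi / 3"
    unfolding airy_zero_def by auto
qed

lemma airy_zero_less: "1 \<le> j \<Longrightarrow> j < k \<Longrightarrow> airy_zero j < airy_zero k"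
  using phase_strict_iff[of "airy_zero j" "airy_zero k"] airy_zero[of j] airy_zero[of k] by auto

lemma airy_zero_pos: "1 \<le> k \<Longrightarrow> 0 < airy_zero k"
proof -
  assume k: "1 \<le> k"
  have "2 * pi * 1 \<le> 2 * pi * real k" using k by (intro mult_left_mono) auto
  then have "phase (airy_zero k) > 0" using airy_zero(2)[OF k] pi_gt_zero by linarith
  then have "airy_zero k \<noteq> 0" by auto
  then show ?thesis using airy_zero(1)[OF k] by linarith
qed

lemma zero_iff:
  assumes "s \<ge> 0"
  shows "v (- of_real s) = 0 \<longleftrightarrow> (\<exists>k\<ge>1. s = airy_zero k)"
proof -
  note nz = v_al_be_cone_nz[OF of_real_cone[OF assms]]
  have e: "exp (\<i> * phase s) = v (be * of_real s) / v (al * of_real s)"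
    using exp_Psi[OF of_real_cone[OF assms]] Psi_of_real[OF assms] by simp
  have "v (- of_real s) = al * v (al * of_real s) * (1 + be^2 * exp (\<i> * phase s))"
  proof -
    have "al * be^2 = (al * be) * be" by (simp only: power2_eq_square mult.assoc)
    then have "al * be^2 = be" unfolding al_be(1) by simp
    then have "al * v (al * of_real s) * (be^2 * exp (\<i> * phase s)) = be * v (be * of_real s)"
      unfolding e using nz by (simp add: field_simps)
    then show ?thesis unfolding connection by (simp only: distrib_left) simp
  qed
  then have "v (- of_real s) = 0 \<longleftrightarrow> 1 - al * exp (\<i> * phase s) = 0"
    using nz unfolding al_be by simp
  also have "\<dots> \<longleftrightarrow> exp (\<i> * phase s) = exp (\<i> * of_real (- (pi/3)))"
  proof -
    have "exp (\<i> * of_real (- (pi/3))) = be" by (simp add: cis_conv_exp)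
    moreover have "1 - al * x = 0 \<longleftrightarrow> x = be" for x
      using al_be(1,2) by (metis eq_iff_diff_eq_0 mult.assoc mult_1)
    ultimately show ?thesis by simp
  qed
  also have "\<dots> \<longleftrightarrow> (\<exists>n::int. phase s = - (pi/3) + 2 * of_int n * pi)"
    unfolding exp_eq by (simp add: complex_eq_iff)
  also have "\<dots> \<longleftrightarrow> (\<exists>k\<ge>1. s = airy_zero k)"
  proof
    assume "\<exists>n::int. phase s = - (pi/3) + 2 * of_int n * pi"
    then obtain n :: int where n: "phase s = - (pi/3) + 2 * of_int n * pi" by blast
    \<comment> \<open>Nonnegativity of the phase rules out n <= 0, so the numbering starts at
      1.\<close>
    have "phase s \<ge> 0" using phase_strict[of 0 s] assms by (cases "s = 0") auto
    then have "2 * of_int n * pi > 0" using n pi_gt_zero by linarith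
    then have "n > 0" by (simp add: zero_less_mult_iff)
    then have n1: "nat n \<ge> 1" "real (nat n) = of_int n" by auto
    have "phase s = phase (airy_zero (nat n))" using airy_zero(2)[OF n1(1)] n n1(2) by simp
    then have "s = airy_zero (nat n)"
      using phase_strict_iff[OF assms airy_zero(1)[OF n1(1)]] phase_strict_iff[OF airy_zero(1)[OF n1(1)] assms] by auto
    then show "\<exists>k\<ge>1. s = airy_zero k" using n1 by blast
  next
    assume "\<exists>k\<ge>1. s = airy_zero k"
    then obtain k where k: "k \<ge> 1" "s = airy_zero k" by blast
    then have "phase s = - (pi/3) + 2 * of_int (int k) * pi" using airy_zero(2)[OF k(1)] by simp
    then show "\<exists>n::int. phase s = - (pi/3) + 2 * of_int n * pi" by blast
  qed
  finally show ?thesis .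
qed

text \<open>Solving 4/3 x + pi/6 = 2 pi k - pi/3 gives x = 3 pi/2 (k - 1/4). The error O(1/(1 + x))
  is O(1/k) because the same relation bounds k by a multiple of 1 + x.\<close>

lemma airy_zero_asymp:
  obtains B where "\<And>k. k \<ge> 1 \<Longrightarrow> \<bar>airy_zero k powr (3/2) - 3 * pi / 2 * (real k - 1/4)\<bar> \<le> B / real k"
proof -
  obtain B where B: "B > 0" "\<And>s. s \<ge> 0 \<Longrightarrow> \<bar>phase s - (4/3 * s powr (3/2) + pi/6)\<bar> \<le> B / (1 + s powr (3/2))"
    using phase_asymp by blast
  show ?thesis
  proof (rule that[of "3/4 * B * (B + 2)"])
    fix k :: nat assume k: "k \<ge> 1"
    define x where "x = airy_zero k powr (3/2)"
    have x0: "x \<ge> 0" by (simp add: x_def)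
    have d: "\<bar>2 * pi * real k - pi/3 - (4/3 * x + pi/6)\<bar> \<le> B / (1 + x)"
      using B(2)[OF airy_zero(1)[OF k]] airy_zero(2)[OF k] by (simp add: x_def)
    have "B / (1 + x) \<le> B / 1" using B x0 by (intro divide_left_mono) auto
    then have "2 * pi * real k \<le> 4/3 * x + pi/2 + B" using d by linarith
    moreover have "2 * 2 * real k \<le> 2 * pi * real k" using pi_ge_two by (intro mult_right_mono) auto
    ultimately have "4 * real k \<le> 4/3 * x + 2 + B" using pi_less_4 by linarith
    moreover have "0 \<le> B * x" using B(1) x0 by simp
    ultimately have "real k \<le> (B + 2) * (1 + x)" using B(1) x0 unfolding distrib_left distrib_right by linarith
    then have k2: "1 / (1 + x) \<le> (B + 2) / real k" using k x0 by (simp add: field_simps)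
    have "\<bar>x - 3 * pi / 2 * (real k - 1/4)\<bar> = 3/4 * \<bar>2 * pi * real k - pi/3 - (4/3 * x + pi/6)\<bar>"
      by (simp add: abs_if field_simps)
    also have "\<dots> \<le> 3/4 * (B * (1 / (1 + x)))" using d by (intro mult_left_mono) auto
    also have "\<dots> \<le> 3/4 * (B * ((B + 2) / real k))" using B k2 by (intro mult_left_mono) auto
    finally show "\<bar>airy_zero k powr (3/2) - 3 * pi / 2 * (real k - 1/4)\<bar> \<le> 3/4 * B * (B + 2) / real k"
      by (simp add: x_def)
  qed
qed

section \<open>The derivative of \<open>Psi\<close> near the positive axis\<close>

lemma Arg_al_be:
  assumes "Re z > 0"
  shows "\<bar>Arg (al * z)\<bar> \<le> pi - pi/6" "\<bar>Arg (be * z)\<bar> \<le> pi - pi/6"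
    "(al * z) powr of_real p = cis (p * (pi/3)) * z powr of_real p"
    "(be * z) powr of_real p = cis (- (p * (pi/3))) * z powr of_real p"
proof -
  have z: "z \<noteq> 0" "\<bar>Arg z\<bar> < pi / 2" using assms Arg_Re_pos[of z] by auto
  have 1: "- pi < Arg z + pi/3" "Arg z + pi/3 \<le> pi" "- pi < Arg z + (-(pi/3))" "Arg z + (-(pi/3)) \<le> pi"
    using z(2) by linarith+
  show "\<bar>Arg (al * z)\<bar> \<le> pi - pi/6"
    using Arg_cis_times[OF z(1) 1(1,2)] z(2) by linarith
  show "\<bar>Arg (be * z)\<bar> \<le> pi - pi/6"
    using Arg_cis_times[OF z(1) 1(3,4)] z(2) by linarith
  show "(al * z) powr of_real p = cis (p * (pi/3)) * z powr of_real p"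
    by (rule cis_times_powr[OF z(1) 1(1,2)])
  show "(be * z) powr of_real p = cis (- (p * (pi/3))) * z powr of_real p"
    using cis_times_powr[OF z(1) 1(3,4)] by simp
qed

lemma powr_al_be_three_halves:
  assumes "Re z > 0"
  shows "(al * z) powr (3/2) = \<i> * z powr (3/2)" "(be * z) powr (3/2) = - \<i> * z powr (3/2)"
proof -
  have [simp]: "cis (- (pi / 2)) = - \<i>" by (simp add: complex_eq_iff)
  show "(al * z) powr (3/2) = \<i> * z powr (3/2)" "(be * z) powr (3/2) = - \<i> * z powr (3/2)"
    using Arg_al_be(3)[OF assms, of "3/2"] Arg_al_be(4)[OF assms, of "3/2"] by simp_all
qed

text \<open>The 3/2 powers at the two rotated points are opposite, so the exponentials cancel, and
  so do the phases of the quarter powers. The derivative of \<open>Psi\<close> is therefore of size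
  sqrt z, without exponential growth or oscillation.\<close>

lemma lead_al_be:
  assumes "Re z > 0"
  shows "lead (al * z) * lead (be * z) = 1 / (4 * pi * csqrt z)"
proof -
  have "z powr (1/4) * z powr (1/4) = csqrt z"
    by (simp add: csqrt_conv_powr flip: powr_add)
  moreover have "cis (pi/12) * cis (- (pi/12)) = 1" by (simp add: cis_mult)
  ultimately have "(cis (pi/12) * z powr (1/4)) * (cis (- (pi/12)) * z powr (1/4)) = csqrt z"
    by (metis (no_types) mult.assoc mult.commute mult_1)
  then have h1: "(al * z) powr (1/4) * (be * z) powr (1/4) = csqrt z"
    using Arg_al_be(3)[OF assms, of "1/4"] Arg_al_be(4)[OF assms, of "1/4"] by simp
  have h2: "exp (- (2/3) * (al * z) powr (3/2)) * exp (- (2/3) * (be * z) powr (3/2)) = 1"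
    unfolding powr_al_be_three_halves[OF assms] by (simp flip: exp_add)
  have h3: "of_real (sqrt pi) * of_real (sqrt pi) = (of_real pi :: complex)"
    by (simp flip: of_real_mult)
  have h4: "(2 * r * x) * (2 * r * y) = 4 * (r * r) * (x * y)" for r x y :: complex by simp
  show ?thesis
    unfolding lead_def times_divide_times_eq by (simp only: h1 h2 h3 h4 of_real_mult of_real_numeral)
qed

definition recip_prod :: "complex \<Rightarrow> complex" where "recip_prod z = 1 / (v (al * z) * v (be * z))"

lemma Psi_deriv': "z \<in> cone \<Longrightarrow> (Psi has_field_derivative \<i> * kappa * recip_prod z) (at z)"
  using Psi_deriv by (simp add: recip_prod_def)

text \<open>Rotation by 60 degrees keeps the right half plane at an angle of at least pi/6 from the
  negative axis, so one instance of the asymptotics serves all three arguments.\<close>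

lemma asymp_right:
  obtains R where "R \<ge> 1" 
    "\<And>z. Re z > 0 \<Longrightarrow> cmod z \<ge> R \<Longrightarrow> cmod (v (al * z) / lead (al * z) - 1) \<le> 1/16"
    "\<And>z. Re z > 0 \<Longrightarrow> cmod z \<ge> R \<Longrightarrow> cmod (v (be * z) / lead (be * z) - 1) \<le> 1/16"
    "\<And>z. Re z > 0 \<Longrightarrow> cmod z \<ge> R \<Longrightarrow> cmod (v z / lead z - 1) \<le> 1/16"
proof -
  obtain R C where RC: "R \<ge> 1" "C > 0" 
    "\<And>\<xi>. cmod \<xi> \<ge> R \<Longrightarrow> \<bar>Arg \<xi>\<bar> \<le> pi - pi/6 \<Longrightarrow>
        cmod (v \<xi> / lead \<xi> - 1) \<le> C * cmod \<xi> powr (-3/2) \<and> cmod (v \<xi> / lead \<xi> - 1) \<le> 1/16"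
    using asymp[of "pi/6"] pi_gt_zero by auto
  show ?thesis
  proof (rule that[OF RC(1)])
    fix z assume z: "Re z > 0" "cmod z \<ge> R"
    show "cmod (v (al * z) / lead (al * z) - 1) \<le> 1/16"
      using RC(3)[OF _ Arg_al_be(1)[OF z(1)]] z(2) by simp
    show "cmod (v (be * z) / lead (be * z) - 1) \<le> 1/16"
      using RC(3)[OF _ Arg_al_be(2)[OF z(1)]] z(2) by simp
    have "\<bar>Arg z\<bar> \<le> pi - pi/6" using Arg_Re_pos[of z] z pi_gt_zero by linarith
    then show "cmod (v z / lead z - 1) \<le> 1/16"
      using RC(3) z(2) by blast
  qed
qed

lemma recip_prod_asymp:
  obtains R where "R \<ge> 1"
    "\<And>z. Re z > 0 \<Longrightarrow> cmod z \<ge> R \<Longrightarrow> \<exists>Q. recip_prod z = 4 * pi * (csqrt z * Q) \<and> cmod (Q - 1) \<le> 1/4"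
proof -
  obtain R where R: "R \<ge> 1" 
    "\<And>z. Re z > 0 \<Longrightarrow> cmod z \<ge> R \<Longrightarrow> cmod (v (al * z) / lead (al * z) - 1) \<le> 1/16"
    "\<And>z. Re z > 0 \<Longrightarrow> cmod z \<ge> R \<Longrightarrow> cmod (v (be * z) / lead (be * z) - 1) \<le> 1/16"
    using asymp_right by metis
  show ?thesis
  proof (rule that[OF R(1)])
    fix z assume z: "Re z > 0" "cmod z \<ge> R"
    then have z0: "z \<noteq> 0" by auto
    define a where "a = v (al * z) / lead (al * z) - 1"
    define b where "b = v (be * z) / lead (be * z) - 1"
    have ab: "cmod a \<le> 1/16" "cmod b \<le> 1/16" using R(2,3)[OF z] by (simp_all add: a_def b_def)
    define q where "q = a + b + a * b"
    have "cmod (a * b) \<le> 1/16 * (1/16)" unfolding norm_mult using ab by (intro mult_mono) auto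
    then have q: "cmod q \<le> 1/7"
      using norm_triangle_ineq[of "a + b" "a * b"] norm_triangle_ineq[of a b] ab by (simp add: q_def)
    have eq: "v (al * z) * v (be * z) = (1 + q) * (lead (al * z) * lead (be * z))"
    proof -
      have "v (al * z) = (1 + a) * lead (al * z)" "v (be * z) = (1 + b) * lead (be * z)"
        using z0 by (simp_all add: a_def b_def lead_nz)
      then show ?thesis by (simp add: q_def algebra_simps)
    qed
    have n1: "cmod (1 + q) \<ge> 6/7" using norm_triangle_ineq4[of "1 + q" q] q by simp
    then have nz: "1 + q \<noteq> 0" by auto
    have "1 / (1 + q) - 1 = - q / (1 + q)" using nz by (simp add: field_simps)
    then have "cmod (1 / (1 + q) - 1) = cmod q / cmod (1 + q)" by (simp add: norm_divide)
    also have "\<dots> \<le> (1/7) / (6/7)" using q n1 by (intro frac_le) auto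
    finally have "cmod (1 / (1 + q) - 1) \<le> 1/4" by simp
    moreover have "recip_prod z = 4 * pi * (csqrt z * (1 / (1 + q)))"
      unfolding recip_prod_def eq lead_al_be[OF z(1)] by simp
    ultimately show "\<exists>Q. recip_prod z = 4 * pi * (csqrt z * Q) \<and> cmod (Q - 1) \<le> 1/4" by blast
  qed
qed

text \<open>The slope 1/8 bounds the modulus by 9/8 of the real part, and the square of 108/100
  exceeds 9/8.\<close>

lemma csqrt_thin:
  assumes "\<bar>Im z\<bar> \<le> Re z / 8"
  shows "sqrt (Re z) \<le> Re (csqrt z)" "\<bar>Im (csqrt z)\<bar> \<le> sqrt (Re z) / 4"
    "cmod (csqrt z) \<le> 108/100 * sqrt (Re z)"
proof -
  have s: "Re z \<ge> 0" using assms by linarith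
  have n: "cmod z \<le> 9/8 * Re z" using cmod_le[of z] assms s by linarith
  show "sqrt (Re z) \<le> Re (csqrt z)" using complex_Re_le_cmod[of z] by simp
  have "\<bar>Im (csqrt z)\<bar> \<le> sqrt ((cmod z - Re z) / 2)"
    by (simp add: abs_mult complex_Re_le_cmod abs_real_def[of "sqrt _"] sgn_if)
  also have "\<dots> \<le> sqrt (Re z / 16)" using n by (intro real_sqrt_le_mono) auto
  also have "\<dots> = sqrt (Re z) / 4" by (simp add: real_sqrt_divide)
  finally show "\<bar>Im (csqrt z)\<bar> \<le> sqrt (Re z) / 4" .
  have "cmod (csqrt z) = sqrt (cmod z)" by simp
  also have "\<dots> \<le> sqrt ((108/100)^2 * Re z)"
    using n s by (intro real_sqrt_le_mono) (simp add: power2_eq_square)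
  also have "\<dots> = 108/100 * sqrt (Re z)" by (simp add: real_sqrt_mult)
  finally show "cmod (csqrt z) \<le> 108/100 * sqrt (Re z)" .
qed

text \<open>Zeros of v can lie only on the negative axis. If a rotated point is real, then Im z is -
  sqrt 3 or + sqrt 3 times Re z, and the rotated point is 2 Re z >= 0.\<close>

lemma Re_al_be_nonneg_nz:
  assumes "Re z \<ge> 0" shows "v (al * z) \<noteq> 0" "v (be * z) \<noteq> 0"
proof -
  have *: "v \<xi> \<noteq> 0" if "Im \<xi> \<noteq> 0 \<or> Re \<xi> \<ge> 0" for \<xi>
  proof (cases "Im \<xi> = 0")
    case True
    then have "\<xi> = of_real (Re \<xi>)" by (simp add: complex_eq_iff)
    then show ?thesis using v_nz_nonneg[of "Re \<xi>"] that True by auto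
  qed (rule v_nz_nonreal)
  have "Re (al * z) \<ge> 0" if "Im (al * z) = 0"
  proof -
    have "Im z = - (sqrt 3 * Re z)" using that by (simp add: al_eq field_simps)
    then show ?thesis using assms by (simp add: al_eq)
  qed
  then show "v (al * z) \<noteq> 0" using * by blast
  have "Re (be * z) \<ge> 0" if "Im (be * z) = 0"
  proof -
    have "Im z = (sqrt 3 * Re z)" using that by (simp add: be_eq field_simps)
    then show ?thesis using assms by (simp add: be_eq)
  qed
  then show "v (be * z) \<noteq> 0" using * by blast
qed

lemma recip_prod_of_real: "recip_prod (of_real s) = of_real (1 / (cmod (v (al * of_real s)))\<^sup>2)"
  unfolding recip_prod_def v_be_of_real by (simp only: complex_norm_square of_real_divide of_real_1)

text \<open>For large z \<open>recip_prod\<close> is close to 4 pi sqrt z, whose real part dominates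
  near the axis. For bounded z it is positive on the axis, where the two factors are conjugate, and
  uniform continuity keeps the real part dominant in a thin strip. The first bound makes
  \<open>Psi\<close> expanding; the second keeps \<open>Im (Psi z)\<close> nonnegative.\<close>

lemma recip_prod_sector:
  obtains \<delta> c where "0 < \<delta>" "\<delta> \<le> 1/100" "c > 0"
    "\<And>z. \<bar>Im z\<bar> \<le> \<delta> * Re z \<Longrightarrow> c \<le> Re (recip_prod z)"
    "\<And>z. \<bar>Im z\<bar> \<le> \<delta> * Re z \<Longrightarrow> \<bar>Im (recip_prod z)\<bar> \<le> Re (recip_prod z)"
proof -
  obtain R where R: "R \<ge> 1"
    "\<And>z. Re z > 0 \<Longrightarrow> cmod z \<ge> R \<Longrightarrow> \<exists>Q. recip_prod z = 4 * pi * (csqrt z * Q) \<and> cmod (Q - 1) \<le> 1/4"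
    using recip_prod_asymp by metis
  have large: "1 \<le> Re (recip_prod z) \<and> \<bar>Im (recip_prod z)\<bar> \<le> Re (recip_prod z)" if z: "\<bar>Im z\<bar> \<le> Re z / 8" "Re z \<ge> R" for z
  proof -
    have "Re z > 0" "cmod z \<ge> R" using z R(1) complex_Re_le_cmod[of z] by linarith+
    then obtain Q where Q: "recip_prod z = 4 * pi * (csqrt z * Q)" "cmod (Q - 1) \<le> 1/4" using R(2) by blast
    define s where "s = sqrt (Re z)"
    have s1: "s \<ge> 1" using z R(1) by (simp add: s_def)
    define y where "y = csqrt z * (Q - 1)"
    have "cmod y \<le> (108/100 * s) * (1/4)"
      unfolding y_def norm_mult s_def using csqrt_thin(3)[OF z(1)] Q(2) z(2) R(1) by (intro mult_mono) auto
    then have y: "\<bar>Re y\<bar> \<le> 27/100 * s" "\<bar>Im y\<bar> \<le> 27/100 * s"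
      using abs_Re_le_cmod[of y] abs_Im_le_cmod[of y] by linarith+
    have eq: "csqrt z * Q = csqrt z + y" by (simp add: y_def algebra_simps)
    define X where "X = csqrt z * Q"
    have X: "Re X \<ge> 73/100 * s" "\<bar>Im X\<bar> \<le> Re X"
      using csqrt_thin(1,2)[OF z(1)] y s1 unfolding eq X_def s_def[symmetric]
      unfolding plus_complex.sel by linarith+
    have iPX: "Re (recip_prod z) = 4 * pi * Re X" "Im (recip_prod z) = 4 * pi * Im X"
      unfolding Q(1) X_def[symmetric] by simp_all
    have "4 * 3 * (73/100 * 1) \<le> 4 * pi * Re X"
      using X(1) s1 pi_gt3 by (intro mult_mono) auto
    moreover have "4 * pi * \<bar>Im X\<bar> \<le> 4 * pi * Re X" using X(2) by (intro mult_left_mono) auto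
    ultimately show ?thesis unfolding iPX by (simp add: abs_mult)
  qed
  define K where "K = cbox (Complex 0 (-1)) (Complex R 1)"
  have K: "compact K" unfolding K_def by simp
  have inK: "z \<in> K \<longleftrightarrow> 0 \<le> Re z \<and> Re z \<le> R \<and> -1 \<le> Im z \<and> Im z \<le> 1" for z
    by (auto simp: K_def in_cbox_complex_iff)
  have "continuous_on K recip_prod"
    unfolding recip_prod_def by (intro continuous_intros) (use inK Re_al_be_nonneg_nz in auto)
  then have uc: "uniformly_continuous_on K recip_prod" using K compact_uniformly_continuous by blast
  define f where "f s = 1 / (cmod (v (al * of_real s)))\<^sup>2" for s :: real
  have "continuous_on {0..R} f"
    unfolding f_def by (intro continuous_intros) (use Re_al_be_nonneg_nz in auto)
  then obtain s0 where s0: "s0 \<in> {0..R}" "\<And>s. s \<in> {0..R} \<Longrightarrow> f s0 \<le> f s"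
    using continuous_attains_inf[of "{0..R}" f] R(1) by auto
  define m where "m = f s0"
  have m: "m > 0" using s0(1) Re_al_be_nonneg_nz[of "of_real s0"] by (auto simp: m_def f_def)
  obtain d where d: "d > 0" "\<And>z z'. z \<in> K \<Longrightarrow> z' \<in> K \<Longrightarrow> dist z' z < d \<Longrightarrow> dist (recip_prod z') (recip_prod z) < m / 3"
    using uc m unfolding uniformly_continuous_on_def by (metis zero_less_divide_iff zero_less_numeral)
  have small: "2/3 * m \<le> Re (recip_prod z) \<and> \<bar>Im (recip_prod z)\<bar> \<le> Re (recip_prod z)" 
    if z: "\<bar>Im z\<bar> < d" "\<bar>Im z\<bar> \<le> 1" "0 \<le> Re z" "Re z \<le> R" for z
  proof -
    define w where "w = recip_prod z - recip_prod (of_real (Re z))"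
    have "dist (recip_prod z) (recip_prod (of_real (Re z))) < m / 3"
    proof (rule d(2))
      show "dist z (of_real (Re z)) < d"
        using z(1) by (simp add: dist_norm complex_eq_iff cmod_def)
    qed (use z R in \<open>auto simp: inK\<close>)
    then have "cmod w < m / 3" by (simp add: dist_norm w_def)
    then have w: "\<bar>Re w\<bar> < m/3" "\<bar>Im w\<bar> < m/3" using abs_Re_le_cmod[of w] abs_Im_le_cmod[of w] by linarith+
    have "m \<le> f (Re z)" using s0(2)[of "Re z"] z by (simp add: m_def)
    moreover have "Re (recip_prod z) = f (Re z) + Re w" "Im (recip_prod z) = Im w"
      by (simp_all add: w_def recip_prod_of_real f_def)
    ultimately show ?thesis using w by linarith
  qed
  \<comment> \<open>This slope keeps the cone inside the strip of uniform continuity as long as Re z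
    <= R.\<close>
  define \<delta> where "\<delta> = min (1/100) (min d 1 / (2 * R))"
  have \<delta>: "\<delta> > 0" "\<delta> \<le> 1/100" "\<delta> * R \<le> min d 1 / 2"
  proof -
    show "\<delta> > 0" "\<delta> \<le> 1/100" using d(1) R(1) by (auto simp: \<delta>_def)
    have "\<delta> * R \<le> min d 1 / (2 * R) * R" using R(1) by (intro mult_right_mono) (auto simp: \<delta>_def)
    then show "\<delta> * R \<le> min d 1 / 2" using R(1) by simp
  qed
  have main: "min 1 (2/3 * m) \<le> Re (recip_prod z) \<and> \<bar>Im (recip_prod z)\<bar> \<le> Re (recip_prod z)" if z: "\<bar>Im z\<bar> \<le> \<delta> * Re z" for z
  proof -
    have "0 \<le> \<delta> * Re z" using z by linarith
    then have r: "Re z \<ge> 0" using \<delta>(1) by (simp add: zero_le_mult_iff)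
    show ?thesis
    proof (cases "Re z \<ge> R")
      case True
      have "\<delta> * Re z \<le> 1/100 * Re z" using \<delta> r by (intro mult_right_mono) auto
      then show ?thesis using large[of z] z True r by auto
    next
      case False
      have "\<delta> * Re z \<le> \<delta> * R" using \<delta> False by (intro mult_left_mono) auto
      then have "\<bar>Im z\<bar> \<le> min d 1 / 2" using z \<delta>(3) by linarith
      then show ?thesis using small[of z] d(1) False r by auto
    qed
  qed
  show ?thesis
    by (rule that[of \<delta> "min 1 (2/3 * m)"]) (use \<delta> m main in auto)
qed

end

subsection \<open>Bounds for the solutions\<close>

lemma sector_convex:
  assumes "\<bar>Im z1\<bar> \<le> \<delta> * Re z1" "\<bar>Im z2\<bar> \<le> \<delta> * Re z2" "0 \<le> r" "r \<le> (1::real)"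
  shows "\<bar>Im (z2 + of_real r * (z1 - z2))\<bar> \<le> \<delta> * Re (z2 + of_real r * (z1 - z2))"
proof -
  have "\<bar>Im (z2 + of_real r * (z1 - z2))\<bar> = \<bar>(1 - r) * Im z2 + r * Im z1\<bar>"
    by (simp add: algebra_simps)
  also have "\<dots> \<le> (1 - r) * \<bar>Im z2\<bar> + r * \<bar>Im z1\<bar>"
    using assms by (intro order_trans[OF abs_triangle_ineq]) (simp add: abs_mult)
  also have "\<dots> \<le> (1 - r) * (\<delta> * Re z2) + r * (\<delta> * Re z1)"
    using assms by (intro add_mono mult_left_mono) auto
  also have "\<dots> = \<delta> * Re (z2 + of_real r * (z1 - z2))" by (simp add: algebra_simps)
  finally show ?thesis .
qed

context airy
begin

lemma in_cone: "\<bar>Im z\<bar> \<le> \<delta> * Re z \<Longrightarrow> 0 < \<delta> \<Longrightarrow> \<delta> \<le> 1/100 \<Longrightarrow> z \<in> cone"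
proof -
  assume a: "\<bar>Im z\<bar> \<le> \<delta> * Re z" "0 < \<delta>" "\<delta> \<le> 1/100"
  then have "0 \<le> \<delta> * Re z" by linarith
  then have "0 \<le> Re z" using a(2) by (simp add: zero_le_mult_iff)
  then have "\<delta> * Re z \<le> 1/2 * Re z" using a by (intro mult_right_mono) auto
  then show "z \<in> cone" using a by (simp add: cone_def)
qed

text \<open>Along the segment from z2 to z1 the component of \<open>Psi\<close> in the direction i
  (z1 - z2), measured in units of the length of the segment, has derivative kappa times the real
  part of \<open>recip_prod\<close>, hence at least kappa c.\<close>

lemma Psi_expand:
  assumes \<delta>: "0 < \<delta>" "\<delta> \<le> 1/100" 
    and c: "\<And>z. \<bar>Im z\<bar> \<le> \<delta> * Re z \<Longrightarrow> c \<le> Re (recip_prod z)"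
    and z: "\<bar>Im z1\<bar> \<le> \<delta> * Re z1" "\<bar>Im z2\<bar> \<le> \<delta> * Re z2"
  shows "kappa * c * cmod (z1 - z2) \<le> cmod (Psi z1 - Psi z2)"
proof (cases "z1 = z2")
  case False
  define w where "w = z1 - z2"
  have w: "w \<noteq> 0" using False by (simp add: w_def)
  define F where "F r = Re (Psi (z2 + of_real r * w) * (1 / (\<i> * w)))" for r
  have dF: "(F has_real_derivative kappa * Re (recip_prod (z2 + of_real r * w))) (at r)" if "0 \<le> r" "r \<le> 1" for r
  proof -
    have "z2 + of_real r * w \<in> cone"
      using in_cone[OF sector_convex[OF z that] \<delta>] by (simp add: w_def)
    from has_vector_derivative_line[OF Psi_deriv'[OF this]]
    have "((\<lambda>r. Psi (z2 + of_real r * w) * (1 / (\<i> * w))) has_vector_derivative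
        w * (\<i> * kappa * recip_prod (z2 + of_real r * w)) * (1 / (\<i> * w))) (at r)"
      by (rule has_vector_derivative_mult_left)
    from has_real_derivative_Re[OF this] show ?thesis
      using w by (simp add: F_def[abs_def])
  qed
  define G where "G r = F r - kappa * c * r" for r
  have "G 0 \<le> G 1"
  proof (rule DERIV_nonneg_imp_nondecreasing[where f = G])
    fix r :: real assume r: "0 \<le> r" "r \<le> 1"
    have "c \<le> Re (recip_prod (z2 + of_real r * w))"
      using c[OF sector_convex[OF z r]] by (simp add: w_def)
    then have "kappa * c \<le> kappa * Re (recip_prod (z2 + of_real r * w))" using kappa_pos by (intro mult_left_mono) auto
    moreover have "(G has_real_derivative kappa * Re (recip_prod (z2 + of_real r * w)) - kappa * c) (at r)"
      unfolding G_def by (rule derivative_eq_intros dF[OF r] refl | simp)+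
    ultimately show "\<exists>y. (G has_real_derivative y) (at r) \<and> 0 \<le> y" by force
  qed simp
  then have "kappa * c \<le> Re ((Psi z1 - Psi z2) * (1 / (\<i> * w)))"
    by (simp add: G_def F_def w_def algebra_simps diff_divide_distrib)
  also have "\<dots> \<le> cmod ((Psi z1 - Psi z2) * (1 / (\<i> * w)))" by (rule complex_Re_le_cmod)
  also have "\<dots> = cmod (Psi z1 - Psi z2) / cmod w" by (simp add: norm_mult norm_divide)
  finally show ?thesis using w by (simp add: pos_le_divide_eq w_def)
qed simp

text \<open>Along the ray from 0 the derivative of \<open>Im Psi\<close> is kappa times Re (z P)
  with P the value of \<open>recip_prod\<close>; both factors have dominant real part. This excludes
  nonpositive indices in \<open>characteristic_log\<close>.\<close>

lemma Im_Psi_nonneg: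
  assumes \<delta>: "0 < \<delta>" "\<delta> \<le> 1/100" 
    and c: "\<And>z. \<bar>Im z\<bar> \<le> \<delta> * Re z \<Longrightarrow> \<bar>Im (recip_prod z)\<bar> \<le> Re (recip_prod z)"
    and z: "\<bar>Im z\<bar> \<le> \<delta> * Re z"
  shows "Im (Psi z) \<ge> 0"
proof -
  define F where "F r = Im (Psi (0 + of_real r * z))" for r
  have "F 0 \<le> F 1"
  proof (rule DERIV_nonneg_imp_nondecreasing[where f = F])
    fix r :: real assume r: "0 \<le> r" "r \<le> 1"
    have s: "\<bar>Im (of_real r * z)\<bar> \<le> \<delta> * Re (of_real r * z)"
      using mult_left_mono[OF z r(1)] r by (simp add: abs_mult mult_ac)
    define P where "P = recip_prod (0 + of_real r * z)"
    have "0 + of_real r * z \<in> cone" using in_cone[OF s \<delta>] by simp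
    from has_real_derivative_Im[OF has_vector_derivative_line[OF Psi_deriv'[OF this]]]
    have "(F has_real_derivative Im (z * (\<i> * kappa * P))) (at r)"
      unfolding F_def[abs_def] P_def .
    moreover have "Im (z * (\<i> * kappa * P)) = kappa * (Re z * Re P - Im z * Im P)"
      by (simp add: algebra_simps)
    moreover have "Im z * Im P \<le> Re z * Re P"
    proof -
      have "\<bar>Im z\<bar> * \<bar>Im P\<bar> \<le> Re z * Re P"
      proof (rule mult_mono)
        show "\<bar>Im P\<bar> \<le> Re P" using c[OF s] by (simp add: P_def)
        show "\<bar>Im z\<bar> \<le> Re z" "0 \<le> Re z" using in_cone[OF z \<delta>] by (auto simp: cone_def)
      qed auto
      then show ?thesis by (metis abs_ge_self abs_mult order_trans)
    qed
    ultimately show "\<exists>y. (F has_real_derivative y) (at r) \<and> 0 \<le> y"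
      using kappa_pos by (intro exI[of _ "Im (z * (\<i> * kappa * P))"]) auto
  qed simp
  then show ?thesis by (simp add: F_def)
qed

text \<open>Multiplication by \<open>- al\<close> is a rotation by -120 degrees and changes the sign
  of the 3/2 power for b in the first quadrant, so \<open>v b\<close> and
  \<open>v (- al * b)\<close> carry inverse exponential factors. The last expression is, up to sign,
  the derivative of their quotient with respect to b, by \<open>wronskian_al\<close>.\<close>

lemma v_ratio_bound:
  obtains R C where "R \<ge> 1" "C > 0"
    "\<And>b. Re b > 0 \<Longrightarrow> Im b > 0 \<Longrightarrow> cmod b \<ge> R \<Longrightarrow> v (- al * b) \<noteq> 0"
    "\<And>b. Re b > 0 \<Longrightarrow> Im b > 0 \<Longrightarrow> cmod b \<ge> R \<Longrightarrow>
       cmod (v b / v (- al * b)) \<le> 3 * exp (- (4/3) * Re (b powr (3/2)))"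
    "\<And>b. Re b > 0 \<Longrightarrow> Im b > 0 \<Longrightarrow> cmod b \<ge> R \<Longrightarrow>
       cmod ((1 + al) * (v 0 * vd 0) / (v (- al * b))\<^sup>2) \<le> C * cmod b powr (1/2) * exp (- (4/3) * Re (b powr (3/2)))"
proof -
  obtain R C where RC: "R \<ge> 1" "C > 0" 
    "\<And>\<xi>. cmod \<xi> \<ge> R \<Longrightarrow> \<bar>Arg \<xi>\<bar> \<le> pi - pi/6 \<Longrightarrow>
        cmod (v \<xi> / lead \<xi> - 1) \<le> C * cmod \<xi> powr (-3/2) \<and> cmod (v \<xi> / lead \<xi> - 1) \<le> 1/16"
    using asymp[of "pi/6"] pi_gt_zero by auto
  define W where "W = (1 + al) * (v 0 * vd 0)"
  have W: "W \<noteq> 0" using wronskian_al_nz by (simp add: W_def)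
  have main: "v (- al * b) \<noteq> 0 \<and> cmod (v b / v (- al * b)) \<le> 3 * exp (- (4/3) * Re (b powr (3/2))) \<and>
     cmod (W / (v (- al * b))\<^sup>2) \<le> cmod W * (16/15)\<^sup>2 * (4 * pi) * cmod b powr (1/2) * exp (- (4/3) * Re (b powr (3/2)))"
    if b: "Re b > 0" "Im b > 0" "cmod b \<ge> R" for b
  proof -
    have b0: "b \<noteq> 0" using b by auto
    have Ab: "0 < Arg b" "Arg b < pi / 2" using b Arg_pos_iff[of b] Arg_Re_pos[of b] by auto
    have mal: "- al = cis (- (2 * pi / 3))"
      by (auto simp: complex_eq_iff cos_60 sin_60 cos_120 sin_120)
    define b' where "b' = - al * b"
    have rng: "- pi < Arg b + (- (2 * pi / 3))" "Arg b + (- (2 * pi / 3)) \<le> pi" using Ab by linarith+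
    have Ab': "\<bar>Arg b'\<bar> \<le> pi - pi/6"
      unfolding b'_def mal Arg_cis_times[OF b0 rng] using Ab by linarith
    have pb': "b' powr (3/2) = - (b powr (3/2))"
    proof -
      have "cis (- pi) = - 1" by (simp add: complex_eq_iff)
      then show ?thesis using cis_times_powr[OF b0 rng, of "3/2"] unfolding b'_def mal by simp
    qed
    have nb': "cmod b' = cmod b" by (simp add: b'_def norm_mult)
    have b'0: "b' \<noteq> 0" using b0 nb' by auto
    define x where "x = v b / lead b - 1"
    define x' where "x' = v b' / lead b' - 1"
    have "\<bar>Arg b\<bar> \<le> pi - pi/6" using Ab by linarith
    then have x: "cmod x \<le> 1/16" using RC(3)[OF b(3)] by (simp add: x_def)
    have x': "cmod x' \<le> 1/16" using RC(3)[OF _ Ab'] b(3) nb' by (simp add: x'_def)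
    have vb: "v b = (1 + x) * lead b" and vb': "v b' = (1 + x') * lead b'"
      using lead_nz[OF b0] lead_nz[OF b'0] by (simp_all add: x_def x'_def)
    have n: "cmod (1 + x) \<le> 17/16" "15/16 \<le> cmod (1 + x')"
      using norm_triangle_ineq[of 1 x] norm_triangle_ineq4[of "1 + x'" x'] x x' by auto
    define T where "T = Re (b powr (3/2))"
    have lb: "cmod (lead b) = exp (- (2/3) * T) / (2 * sqrt pi * cmod b powr (1/4))"
      by (simp add: norm_lead T_def)
    have lb': "cmod (lead b') = exp (2/3 * T) / (2 * sqrt pi * cmod b powr (1/4))"
      by (simp add: norm_lead T_def pb' nb')
    have vnz: "v b' \<noteq> 0" using n(2) lead_nz[OF b'0] unfolding vb' by auto
    have "cmod (v b / v b') = cmod (1 + x) / cmod (1 + x') * (cmod (lead b) / cmod (lead b'))"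
      unfolding vb vb' by (simp add: norm_divide norm_mult)
    also have "cmod (lead b) / cmod (lead b') = exp (- (2/3) * T) / exp (2/3 * T)"
      unfolding lb lb' using b0 by simp
    also have "\<dots> = exp (- (4/3) * T)" by (simp flip: exp_diff)
    also have "cmod (1 + x) / cmod (1 + x') \<le> (17/16) / (15/16)" using n by (intro frac_le) auto
    finally have "cmod (v b / v b') \<le> (17/16) / (15/16) * exp (- (4/3) * T)"
      by simp
    also have "\<dots> \<le> 3 * exp (- (4/3) * T)" by (rule mult_right_mono) auto
    finally have 1: "cmod (v b / v b') \<le> 3 * exp (- (4/3) * T)" .
    have lpos: "cmod (lead b') > 0" using lead_nz[OF b'0] by simp
    have "15/16 * cmod (lead b') \<le> cmod (v b')" unfolding vb' norm_mult using n by (intro mult_right_mono) auto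
    then have "(15/16 * cmod (lead b'))\<^sup>2 \<le> (cmod (v b'))\<^sup>2" by (intro power_mono) auto
    then have "cmod W / (cmod (v b'))\<^sup>2 \<le> cmod W / (15/16 * cmod (lead b'))\<^sup>2"
      using lpos vnz by (intro divide_left_mono) auto
    also have "\<dots> = cmod W * (16/15)\<^sup>2 * (1 / (cmod (lead b'))\<^sup>2)"
      by (simp add: power_mult_distrib field_simps)
    also have "1 / (cmod (lead b'))\<^sup>2 = (2 * sqrt pi * cmod b powr (1/4))\<^sup>2 / (exp (2/3 * T))\<^sup>2"
      unfolding lb' by (simp add: power_divide)
    also have "(exp (2/3 * T))\<^sup>2 = exp (4/3 * T)" by (simp add: power2_eq_square flip: exp_add)
    also have "(2 * sqrt pi * cmod b powr (1/4))\<^sup>2 = 4 * pi * cmod b powr (1/2)"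
      by (simp add: power_mult_distrib power2_eq_square[of "_ powr _"] flip: powr_add)
    finally have "cmod W / (cmod (v b'))\<^sup>2 \<le> cmod W * (16/15)\<^sup>2 * (4 * pi * cmod b powr (1/2) / exp (4/3 * T))" .
    then have "cmod (W / (v b')\<^sup>2) \<le> cmod W * (16/15)\<^sup>2 * (4 * pi) * cmod b powr (1/2) * exp (- (4/3) * T)"
      by (simp add: norm_divide norm_power exp_minus field_simps)
    then show ?thesis using 1 vnz by (simp add: b'_def T_def)
  qed
  show ?thesis
    by (rule that[of R "cmod W * (16/15)\<^sup>2 * (4 * pi)"]) (use RC main W in \<open>auto simp: W_def[symmetric]\<close>)
qed

text \<open>A crude bound valid in every direction: near the negative axis \<open>connection\<close>
  expresses v by its values at two points in the range of the asymptotics.\<close>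

lemma v_upper:
  obtains C where "C > 0" "\<And>\<xi>. cmod (v \<xi>) \<le> C * exp (cmod \<xi> powr (3/2))"
proof -
  obtain R where R: "R \<ge> 1" 
    "\<And>z. Re z > 0 \<Longrightarrow> cmod z \<ge> R \<Longrightarrow> cmod (v (al * z) / lead (al * z) - 1) \<le> 1/16"
    "\<And>z. Re z > 0 \<Longrightarrow> cmod z \<ge> R \<Longrightarrow> cmod (v (be * z) / lead (be * z) - 1) \<le> 1/16"
    "\<And>z. Re z > 0 \<Longrightarrow> cmod z \<ge> R \<Longrightarrow> cmod (v z / lead z - 1) \<le> 1/16"
    using asymp_right by metis
  have good: "cmod (v \<xi>) \<le> exp (cmod \<xi> powr (3/2))" 
    if \<xi>: "cmod \<xi> \<ge> 1" "cmod (v \<xi> / lead \<xi> - 1) \<le> 1/16" for \<xi>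
  proof -
    have nz: "\<xi> \<noteq> 0" using \<xi> by auto
    have "cmod (v \<xi> / lead \<xi>) \<le> 17/16" using \<xi>(2) norm_triangle_ineq[of "v \<xi> / lead \<xi> - 1" 1] by simp
    then have "cmod (v \<xi>) \<le> 17/16 * cmod (lead \<xi>)"
      using lead_nz[OF nz] by (simp add: norm_divide pos_divide_le_eq)
    also have "\<dots> \<le> 17/16 * (exp (cmod \<xi> powr (3/2)) / 2)"
    proof (rule mult_left_mono)
      have "- Re (\<xi> powr (3/2)) \<le> cmod (\<xi> powr (3/2))" using abs_Re_le_cmod[of "\<xi> powr (3/2)"] by linarith
      also have "\<dots> = cmod \<xi> powr (3/2)" by (simp add: norm_powr_real_powr')
      finally have "- (2/3) * Re (\<xi> powr (3/2)) \<le> cmod \<xi> powr (3/2)"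
        using powr_ge_zero[of "cmod \<xi>" "3/2"] by linarith
      then have "exp (- (2/3) * Re (\<xi> powr (3/2))) \<le> exp (cmod \<xi> powr (3/2))" by simp
      moreover have "2 * 1 * 1 \<le> 2 * sqrt pi * cmod \<xi> powr (1/4)"
        using \<xi>(1) pi_ge_two by (intro mult_mono ge_one_powr_ge_zero) (auto intro!: real_le_rsqrt)
      ultimately show "cmod (lead \<xi>) \<le> exp (cmod \<xi> powr (3/2)) / 2"
        unfolding norm_lead by (intro frac_le) auto
    qed simp
    also have "\<dots> \<le> exp (cmod \<xi> powr (3/2))" by simp
    finally show ?thesis .
  qed
  have "compact (v ` cball 0 (2 * R))" by (intro compact_continuous_image v_cont continuous_intros) auto
  then have "bounded (v ` cball 0 (2 * R))" by (rule compact_imp_bounded)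
  then obtain M where "M > 0" "\<forall>x \<in> v ` cball 0 (2 * R). cmod x \<le> M"
    unfolding bounded_pos by blast
  then have M: "M > 0" "\<And>\<xi>. cmod \<xi> \<le> 2 * R \<Longrightarrow> cmod (v \<xi>) \<le> M" by auto
  show ?thesis
  proof (rule that[of "M + 2"])
    show "M + 2 > 0" using M by simp
    fix \<xi>
    have e1: "exp (cmod \<xi> powr (3/2)) \<ge> 1" by simp
    consider "cmod \<xi> \<le> 2 * R" | "cmod \<xi> > 2 * R" "Re \<xi> > 0" | "cmod \<xi> > 2 * R" "Re \<xi> < 0" | "cmod \<xi> > 2 * R" "Re \<xi> = 0" by linarith
    then show "cmod (v \<xi>) \<le> (M + 2) * exp (cmod \<xi> powr (3/2))"
    proof cases
      case 1
      have "M * 1 \<le> (M + 2) * exp (cmod \<xi> powr (3/2))" using M e1 by (intro mult_mono) auto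
      then show ?thesis using M(2)[OF 1] by simp
    next
      case 2
      have "1 * exp (cmod \<xi> powr (3/2)) \<le> (M + 2) * exp (cmod \<xi> powr (3/2))"
        using M by (intro mult_right_mono) auto
      then show ?thesis using good[of \<xi>] R(4)[of \<xi>] 2 R(1) by linarith
    next
      case 3
      define z where "z = - \<xi>"
      have z: "Re z > 0" "cmod z \<ge> R" "cmod z \<ge> 1" "cmod z = cmod \<xi>" using 3 R(1) by (auto simp: z_def)
      have "v \<xi> = al * v (al * z) + be * v (be * z)" using connection[of z] by (simp add: z_def)
      then have "cmod (v \<xi>) \<le> cmod (v (al * z)) + cmod (v (be * z))"
        using norm_triangle_ineq[of "al * v (al * z)" "be * v (be * z)"] by simp
      also have "\<dots> \<le> exp (cmod \<xi> powr (3/2)) + exp (cmod \<xi> powr (3/2))"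
        using good[of "al * z"] good[of "be * z"] R(2,3)[OF z(1,2)] z(3,4) by simp
      also have "\<dots> \<le> (M + 2) * exp (cmod \<xi> powr (3/2))" using M by (simp add: distrib_right)
      finally show ?thesis .
    next
      \<comment> \<open>A point of the imaginary axis is a rotation by 60 degrees of a point with
        positive real part; the sign of its imaginary part decides the direction.\<close>
      case 4
      define z where "z = be * \<xi>"
      define z' where "z' = al * \<xi>"
      have "al * z = \<xi>" "be * z' = \<xi>" unfolding z_def z'_def mult.assoc[symmetric] al_be by simp_all
      moreover have "Re z > 0 \<or> Re z' > 0"
      proof -
        have "Im \<xi> \<noteq> 0" using 4 R(1) by (auto simp: cmod_def)
        moreover have "Re z = sqrt 3 / 2 * Im \<xi>" "Re z' = - (sqrt 3 / 2 * Im \<xi>)" using 4 by (auto simp: z_def z'_def al_eq be_eq)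
        moreover have "sqrt 3 / 2 * Im \<xi> \<noteq> 0" using calculation(1) by simp
        ultimately show ?thesis by linarith
      qed
      moreover have "cmod z = cmod \<xi>" "cmod z' = cmod \<xi>" by (simp_all add: z_def z'_def)
      ultimately have "cmod (v \<xi> / lead \<xi> - 1) \<le> 1/16"
        using R(2)[of z] R(3)[of z'] 4(1) R(1) by auto
      then have "cmod (v \<xi>) \<le> 1 * exp (cmod \<xi> powr (3/2))" using good[of \<xi>] 4(1) R(1) by simp
      also have "\<dots> \<le> (M + 2) * exp (cmod \<xi> powr (3/2))"
        using M by (intro mult_right_mono) auto
      finally show ?thesis .
    qed
  qed
qed

text \<open>Off the cone the point - z keeps an angle of at least arctan \<delta> from the negative
  axis. The asymptotics cover large z, and on the compact remainder \<open>v (- z)\<close> has no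
  zeros.\<close>

lemma v_lower:
  assumes "\<delta> > 0"
  obtains c where "c > 0" "\<And>z. \<not> \<bar>Im z\<bar> < \<delta> * Re z \<Longrightarrow> cmod (v (- z)) \<ge> c * exp (- (cmod z powr (3/2)))"
proof -
  define \<delta>1 where "\<delta>1 = arctan \<delta>"
  have \<delta>1: "\<delta>1 > 0" "\<delta>1 < pi/2" using assms arctan_ubound by (auto simp: \<delta>1_def)
  obtain R C where RC: "R \<ge> 1" "C > 0" 
    "\<And>\<xi>. cmod \<xi> \<ge> R \<Longrightarrow> \<bar>Arg \<xi>\<bar> \<le> pi - \<delta>1 \<Longrightarrow>
        cmod (v \<xi> / lead \<xi> - 1) \<le> C * cmod \<xi> powr (-3/2) \<and> cmod (v \<xi> / lead \<xi> - 1) \<le> 1/16"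
    using asymp[OF \<delta>1(1)] by auto
  have arg: "\<bar>Arg (- z)\<bar> \<le> pi - \<delta>1" if z: "\<not> \<bar>Im z\<bar> < \<delta> * Re z" "z \<noteq> 0" for z
  proof (rule ccontr)
    assume a: "\<not> ?thesis"
    define B where "B = pi - \<bar>Arg (- z)\<bar>"
    have B: "0 \<le> B" "B < \<delta>1" using a mpi_less_Arg[of "-z"] Arg_le_pi[of "-z"] by (auto simp: B_def)
    have "- z = rcis (cmod z) (Arg (- z))" using rcis_cmod_Arg[of "- z"] by simp
    then have "Re (- z) = cmod z * cos (Arg (- z))" "Im (- z) = cmod z * sin (Arg (- z))"
      by (metis Re_rcis, metis Im_rcis)
    moreover have "cos (Arg (- z)) = - cos B" "\<bar>sin (Arg (- z))\<bar> = sin B"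
    proof -
      have "cos (Arg (- z)) = cos \<bar>Arg (- z)\<bar>" by simp
      then show "cos (Arg (- z)) = - cos B" by (simp add: B_def)
      have "\<bar>sin (Arg (- z))\<bar> = \<bar>sin \<bar>Arg (- z)\<bar>\<bar>" by (simp add: abs_if)
      also have "\<dots> = \<bar>sin B\<bar>" by (simp add: B_def)
      also have "\<dots> = sin B" using B \<delta>1 by (intro abs_of_nonneg sin_ge_zero) auto
      finally show "\<bar>sin (Arg (- z))\<bar> = sin B" .
    qed
    ultimately have zz: "Re z = cmod z * cos B" "\<bar>Im z\<bar> = cmod z * sin B"
      by (auto simp: abs_mult) (metis abs_mult abs_norm_cancel abs_minus_cancel)
    have cB: "cos B > 0" using B \<delta>1 by (intro cos_gt_zero_pi) auto
    have "tan B < tan \<delta>1" using B \<delta>1 by (intro tan_monotone) auto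
    then have "tan B < \<delta>" unfolding \<delta>1_def tan_arctan .
    then have "sin B < \<delta> * cos B" using cB unfolding tan_def by (simp only: pos_divide_less_eq)
    then have "cmod z * sin B < cmod z * (\<delta> * cos B)" using z(2) by simp
    then show False using z(1) zz by (simp add: mult_ac)
  qed
  define K where "K = cball 0 R \<inter> - {z. \<bar>Im z\<bar> < \<delta> * Re z}"
  have "open {z. \<bar>Im z\<bar> < \<delta> * Re z}"
    by (intro open_Collect_less continuous_intros)
  then have K: "compact K" unfolding K_def by (intro compact_Int_closed) auto
  have vK: "v (- z) \<noteq> 0" if "\<not> \<bar>Im z\<bar> < \<delta> * Re z" for z
  proof (cases "Im z = 0")
    case True
    then have "Re z \<le> 0" using that assms by (simp add: zero_less_mult_iff)
    moreover have "- z = of_real (- Re z)" using True by (simp add: complex_eq_iff)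
    ultimately show ?thesis using v_nz_nonneg[of "- Re z"] by simp
  qed (use v_nz_nonreal[of "- z"] in simp)
  have "0 \<in> K" using RC(1) by (simp add: K_def)
  then obtain z0 where z0: "z0 \<in> K" "\<And>z. z \<in> K \<Longrightarrow> cmod (v (- z0)) \<le> cmod (v (- z))"
    using continuous_attains_inf[OF K, of "\<lambda>z. cmod (v (- z))"] by (force intro: continuous_intros)
  define m where "m = cmod (v (- z0))"
  have m: "m > 0" using z0(1) vK[of z0] by (auto simp: m_def K_def)
  show ?thesis
  proof (rule that[of "min m (1/16)"])
    show "min m (1/16) > 0" using m by simp
    fix z assume z: "\<not> \<bar>Im z\<bar> < \<delta> * Re z"
    show "cmod (v (- z)) \<ge> min m (1/16) * exp (- (cmod z powr (3/2)))"
    proof (cases "cmod z \<le> R")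
      case True
      have "min m (1/16) * exp (- (cmod z powr (3/2))) \<le> m * 1" using m by (intro mult_mono) auto
      then show ?thesis using z0(2)[of z] True z by (simp add: m_def K_def)
    next
      case False
      then have z0: "z \<noteq> 0" using RC(1) by auto
      define \<rho> where "\<rho> = v (- z) / lead (- z)"
      have "cmod (\<rho> - 1) \<le> 1/16" using RC(3)[OF _ arg[OF z z0]] False by (simp add: \<rho>_def)
      then have "cmod \<rho> \<ge> 15/16" using norm_triangle_ineq4[of \<rho> "\<rho> - 1"] by simp
      then have 1: "cmod (v (- z)) \<ge> 15/16 * cmod (lead (- z))"
        using z0 by (simp add: \<rho>_def norm_divide pos_le_divide_eq lead_nz)
      define x where "x = cmod z powr (3/2)"
      have x1: "x \<ge> cmod z powr (1/4)" unfolding x_def using False RC(1) by (intro powr_mono) auto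
      have "Re ((- z) powr (3/2)) \<le> x" using complex_Re_le_cmod[of "(- z) powr (3/2)"]
        by (simp add: norm_powr_real_powr' x_def)
      then have e: "exp (- (2/3) * x) \<le> exp (- (2/3) * Re ((- z) powr (3/2)))" by simp
      \<comment> \<open>The leading term costs only 2/3 of the exponent x; the remaining x/3 pays
        for the factor \<open>cmod z powr (1/4)\<close> in its denominator.\<close>
      have "sqrt pi \<le> 2" using pi_less_4 by (intro real_le_lsqrt) auto
      then have "2 * sqrt pi * cmod z powr (1/4) \<le> 2 * 2 * x" using x1 by (intro mult_mono) auto
      also have "\<dots> \<le> 12 * exp (x / 3)" using exp_ge_add_one_self[of "x/3"] by linarith
      finally have "cmod (lead (- z)) \<ge> exp (- (2/3) * x) / (12 * exp (x / 3))"
        unfolding norm_lead using e z0 by (intro frac_le) auto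
      also have "exp (- (2/3) * x) / (12 * exp (x / 3)) = exp (- x) / 12"
        by (simp add: field_simps flip: exp_diff exp_add)
      finally have "15/16 * (exp (-x) / 12) \<le> cmod (v (- z))" using 1 by linarith
      moreover have "min m (1/16) * exp (- x) \<le> 1/16 * exp (-x)" by (intro mult_right_mono) auto
      ultimately show ?thesis using exp_gt_zero[of "-x"] unfolding x_def[symmetric] by linarith
    qed
  qed
qed

text \<open>The 3/2 powers at \<open>be * z\<close> and \<open>al * z\<close> are - i and + i times
  \<open>z powr (3/2)\<close>, which doubles the exponent in the quotient. Below the axis this makes
  exp \<open>Psi\<close> exponentially large.\<close>

lemma exp_Psi_lower:
  obtains R where "R \<ge> 1" 
    "\<And>z. Re z > 0 \<Longrightarrow> cmod z \<ge> R \<Longrightarrow> cmod (v (be * z) / v (al * z)) \<ge> 1/2 * exp (- (4/3) * Im (z powr (3/2)))"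
proof -
  obtain R where R: "R \<ge> 1" 
    "\<And>z. Re z > 0 \<Longrightarrow> cmod z \<ge> R \<Longrightarrow> cmod (v (al * z) / lead (al * z) - 1) \<le> 1/16"
    "\<And>z. Re z > 0 \<Longrightarrow> cmod z \<ge> R \<Longrightarrow> cmod (v (be * z) / lead (be * z) - 1) \<le> 1/16"
    using asymp_right by metis
  show ?thesis
  proof (rule that[OF R(1)])
    fix z assume z: "Re z > 0" "cmod z \<ge> R"
    define a where "a = v (al * z) / lead (al * z)"
    define b where "b = v (be * z) / lead (be * z)"
    have z0: "z \<noteq> 0" using z by auto
    have "cmod (a - 1) \<le> 1/16" "cmod (b - 1) \<le> 1/16" using R(2,3)[OF z] by (simp_all add: a_def b_def)
    then have ab: "cmod a \<le> 17/16" "cmod b \<ge> 15/16" "cmod a > 0" 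
      using norm_triangle_ineq[of "a - 1" 1] norm_triangle_ineq4[of b "b - 1"] norm_triangle_ineq4[of a "a - 1"] by auto
    define l where "l = cmod (lead (be * z)) / cmod (lead (al * z))"
    have l: "l = exp (- (4/3) * Im (z powr (3/2)))"
    proof -
      define T where "T = Im (z powr (3/2))"
      have "cmod (lead (al * z)) = exp (2/3 * T) / (2 * sqrt pi * cmod z powr (1/4))"
        unfolding norm_lead powr_al_be_three_halves[OF z(1)] by (simp add: T_def)
      moreover have "cmod (lead (be * z)) = exp (- (2/3) * T) / (2 * sqrt pi * cmod z powr (1/4))"
        unfolding norm_lead powr_al_be_three_halves[OF z(1)] by (simp add: T_def)
      ultimately have "l = exp (- (2/3) * T) / exp (2/3 * T)" unfolding l_def using z0 by simp
      also have "\<dots> = exp (- (4/3) * T)" by (simp flip: exp_diff)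
      finally show ?thesis by (simp add: T_def)
    qed
    have "v (be * z) / v (al * z) = b * lead (be * z) / (a * lead (al * z))"
      using z0 by (simp add: a_def b_def lead_nz)
    then have "cmod (v (be * z) / v (al * z)) = cmod b / cmod a * l"
      by (simp add: norm_mult norm_divide l_def)
    moreover have "(15/16) / (17/16) \<le> cmod b / cmod a" using ab by (intro frac_le) auto
    then have "1/2 \<le> cmod b / cmod a" by simp
    then have "1/2 * l \<le> cmod b / cmod a * l" by (intro mult_right_mono) (auto simp: l_def)
    ultimately show "cmod (v (be * z) / v (al * z)) \<ge> 1/2 * exp (- (4/3) * Im (z powr (3/2)))"
      by (simp add: l)
  qed
qed

end

subsection \<open>The eigenvalue problem\<close>

text \<open>With \<lambda> = exp (-i pi/6) t - 1 this is exp (i pi/6) (1 - \<lambda>), the rotated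
  distance to the endpoint x = 1; times \<open>\<epsilon> powr (-1/3)\<close> it is the Airy
  argument there.\<close>

definition right_dist :: "complex \<Rightarrow> complex" where "right_dist t = 2 * cis (pi/6) - t"

lemma right_dist_sel [simp]: "Re (right_dist t) = sqrt 3 - Re t" "Im (right_dist t) = 1 - Im t"
  by (auto simp: right_dist_def cos_30 sin_30)

definition phi_ext :: "complex \<Rightarrow> real" where "phi_ext t = 4/3 * Re (right_dist t powr (3/2))"

lemma \<phi>_eq_phi_ext: "\<phi> t = phi_ext (of_real t)"
  by (simp add: \<phi>_def phi_ext_def right_dist_def cis_conv_exp)

lemma powr_three_halves_deriv:
  assumes "Re z > 0"
  shows "((\<lambda>z. z powr (3/2)) has_field_derivative 3/2 * csqrt z) (at z)"
proof -
  have "z \<notin> \<real>\<^sub>\<le>\<^sub>0" using assms by (auto simp: complex_nonpos_Reals_iff)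
  from has_field_derivative_powr[OF this, of "3/2"] show ?thesis by (simp add: csqrt_conv_powr)
qed

lemma right_dist_powr_deriv:
  assumes "Re t < sqrt 3"
  shows "((\<lambda>t. right_dist t powr (3/2)) has_field_derivative - (3/2 * csqrt (right_dist t))) (at t)"
proof -
  have "(right_dist has_field_derivative -1) (at t)"
    unfolding right_dist_def by (auto intro!: derivative_eq_intros)
  from DERIV_chain2[OF powr_three_halves_deriv this] assms show ?thesis by simp
qed

lemma sqrt3_bounds: "sqrt 3 > 173/100" "sqrt 3 < 1733/1000" "2 / sqrt 3 < 116/100" "2 / sqrt 3 > 115/100" "1 / sqrt 3 > 57/100"
proof -
  show 1: "sqrt 3 > 173/100" by (rule real_less_rsqrt) (simp add: power2_eq_square)
  show 2: "sqrt 3 < 1733/1000" by (rule real_less_lsqrt) (auto simp: power2_eq_square)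
  have p: "sqrt 3 > 0" by simp
  show "2 / sqrt 3 < 116/100" unfolding pos_divide_less_eq[OF p] using 1 by linarith
  show "2 / sqrt 3 > 115/100" unfolding pos_less_divide_eq[OF p] using 2 by linarith
  show "1 / sqrt 3 > 57/100" unfolding pos_less_divide_eq[OF p] using 2 by linarith
qed

text \<open>At the end of the segment \<open>right_dist\<close> has argument pi/3, so its 3/2 power
  is purely imaginary.\<close>

lemma phi_ext_end: "phi_ext (of_real (2 / sqrt 3)) = 0"
proof -
  have s3: "sqrt 3 * sqrt 3 = 3" by simp
  have "right_dist (of_real (2 / sqrt 3)) = of_real (2 / sqrt 3) * cis (pi/3)"
    using s3 by (auto simp: complex_eq_iff cos_60 sin_60 field_simps)
  moreover have "Ln (of_real (2 / sqrt 3) * cis (pi/3)) = of_real (ln (2 / sqrt 3)) + \<i> * of_real (pi/3)"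
  proof -
    have "Ln (cis (pi/3)) = \<i> * of_real (pi/3)" using pi_gt_zero by (subst Ln_cis) auto
    moreover have "2 / sqrt 3 > 0" by simp
    ultimately show ?thesis by (simp only: Ln_times_of_real Ln_of_real cis_neq_zero not_False_eq_True)
  qed
  ultimately have "right_dist (of_real (2 / sqrt 3)) powr (3/2) = exp (3/2 * (of_real (ln (2 / sqrt 3)) + \<i> * of_real (pi/3)))"
    by (simp only: powr_def) simp
  also have "Re \<dots> = 0"
    by (simp add: Re_exp)
  finally show ?thesis by (simp add: phi_ext_def)
qed

text \<open>On the real axis the imaginary part of \<open>right_dist\<close> is 1, so its square
  root has real part at least 1/2, and \<phi> falls towards its zero 2 / sqrt 3 with slope at most
  -1.\<close>

lemma phi_ext_real_lower:
  assumes "s \<le> 2 / sqrt 3"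
  shows "phi_ext (of_real s) \<ge> 2 / sqrt 3 - s"
proof -
  define G where "G s = phi_ext (of_real s) + s" for s
  have "G (2 / sqrt 3) \<le> G s"
  proof (rule DERIV_nonpos_imp_nonincreasing[where f = G, OF assms])
    fix x assume x: "s \<le> x" "x \<le> 2 / sqrt 3"
    then have x1: "x < sqrt 3" using sqrt3_bounds by linarith
    then have xr: "Re (0 + of_real x * 1) < sqrt 3" by simp
    from DERIV_add[OF DERIV_cmult[OF has_real_derivative_Re[OF has_vector_derivative_line[OF right_dist_powr_deriv[OF xr]]], of "4/3"] DERIV_ident]
    have "(G has_real_derivative 4/3 * Re (- (3/2 * csqrt (right_dist (of_real x)))) + 1) (at x)"
      unfolding G_def phi_ext_def by simp
    moreover have "Re (csqrt (right_dist (of_real x))) \<ge> 1/2"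
    proof -
      have "1/4 \<le> (cmod (right_dist (of_real x)) + Re (right_dist (of_real x))) / 2"
        using abs_Im_le_cmod[of "right_dist (of_real x)"] x1 by simp
      then have "sqrt (1/4) \<le> Re (csqrt (right_dist (of_real x)))"
        unfolding csqrt.sel by (rule real_sqrt_le_mono)
      then show ?thesis by (simp add: real_sqrt_divide)
    qed
    ultimately show "\<exists>y. (G has_real_derivative y) (at x) \<and> y \<le> 0"
      by (intro exI[of _ "4/3 * Re (- (3/2 * csqrt (right_dist (of_real x)))) + 1"]) simp
  qed
  then show ?thesis using phi_ext_end by (simp add: G_def)
qed

lemma csqrt_quadrant:
  assumes "Re q > 0" "0 \<le> Im q" "Im q \<le> 2"
  shows "0 \<le> Im (csqrt q)" "Im (csqrt q) \<le> 1"
proof -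
  have eq: "Im (csqrt q) = sqrt ((cmod q - Re q) / 2)"
    using assms complex_Re_le_cmod[of q] by (cases "Im q = 0") (auto simp: cmod_def)
  show "0 \<le> Im (csqrt q)" unfolding eq using complex_Re_le_cmod[of q] by simp
  have "cmod q \<le> Re q + Im q" using cmod_le[of q] assms by simp
  then have "(cmod q - Re q) / 2 \<le> 1" using assms by simp
  then show "Im (csqrt q) \<le> 1" unfolding eq by simp
qed

lemma phi_ext_vertical_deriv:
  assumes "s < sqrt 3"
  shows "((\<lambda>y. phi_ext (of_real s + of_real y * \<i>)) has_real_derivative 2 * Im (csqrt (right_dist (of_real s + of_real y * \<i>)))) (at y)"
proof -
  have xr: "Re (of_real s + of_real y * \<i>) < sqrt 3" using assms by simp
  from DERIV_cmult[OF has_real_derivative_Re[OF has_vector_derivative_line[OF right_dist_powr_deriv[OF xr]]], of "4/3"]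
  show ?thesis unfolding phi_ext_def by simp
qed

text \<open>The vertical derivative is 2 Im sqrt(\<open>right_dist\<close>), which lies between 0
  and 2. Above the axis the exponent therefore only gains; below it loses at most twice the
  depth.\<close>

lemma phi_ext_lower:
  assumes "Re t \<le> 2 / sqrt 3" "\<bar>Im t\<bar> \<le> 1"
  shows "phi_ext t \<ge> phi_ext (of_real (Re t)) - 2 * max 0 (- Im t)"
proof -
  define s where "s = Re t"
  define f where "f y = phi_ext (of_real s + of_real y * \<i>)" for y
  have s: "s < sqrt 3" using assms(1) sqrt3_bounds by (simp add: s_def)
  have df: "(f has_real_derivative 2 * Im (csqrt (right_dist (of_real s + of_real y * \<i>)))) (at y)" for y
    unfolding f_def by (rule phi_ext_vertical_deriv[OF s])
  have b: "0 \<le> Im (csqrt (right_dist (of_real s + of_real y * \<i>)))" "Im (csqrt (right_dist (of_real s + of_real y * \<i>))) \<le> 1"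
    if "-1 \<le> y" "y \<le> 1" for y
    by (rule csqrt_quadrant; use s that in simp)+
  have t: "t = of_real s + of_real (Im t) * \<i>" by (simp add: complex_eq_iff s_def)
  show ?thesis
  proof (cases "Im t \<ge> 0")
    case True
    have "f 0 \<le> f (Im t)"
      by (rule DERIV_nonneg_imp_nondecreasing[where f = f, OF True])
         (use df b assms in \<open>force\<close>)
    then show ?thesis using True t by (simp add: f_def s_def)
  next
    case False
    define g where "g y = f y - 2 * y" for y
    have "g 0 \<le> g (Im t)"
    proof (rule DERIV_nonpos_imp_nonincreasing[where f = g])
      show "Im t \<le> 0" using False by simp
      fix y assume y: "Im t \<le> y" "y \<le> 0"
      have "(g has_real_derivative 2 * Im (csqrt (right_dist (of_real s + of_real y * \<i>))) - 2) (at y)"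
        unfolding g_def by (rule derivative_eq_intros df refl | simp)+
      then show "\<exists>y'. (g has_real_derivative y') (at y) \<and> y' \<le> 0" 
        using b[of y] y assms(2) by force
    qed
    then show ?thesis using False t by (simp add: f_def g_def s_def)
  qed
qed

lemma phi_ext_lower_lin:
  assumes "Re t \<le> 2 / sqrt 3" "\<bar>Im t\<bar> \<le> 1"
  shows "phi_ext t \<ge> (2 / sqrt 3 - Re t) - 2 * max 0 (- Im t)"
  using phi_ext_lower[OF assms] phi_ext_real_lower[OF assms(1)] by linarith

text \<open>The bound Re t <= 3/2 < sqrt 3 keeps \<open>right_dist\<close> away from the branch cut
  and of modulus at most 4, so the 3/2 power has derivative at most 3; the factor 4/3 makes this
  4.\<close>

lemma phi_ext_lipschitz:
  assumes "\<And>t. t \<in> {t1, t2} \<Longrightarrow> 0 \<le> Re t \<and> Re t \<le> 3/2 \<and> \<bar>Im t\<bar> \<le> 1"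
  shows "\<bar>phi_ext t1 - phi_ext t2\<bar> \<le> 4 * cmod (t1 - t2)"
proof -
  define S where "S = cbox (Complex 0 (-1)) (Complex (3/2) 1)"
  have inS: "z \<in> S \<longleftrightarrow> 0 \<le> Re z \<and> Re z \<le> 3/2 \<and> -1 \<le> Im z \<and> Im z \<le> 1" for z
    by (auto simp: S_def in_cbox_complex_iff)
  have "cmod (right_dist t1 powr (3/2) - right_dist t2 powr (3/2)) \<le> 3 * cmod (t1 - t2)"
  proof (rule field_differentiable_bound[of S])
    show "convex S" unfolding S_def by (rule convex_box)
    fix z assume z: "z \<in> S"
    then have "Re z < sqrt 3" using sqrt3_bounds by (simp add: inS)
    from right_dist_powr_deriv[OF this] show "((\<lambda>t. right_dist t powr (3/2)) has_field_derivative - (3/2 * csqrt (right_dist z))) (at z within S)"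
      by (rule has_field_derivative_at_within)
    have "cmod (right_dist z) \<le> 4" using cmod_le[of "right_dist z"] z sqrt3_bounds by (simp add: inS)
    then have "sqrt (cmod (right_dist z)) \<le> 2" by (intro real_le_lsqrt) auto
    then show "cmod (- (3/2 * csqrt (right_dist z))) \<le> 3" by (simp add: norm_mult)
  next
    show "t1 \<in> S" "t2 \<in> S" using assms[of t1] assms[of t2] by (auto simp: inS)
  qed
  moreover have "\<bar>Re (right_dist t1 powr (3/2) - right_dist t2 powr (3/2))\<bar> \<le> cmod (right_dist t1 powr (3/2) - right_dist t2 powr (3/2))"
    by (rule abs_Re_le_cmod)
  moreover have "phi_ext t1 - phi_ext t2 = 4/3 * Re (right_dist t1 powr (3/2) - right_dist t2 powr (3/2))" by (simp add: phi_ext_def)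
  ultimately show ?thesis by simp
qed

text \<open>For Re t >= 1 the square root has real part at least 1. After multiplication by 4/3 the
  slope 3/2 becomes 2, exactly the largest loss in \<open>phi_ext_lower\<close>, so that exp
  \<open>Psi\<close> grows below the axis at least as fast as the bound for h.\<close>

lemma Im_powr_three_halves_lower:
  assumes "Re t \<ge> 1" "Im t \<le> 0"
  shows "Im (t powr (3/2)) \<le> 3/2 * Im t"
proof -
  define s where "s = Re t"
  define f where "f y = Im ((of_real s + of_real y * \<i>) powr (3/2)) - 3/2 * y" for y
  have "f (Im t) \<le> f 0"
  proof (rule DERIV_nonneg_imp_nondecreasing[where f = f, OF assms(2)])
    fix y
    have r: "Re (of_real s + of_real y * \<i>) > 0" using assms by (simp add: s_def)
    define c where "c = csqrt (of_real s + of_real y * \<i>)"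
    have d: "((\<lambda>y. Im ((of_real s + of_real y * \<i>) powr (3/2))) has_real_derivative 3/2 * Re c) (at y)"
      using has_real_derivative_Im[OF has_vector_derivative_line[OF powr_three_halves_deriv[OF r]]] by (simp add: c_def)
    have "(f has_real_derivative 3/2 * Re c - 3/2) (at y)"
      unfolding f_def by (rule derivative_eq_intros d refl | simp)+
    moreover have "Re c \<ge> 1"
    proof -
      have "1 \<le> (cmod (of_real s + of_real y * \<i>) + Re (of_real s + of_real y * \<i>)) / 2"
        using complex_Re_le_cmod[of "of_real s + of_real y * \<i>"] assms by (simp add: s_def)
      then have "sqrt 1 \<le> Re c" unfolding c_def csqrt.sel by (rule real_sqrt_le_mono)
      then show ?thesis by simp
    qed
    ultimately show "\<exists>y'. (f has_real_derivative y') (at y) \<and> 0 \<le> y'" by force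
  qed
  moreover have "t = of_real s + of_real (Im t) * \<i>" by (simp add: complex_eq_iff s_def)
  moreover have "Im (of_real s powr (3/2)) = 0"
    using powr_of_real[of s "3/2"] assms by (simp add: s_def)
  ultimately show ?thesis by (simp add: f_def)
qed

lemma powr_scale:
  fixes z :: complex
  assumes "r > 0" "z \<noteq> 0"
  shows "(of_real r * z) powr (3/2) = of_real (r powr (3/2)) * z powr (3/2)"
proof -
  have "exp (3/2 * of_real (ln r)) = (of_real (r powr (3/2)) :: complex)"
    using assms by (simp add: powr_def flip: exp_of_real)
  then show ?thesis using assms
    by (simp add: powr_def[of "of_real r * z"] powr_def[of z] Ln_times_of_real Ln_of_real distrib_left exp_add)
qed

section \<open>The reflection symmetry and the characteristic equation\<close>

lemma eigenvalue_reflect: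
  assumes "eigenvalue \<epsilon> \<mu>"
  shows "eigenvalue \<epsilon> (- cnj \<mu>)"
proof -
  from assms obtain y y' y'' :: "real \<Rightarrow> complex" where
    c: "continuous_on {-1..1} y" and
    d: "\<And>x. x\<in>{-1<..<1} \<Longrightarrow> (y has_vector_derivative y' x) (at x) \<and>
           (y' has_vector_derivative y'' x) (at x) \<and>
           - \<i> * of_real \<epsilon> * y'' x = (of_real x - \<mu>) * y x" and
    bc: "y (-1) = 0" "y 1 = 0" and nz: "\<exists>x\<in>{-1..1}. y x \<noteq> 0"
    unfolding eigenvalue_def by blast
  \<comment> \<open>Conjugation changes the sign of the imaginary unit and x -> - x changes the sign
    of x, so the equation returns with \<open>- cnj \<mu>\<close> in place of \<mu>.\<close>
  define z where "z x = cnj (y (- x))" for x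
  define z' where "z' x = - cnj (y' (- x))" for x
  define z'' where "z'' x = cnj (y'' (- x))" for x
  have neg: "((\<lambda>x. f (- x)) has_vector_derivative - f') (at x)"
    if "(f has_vector_derivative f') (at (- x))" for f :: "real \<Rightarrow> complex" and f' x
  proof -
    have "((\<lambda>x::real. - x) has_vector_derivative -1) (at x)"
      by (auto intro!: derivative_eq_intros)
    from vector_diff_chain_at[OF this that] show ?thesis by (simp add: o_def)
  qed
  show ?thesis
    unfolding eigenvalue_def
  proof (rule exI[of _ z], rule exI[of _ z'], rule exI[of _ z''], intro conjI ballI)
    show "continuous_on {- 1..1} z"
      unfolding z_def by (intro continuous_intros continuous_on_compose2[OF c]) auto
    show "z (-1) = 0" "z 1 = 0" using bc by (auto simp: z_def)
    from nz obtain x where "x \<in> {-1..1}" "y x \<noteq> 0" by blast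
    then show "\<exists>x\<in>{-1..1}. z x \<noteq> 0" by (intro bexI[of _ "- x"]) (auto simp: z_def)
  next
    fix x :: real assume "x \<in> {-1<..<1}"
    then have "- x \<in> {-1<..<1}" by auto
    note D = d[OF this]
    have 1: "((\<lambda>x. cnj (y (- x))) has_vector_derivative cnj (- y' (- x))) (at x)"
      by (intro has_vector_derivative_cnj neg) (use D in auto)
    then show "(z has_vector_derivative z' x) (at x)" by (simp add: z_def[abs_def] z'_def)
    have "((\<lambda>x. - cnj (y' (- x))) has_vector_derivative - cnj (- y'' (- x))) (at x)"
      by (intro has_vector_derivative_minus has_vector_derivative_cnj neg) (use D in auto)
    then show "(z' has_vector_derivative z'' x) (at x)" by (simp add: z'_def[abs_def] z''_def)
    have "cnj (- \<i> * of_real \<epsilon> * y'' (- x)) = cnj ((of_real (- x) - \<mu>) * y (- x))" using D by simp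
    then have "\<i> * of_real \<epsilon> * z'' x = (- of_real x - cnj \<mu>) * z x" by (simp add: z_def z''_def)
    then have "- (\<i> * of_real \<epsilon> * z'' x) = - ((- of_real x - cnj \<mu>) * z x)" by (rule arg_cong)
    then show "- \<i> * of_real \<epsilon> * z'' x = (of_real x - - cnj \<mu>) * z x"
      by (simp only: mult_minus_left [symmetric]) simp
  qed
qed

lemma eigenvalue_reflect_iff: "eigenvalue \<epsilon> \<mu> \<longleftrightarrow> eigenvalue \<epsilon> (- cnj \<mu>)"
  using eigenvalue_reflect[of \<epsilon> \<mu>] eigenvalue_reflect[of \<epsilon> "- cnj \<mu>"] by auto

context airy
begin

text \<open>The affine substitution with cubed coefficient i/\<epsilon>, which turns the
  differential equation into the Airy equation.\<close>

definition \<xi>1 :: "real \<Rightarrow> complex \<Rightarrow> real \<Rightarrow> complex" where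
  "\<xi>1 \<epsilon> \<mu> x = of_real (\<epsilon> powr (-1/3)) * cis (pi/6) * (of_real x - \<mu>)"

text \<open>The condition says that the matrix of boundary values of the two basis solutions is
  singular. An eigenfunction is written in this basis through its Wronskians; conversely a
  combination vanishing at -1 is given explicitly.\<close>

lemma eigenvalue_iff:
  assumes \<epsilon>: "\<epsilon> > 0"
  shows "eigenvalue \<epsilon> \<mu> \<longleftrightarrow>
    v (\<xi>1 \<epsilon> \<mu> (-1)) * v (- al * \<xi>1 \<epsilon> \<mu> 1) = v (\<xi>1 \<epsilon> \<mu> 1) * v (- al * \<xi>1 \<epsilon> \<mu> (-1))"
proof -
  define c where "c = of_real (\<epsilon> powr (-1/3)) * cis (pi/6)"
  define \<xi> where "\<xi> = \<xi>1 \<epsilon> \<mu>"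
  have \<xi>: "\<xi> x = c * (of_real x - \<mu>)" for x by (simp add: \<xi>_def \<xi>1_def c_def)
  have c0: "c \<noteq> 0" using \<epsilon> by (simp add: c_def)
  have c3: "c^3 = \<i> / of_real \<epsilon>"
  proof -
    have "(\<epsilon> powr (-1/3)) ^ 3 = \<epsilon> powr (-1)"
      using \<epsilon> by (simp flip: powr_realpow add: powr_powr)
    then have e3: "(of_real (\<epsilon> powr (-1/3)))^3 = (of_real (\<epsilon> powr (-1)) :: complex)"
      by (metis of_real_power)
    have "cis (pi/6) ^ 3 = cis (real 3 * (pi/6))" by (simp only: Complex.DeMoivre)
    then have "cis (pi/6) ^ 3 = \<i>" by simp
    then show ?thesis unfolding c_def power_mult_distrib e3 using \<epsilon> by (simp add: powr_minus divide_simps)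
  qed
  define W where "W = (1 + al) * (v 0 * vd 0)"
  have W: "vd b * v (- al * b) + al * v b * vd (- al * b) = W" for b
    unfolding W_def by (rule wronskian_al)
  have Wnz: "W \<noteq> 0" unfolding W_def by (rule wronskian_al_nz)
  define u where "u \<kappa> x = v (\<kappa> * \<xi> x)" for \<kappa> x
  define u' where "u' \<kappa> x = \<kappa> * c * vd (\<kappa> * \<xi> x)" for \<kappa> x
  define u'' where "u'' \<kappa> x = \<kappa> * c * (\<kappa> * c * (\<kappa> * \<xi> x * v (\<kappa> * \<xi> x)))" for \<kappa> x
  have lin: "\<kappa> * \<xi> x = \<kappa> * c * (- \<mu>) + of_real x * (\<kappa> * c)" for \<kappa> x by (simp add: \<xi> algebra_simps)
  have du: "(u \<kappa> has_vector_derivative u' \<kappa> x) (at x)" for \<kappa> x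
    unfolding u_def[abs_def] u'_def lin by (rule v_vector_deriv)
  have du': "(u' \<kappa> has_vector_derivative u'' \<kappa> x) (at x)" for \<kappa> x
    unfolding u'_def[abs_def] u''_def lin
    by (rule has_vector_derivative_mult_right[OF vd_vector_deriv])
  have ode: "u'' \<kappa> x = \<i> / of_real \<epsilon> * (of_real x - \<mu>) * u \<kappa> x" if "\<kappa>^3 = 1" for \<kappa> x
  proof -
    have "u'' \<kappa> x = \<kappa>^3 * c^3 * (of_real x - \<mu>) * u \<kappa> x"
      by (simp add: u''_def u_def \<xi> power3_eq_cube)
    then show ?thesis using that c3 by simp
  qed
  have mal3: "(- al)^3 = 1" using al_be(4) by (simp add: power3_eq_cube)
  have wr: "u' 1 x * u (- al) x - u' (- al) x * u 1 x = c * W" for x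
    unfolding W[of "\<xi> x", symmetric] by (simp add: u_def u'_def algebra_simps)
  show ?thesis
  proof
    assume "eigenvalue \<epsilon> \<mu>"
    then obtain y y' y'' :: "real \<Rightarrow> complex" where
      cont: "continuous_on {-1..1} y" and
      d: "\<And>x. x\<in>{-1<..<1} \<Longrightarrow> (y has_vector_derivative y' x) (at x) \<and>
             (y' has_vector_derivative y'' x) (at x) \<and>
             - \<i> * of_real \<epsilon> * y'' x = (of_real x - \<mu>) * y x" and
      bc: "y (-1) = 0" "y 1 = 0" and nz: "\<exists>x\<in>{-1..1}. y x \<noteq> 0"
      unfolding eigenvalue_def by blast
    have yode: "y'' x = \<i> / of_real \<epsilon> * (of_real x - \<mu>) * y x" if "x\<in>{-1<..<1}" for x
    proof -
      have "- \<i> * of_real \<epsilon> * y'' x = (of_real x - \<mu>) * y x" using d[OF that] by blast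
      then have "\<i> * (- \<i> * of_real \<epsilon> * y'' x) = \<i> * ((of_real x - \<mu>) * y x)" by simp
      then have "of_real \<epsilon> * y'' x = \<i> * (of_real x - \<mu>) * y x" by (simp add: mult.assoc flip: mult.assoc[of \<i> \<i>])
      then show ?thesis using \<epsilon> by (simp add: field_simps)
    qed
    have "\<exists>K. \<forall>x\<in>{-1<..<1}. y x * u' \<kappa> x - y' x * u \<kappa> x = K" if \<kappa>3: "\<kappa>^3 = 1" for \<kappa>
    proof -
      have "((\<lambda>x. y x * u' \<kappa> x - y' x * u \<kappa> x) has_derivative (\<lambda>h. 0)) (at x within {-1<..<1})"
        if x: "x\<in>{-1<..<1}" for x
      proof -
        have "((\<lambda>x. y x * u' \<kappa> x - y' x * u \<kappa> x) has_vector_derivative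
            (y x * u'' \<kappa> x + y' x * u' \<kappa> x) - (y' x * u' \<kappa> x + y'' x * u \<kappa> x)) (at x)"
          by (intro has_vector_derivative_diff has_vector_derivative_mult du du') (use d[OF x] in auto)
        moreover have "(y x * u'' \<kappa> x + y' x * u' \<kappa> x) - (y' x * u' \<kappa> x + y'' x * u \<kappa> x) = 0"
          unfolding ode[OF \<kappa>3] yode[OF x] by (simp add: algebra_simps)
        ultimately show ?thesis
          by (simp add: has_vector_derivative_def has_derivative_at_withinI)
      qed
      then show ?thesis
        using has_derivative_zero_constant[of "{-1<..<1::real}" "\<lambda>x. y x * u' \<kappa> x - y' x * u \<kappa> x"] by auto
    qed
    from this[of 1] this[OF mal3] obtain K1 K2 where
      K1: "\<And>x. x\<in>{-1<..<1} \<Longrightarrow> y x * u' 1 x - y' x * u 1 x = K1" and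
      K2: "\<And>x. x\<in>{-1<..<1} \<Longrightarrow> y x * u' (- al) x - y' x * u (- al) x = K2" by auto
    \<comment> \<open>Cramer's rule: the Wronskians \<open>K1\<close> and \<open>K2\<close> of y
      with the basis are its coefficients up to sign and the factor \<open>c * W\<close>.\<close>
    define f where "f x = y x * (c * W) - (K1 * u (- al) x - K2 * u 1 x)" for x
    have f0: "f x = 0" if "x\<in>{-1<..<1}" for x
      unfolding f_def wr[of x, symmetric] K1[OF that, symmetric] K2[OF that, symmetric]
      by (simp add: algebra_simps)
    have cu: "continuous_on S (u \<kappa>)" for \<kappa> S
      by (rule continuous_at_imp_continuous_on) (use has_vector_derivative_continuous[OF du] in auto)
    \<comment> \<open>The equation holds only in the open interval, so the representation of y
      reaches the two endpoints by continuity.\<close>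
    have cl: "closure {-1<..<1::real} = {-1..1}" by simp
    have "continuous_on {-1..1} f"
      unfolding f_def[abs_def] by (intro continuous_intros cont cu)
    then have "f x = 0" if "x\<in>{-1..1}" for x
      using that f0 continuous_constant_on_closure[of "{-1<..<1}" f 0 x] unfolding cl by blast
    then have yx: "y x * (c * W) = K1 * u (- al) x - K2 * u 1 x" if "x\<in>{-1..1}" for x
      using that by (simp add: f_def)
    have nK: "K1 \<noteq> 0 \<or> K2 \<noteq> 0"
    proof (rule ccontr)
      assume "\<not> ?thesis"
      then have "y x = 0" if "x\<in>{-1..1}" for x using yx[OF that] Wnz c0 by simp
      then show False using nz by blast
    qed
    have e: "K1 * u (- al) (-1) = K2 * u 1 (-1)" "K1 * u (- al) 1 = K2 * u 1 1"
      using yx[of "-1"] yx[of 1] bc by auto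
    have "u 1 (-1) * u (- al) 1 = u 1 1 * u (- al) (-1)"
    proof (cases "K1 = 0")
      case True
      then show ?thesis using e nK by auto
    next
      case False
      have "K1 * (u 1 (-1) * u (- al) 1) = u 1 (-1) * (K1 * u (- al) 1)" by simp
      also have "\<dots> = u 1 1 * (K2 * u 1 (-1))" unfolding e by simp
      also have "\<dots> = K1 * (u 1 1 * u (- al) (-1))" unfolding e[symmetric] by simp
      finally show ?thesis using False by simp
    qed
    then show "v (\<xi>1 \<epsilon> \<mu> (-1)) * v (- al * \<xi>1 \<epsilon> \<mu> 1) = v (\<xi>1 \<epsilon> \<mu> 1) * v (- al * \<xi>1 \<epsilon> \<mu> (-1))"
      by (simp add: u_def \<xi>_def)
  next
    assume eq: "v (\<xi>1 \<epsilon> \<mu> (-1)) * v (- al * \<xi>1 \<epsilon> \<mu> 1) = v (\<xi>1 \<epsilon> \<mu> 1) * v (- al * \<xi>1 \<epsilon> \<mu> (-1))"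
    define A where "A = u (- al) (-1)"
    define B where "B = - u 1 (-1)"
    define y where "y x = A * u 1 x + B * u (- al) x" for x
    define y' where "y' x = A * u' 1 x + B * u' (- al) x" for x
    define y'' where "y'' x = A * u'' 1 x + B * u'' (- al) x" for x
    have dy: "(y has_vector_derivative y' x) (at x)" for x
      unfolding y_def[abs_def] y'_def by (intro has_vector_derivative_add has_vector_derivative_mult_right du)
    have dy': "(y' has_vector_derivative y'' x) (at x)" for x
      unfolding y'_def[abs_def] y''_def by (intro has_vector_derivative_add has_vector_derivative_mult_right du')
    show "eigenvalue \<epsilon> \<mu>"
      unfolding eigenvalue_def
    proof (rule exI[of _ y], rule exI[of _ y'], rule exI[of _ y''], intro conjI ballI dy dy')
      show "continuous_on {-1..1} y"
        by (rule continuous_at_imp_continuous_on) (use has_vector_derivative_continuous[OF dy] in auto)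
      show "y (-1) = 0" by (simp add: y_def A_def B_def)
      show "y 1 = 0" using eq by (simp add: y_def A_def B_def u_def \<xi>_def)
      show "- \<i> * of_real \<epsilon> * y'' x = (of_real x - \<mu>) * y x" for x
      proof -
        have "y'' x = \<i> / of_real \<epsilon> * (of_real x - \<mu>) * y x"
          unfolding y''_def y_def ode[OF mal3] ode[of 1, simplified] by (simp add: algebra_simps)
        then have "- \<i> * of_real \<epsilon> * y'' x = (- \<i> * \<i>) * (of_real \<epsilon> / of_real \<epsilon>) * ((of_real x - \<mu>) * y x)"
          by (simp add: mult.assoc)
        then show ?thesis using \<epsilon> by simp
      qed
      show "\<exists>x\<in>{-1..1}. y x \<noteq> 0"
      proof (rule ccontr)
        assume "\<not> ?thesis"
        then have y0: "y x = 0" if "x\<in>{-1..1}" for x using that by blast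
        have "(y has_vector_derivative 0) (at 0)"
        proof (rule has_vector_derivative_transform_within_open[of "\<lambda>_. 0" _ _ "{-1<..<1}"])
          show "((\<lambda>_. 0) has_vector_derivative 0) (at (0::real))" by (rule has_vector_derivative_const)
        qed (use y0 in auto)
        then have "y' 0 = 0" using dy vector_derivative_unique_at by blast
        then have e2: "A * u' 1 0 + B * u' (- al) 0 = 0" by (simp add: y'_def)
        have e1: "A * u 1 0 + B * u (- al) 0 = 0" using y0[of 0] by (simp add: y_def)
        have "A * (c * W) = (A * u' 1 0 + B * u' (- al) 0) * u (- al) 0 - u' (- al) 0 * (A * u 1 0 + B * u (- al) 0)"
          unfolding wr[of 0, symmetric] by (simp add: algebra_simps)
        then have "A = 0" using e1 e2 Wnz c0 by simp
        have "B * (c * W) = u' 1 0 * (A * u 1 0 + B * u (- al) 0) - (A * u' 1 0 + B * u' (- al) 0) * u 1 0"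
          unfolding wr[of 0, symmetric] by (simp add: algebra_simps)
        then have "B = 0" using e1 e2 Wnz c0 by simp
        \<comment> \<open>\<open>A\<close> and \<open>B\<close> are, up to sign, the values of the
          two basis solutions at -1, and the nonzero Wronskian prevents them from vanishing
          together.\<close>
        then show False using wr[of "-1"] \<open>A = 0\<close> Wnz c0 by (simp add: A_def B_def)
      qed
    qed
  qed
qed

end

subsection \<open>The perturbed characteristic equation\<close>

lemma eventually_powr_small:
  assumes "a > 0" "m > (0::real)"
  shows "\<forall>\<^sub>F \<epsilon> in at_right 0. K * \<epsilon> powr a < m"
proof -
  define b where "b = (m / (\<bar>K\<bar> + 1)) powr (1 / a)"
  have b: "b > 0" "b powr a = m / (\<bar>K\<bar> + 1)" using assms by (auto simp: b_def powr_powr intro!: divide_pos_pos add_nonneg_pos)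
  have "K * \<epsilon> powr a < m" if "0 < \<epsilon>" "\<epsilon> < b" for \<epsilon>
  proof -
    have "\<epsilon> powr a < m / (\<bar>K\<bar> + 1)" using that assms unfolding b(2)[symmetric] by (intro powr_less_mono2) auto
    then have "\<epsilon> powr a * (\<bar>K\<bar> + 1) < m" by (simp add: pos_less_divide_eq add_nonneg_pos)
    moreover have "K * \<epsilon> powr a \<le> (\<bar>K\<bar> + 1) * \<epsilon> powr a" by (intro mult_right_mono) auto
    ultimately show ?thesis by (simp add: mult.commute)
  qed
  then show ?thesis using b(1) by (auto simp: eventually_at_right_field)
qed

lemma eventually_powr_large:
  assumes "a > 0"
  shows "\<forall>\<^sub>F \<epsilon> in at_right 0. \<epsilon> powr (- a) > (M :: real)"
  using eventually_powr_small[OF assms, of 1 M] eventually_at_right_less[of 0]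
  by (auto elim!: eventually_elim2 simp: powr_minus field_simps)

lemma eventually_exp_small:
  assumes "c > 0" "d > (0::real)"
  shows "\<forall>\<^sub>F \<epsilon> in at_right 0. C * exp (- (d * \<epsilon> powr (-1/2))) < c * \<epsilon> powr (1/4)"
proof -
  have "\<forall>\<^sub>F \<epsilon> in at_right 0. (\<bar>C\<bar> / d) * \<epsilon> powr (1/4) < c"
    using assms by (intro eventually_powr_small) auto
  then show ?thesis using eventually_at_right_less[of 0]
  proof eventually_elim
    case (elim \<epsilon>)
    define y where "y = d * \<epsilon> powr (-1/2)"
    have y: "y > 0" using elim assms by (simp add: y_def)
    have "y \<le> exp y" using exp_ge_add_one_self[of y] by linarith
    then have "exp (- y) \<le> 1 / y" using y by (simp add: exp_minus field_simps)
    also have "1 / y = \<epsilon> powr (1/2) / d" using elim by (simp add: y_def powr_minus field_simps)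
    finally have "\<bar>C\<bar> * exp (- y) \<le> \<bar>C\<bar> * (\<epsilon> powr (1/2) / d)" by (intro mult_left_mono) auto
    also have "\<dots> = (\<bar>C\<bar> / d * \<epsilon> powr (1/4)) * \<epsilon> powr (1/4)" by (simp flip: powr_add)
    also have "\<dots> < c * \<epsilon> powr (1/4)" using elim by (intro mult_strict_right_mono) auto
    finally have "\<bar>C\<bar> * exp (- y) < c * \<epsilon> powr (1/4)" .
    moreover have "C * exp (- y) \<le> \<bar>C\<bar> * exp (- y)" by (intro mult_right_mono) auto
    ultimately have "C * exp (- y) < c * \<epsilon> powr (1/4)" by linarith
    then show ?case unfolding y_def .
  qed
qed

text \<open>The logarithm in \<open>t_max\<close> makes \<open>h = O(\<epsilon> powr (1/4))\<close>, which outweighs the factor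
  \<open>\<bar>b\<bar> powr (1/2) = O(\<epsilon> powr (-1/6))\<close> of \<open>h'\<close> and is small against the spacing of the zeros.\<close>

lemma phi_ext_exp_bound:
  assumes "0 < \<epsilon>" "\<epsilon> < 1" "\<theta> \<ge> 1/4" "Re t \<le> 2 / sqrt 3" "\<bar>Im t\<bar> \<le> 1"
    "Re t \<le> t_max \<theta> \<epsilon> + x * \<epsilon> powr (1/2)"
  shows "exp (- (\<epsilon> powr (-1/2) * phi_ext t)) \<le> \<epsilon> powr (1/4) * exp (x + 2 * (\<epsilon> powr (-1/2) * max 0 (- Im t)))"
proof -
  define e where "e = \<epsilon> powr (-1/2)"
  have e: "e > 0" "e * \<epsilon> powr (1/2) = 1" using assms by (auto simp: e_def simp flip: powr_add)
  define l where "l = ln (1 / \<epsilon>)"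
  have l: "l > 0" using assms by (simp add: l_def)
  have tm: "t_max \<theta> \<epsilon> = 2 / sqrt 3 - \<epsilon> powr (1/2) * (\<theta> * l)"
    using assms by (simp add: t_max_def l_def ln_powr ln_div)
  have "phi_ext t \<ge> \<epsilon> powr (1/2) * (\<theta> * l) - x * \<epsilon> powr (1/2) - 2 * max 0 (- Im t)"
    using phi_ext_lower_lin[OF assms(4,5)] assms(6) unfolding tm by linarith
  then have "e * phi_ext t \<ge> e * (\<epsilon> powr (1/2) * (\<theta> * l) - x * \<epsilon> powr (1/2) - 2 * max 0 (- Im t))"
    using e by (intro mult_left_mono) auto
  also have "e * (\<epsilon> powr (1/2) * (\<theta> * l) - x * \<epsilon> powr (1/2) - 2 * max 0 (- Im t)) =
      (e * \<epsilon> powr (1/2)) * (\<theta> * l) - (e * \<epsilon> powr (1/2)) * x - 2 * (e * max 0 (- Im t))"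
    by (simp add: algebra_simps)
  finally have "e * phi_ext t \<ge> \<theta> * l - x - 2 * (e * max 0 (- Im t))" unfolding e(2) by simp
  moreover have "1/4 * l \<le> \<theta> * l" using assms l by (intro mult_right_mono) auto
  ultimately have "- (e * phi_ext t) \<le> - (1/4 * l) + (x + 2 * (e * max 0 (- Im t)))" by linarith
  then have "exp (- (e * phi_ext t)) \<le> exp (- (1/4 * l) + (x + 2 * (e * max 0 (- Im t))))" by simp
  also have "\<dots> = exp (- (1/4 * l)) * exp (x + 2 * (e * max 0 (- Im t)))" by (rule exp_add)
  also have "exp (- (1/4 * l)) = \<epsilon> powr (1/4)" using assms by (simp add: powr_def l_def ln_div)
  finally show ?thesis by (simp add: e_def)
qed

lemma has_field_derivative_lipschitz_cball:
  fixes f :: "complex \<Rightarrow> complex"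
  assumes "\<And>z. cmod (z - a) \<le> r \<Longrightarrow> \<exists>D. (f has_field_derivative D) (at z) \<and> cmod D \<le> B"
    and "cmod (z1 - a) \<le> r" "cmod (z2 - a) \<le> r"
  shows "cmod (f z1 - f z2) \<le> B * cmod (z1 - z2)"
proof -
  obtain D where D: "\<And>z. cmod (z - a) \<le> r \<Longrightarrow> (f has_field_derivative D z) (at z) \<and> cmod (D z) \<le> B"
    using assms(1) by metis
  show ?thesis
    by (rule field_differentiable_bound[of "cball a r" f D])
       (use D assms in \<open>auto simp: dist_norm norm_minus_commute has_field_derivative_at_within\<close>)
qed

context airy
begin

definition right_arg :: "real \<Rightarrow> complex \<Rightarrow> complex" where
  "right_arg \<epsilon> z = of_real (\<epsilon> powr (-1/3)) * (2 * cis (pi/6)) - z"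

definition pert :: "real \<Rightarrow> complex \<Rightarrow> complex" where
  "pert \<epsilon> z = al^2 * (v (right_arg \<epsilon> z) / v (- al * right_arg \<epsilon> z))"

lemma right_arg_scale: "right_arg \<epsilon> (of_real (\<epsilon> powr (-1/3)) * t) = of_real (\<epsilon> powr (-1/3)) * right_dist t"
  by (simp add: right_arg_def right_dist_def algebra_simps)

lemma eigenvalue_iff_z:
  assumes "\<epsilon> > 0"
  shows "eigenvalue \<epsilon> (cis (- (pi/6)) * t - 1) \<longleftrightarrow>
    v (- (of_real (\<epsilon> powr (-1/3)) * t)) * v (- al * right_arg \<epsilon> (of_real (\<epsilon> powr (-1/3)) * t)) =
    v (right_arg \<epsilon> (of_real (\<epsilon> powr (-1/3)) * t)) * v (al * (of_real (\<epsilon> powr (-1/3)) * t))"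
proof -
  have c: "cis (pi/6) * cis (- (pi/6)) = 1" by (simp add: cis_mult)
  have "\<xi>1 \<epsilon> (cis (- (pi/6)) * t - 1) x = of_real (\<epsilon> powr (-1/3)) * (cis (pi/6) * (of_real x + 1) - (cis (pi/6) * cis (- (pi/6))) * t)" for x
    by (simp only: \<xi>1_def ring_distribs mult.assoc) simp
  then have 0: "\<xi>1 \<epsilon> (cis (- (pi/6)) * t - 1) x = of_real (\<epsilon> powr (-1/3)) * (cis (pi/6) * (of_real x + 1) - t)" for x
    unfolding c by simp
  have 1: "\<xi>1 \<epsilon> (cis (- (pi/6)) * t - 1) (-1) = - (of_real (\<epsilon> powr (-1/3)) * t)"
    unfolding 0 by simp
  have 2: "\<xi>1 \<epsilon> (cis (- (pi/6)) * t - 1) 1 = right_arg \<epsilon> (of_real (\<epsilon> powr (-1/3)) * t)"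
    unfolding 0 right_arg_def by (simp add: algebra_simps)
  show ?thesis unfolding eigenvalue_iff[OF assms] 1 2 by simp
qed

text \<open>Division by \<open>v (al * z)\<close> and \<open>connection\<close> give al + be exp
  \<Psi> = h. Multiplying by al and using al^2 = - be isolates exp \<Psi>; the factor
  \<open>al^2\<close> in \<open>pert\<close> arises here.\<close>

lemma characteristic_sector:
  assumes "z \<in> cone" "v (- al * b) \<noteq> 0"
  shows "v (- z) * v (- al * b) = v b * v (al * z) \<longleftrightarrow> exp (Psi z) = be * (1 + al^2 * (v b / v (- al * b)))"
proof -
  define H where "H = v b / v (- al * b)"
  note nz = v_al_be_cone_nz[OF assms(1)]
  have "v (- z) * v (- al * b) = v b * v (al * z) \<longleftrightarrow> v (- z) / v (al * z) = H"
    using assms(2) nz by (simp add: H_def field_simps)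
  also have "v (- z) / v (al * z) = al + be * exp (Psi z)"
    unfolding connection exp_Psi[OF assms(1)] using nz by (simp add: add_divide_distrib)
  also have "al + be * exp (Psi z) = H \<longleftrightarrow> al * (al + be * exp (Psi z)) = al * H" by simp
  also have "al * (al + be * exp (Psi z)) = al * al + (al * be) * exp (Psi z)" by (simp add: distrib_left mult.assoc)
  also have "\<dots> = exp (Psi z) - be" unfolding al_be by simp
  also have "exp (Psi z) - be = al * H \<longleftrightarrow> exp (Psi z) = be + (be * al) * al * H"
    unfolding al_be(2) by (auto simp: algebra_simps)
  also have "be + (be * al) * al * H = be * (1 + al^2 * H)"
    by (simp add: algebra_simps power2_eq_square)
  finally show ?thesis by (simp add: H_def)
qed

text \<open>\<open>v_ratio_bound\<close> in the variable t; the 3/2 power turns the scale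
  \<open>\<epsilon> powr (-1/3)\<close> into \<open>\<epsilon> powr (-1/2)\<close>. The numerator in
  the quotient rule is the constant Wronskian, so the derivative is controlled by the size of 1 /
  v^2.\<close>

lemma pert_bound:
  obtains R C where "R \<ge> 1" "C > 0"
    "\<And>\<epsilon> t. 0 < \<epsilon> \<Longrightarrow> Re t < sqrt 3 \<Longrightarrow> Im t < 1 \<Longrightarrow> \<epsilon> powr (-1/3) * cmod (right_dist t) \<ge> R \<Longrightarrow>
       v (- al * right_arg \<epsilon> (of_real (\<epsilon> powr (-1/3)) * t)) \<noteq> 0"
    "\<And>\<epsilon> t. 0 < \<epsilon> \<Longrightarrow> Re t < sqrt 3 \<Longrightarrow> Im t < 1 \<Longrightarrow> \<epsilon> powr (-1/3) * cmod (right_dist t) \<ge> R \<Longrightarrow>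
       cmod (pert \<epsilon> (of_real (\<epsilon> powr (-1/3)) * t)) \<le> 3 * exp (- (\<epsilon> powr (-1/2) * phi_ext t))"
    "\<And>\<epsilon> t. 0 < \<epsilon> \<Longrightarrow> Re t < sqrt 3 \<Longrightarrow> Im t < 1 \<Longrightarrow> \<epsilon> powr (-1/3) * cmod (right_dist t) \<ge> R \<Longrightarrow>
       \<exists>D. (pert \<epsilon> has_field_derivative D) (at (of_real (\<epsilon> powr (-1/3)) * t)) \<and>
         cmod D \<le> C * (\<epsilon> powr (-1/3) * cmod (right_dist t)) powr (1/2) * exp (- (\<epsilon> powr (-1/2) * phi_ext t))"
proof -
  obtain R C where RC: "R \<ge> 1" "C > 0"
    "\<And>b. Re b > 0 \<Longrightarrow> Im b > 0 \<Longrightarrow> cmod b \<ge> R \<Longrightarrow> v (- al * b) \<noteq> 0"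
    "\<And>b. Re b > 0 \<Longrightarrow> Im b > 0 \<Longrightarrow> cmod b \<ge> R \<Longrightarrow>
       cmod (v b / v (- al * b)) \<le> 3 * exp (- (4/3) * Re (b powr (3/2)))"
    "\<And>b. Re b > 0 \<Longrightarrow> Im b > 0 \<Longrightarrow> cmod b \<ge> R \<Longrightarrow>
       cmod ((1 + al) * (v 0 * vd 0) / (v (- al * b))\<^sup>2) \<le> C * cmod b powr (1/2) * exp (- (4/3) * Re (b powr (3/2)))"
    by (rule v_ratio_bound) (rule that, assumption+)
  have nal: "cmod (al^2) = 1" by (simp add: norm_power)
  show ?thesis
  proof (rule that[OF RC(1,2)])
    fix \<epsilon> :: real and t assume a: "0 < \<epsilon>" "Re t < sqrt 3" "Im t < 1" "\<epsilon> powr (-1/3) * cmod (right_dist t) \<ge> R"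
    define p where "p = \<epsilon> powr (-1/3)"
    define z where "z = of_real p * t"
    define b where "b = right_arg \<epsilon> z"
    have p: "p > 0" using a by (simp add: p_def)
    have b: "b = of_real p * right_dist t" unfolding b_def z_def p_def by (rule right_arg_scale)
    have q0: "right_dist t \<noteq> 0" using a(2) by (auto simp: complex_eq_iff)
    have br: "Re b > 0" "Im b > 0" "cmod b \<ge> R" "cmod b = p * cmod (right_dist t)"
      unfolding b using a p by (auto simp: norm_mult p_def)
    have "p powr (3/2) = \<epsilon> powr (-1/2)" by (simp add: p_def powr_powr)
    then have e: "- (4/3) * Re (b powr (3/2)) = - (\<epsilon> powr (-1/2) * phi_ext t)"
      unfolding b powr_scale[OF p q0] by (simp add: phi_ext_def)
    show "v (- al * right_arg \<epsilon> (of_real (\<epsilon> powr (-1/3)) * t)) \<noteq> 0"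
      using RC(3)[OF br(1-3)] by (simp add: b_def z_def p_def)
    show "cmod (pert \<epsilon> (of_real (\<epsilon> powr (-1/3)) * t)) \<le> 3 * exp (- (\<epsilon> powr (-1/2) * phi_ext t))"
      using RC(4)[OF br(1-3)] unfolding e
      unfolding pert_def norm_mult nal p_def[symmetric] z_def[symmetric] b_def[symmetric] by simp
    have vb: "v (- al * right_arg \<epsilon> z) \<noteq> 0" using RC(3)[OF br(1-3)] by (simp add: b_def)
    define D where "D = - (al^2 * ((1 + al) * (v 0 * vd 0) / (v (- al * b))\<^sup>2))"
    have dbb: "(right_arg \<epsilon> has_field_derivative -1) (at z)"
      unfolding right_arg_def by (auto intro!: derivative_eq_intros)
    have "((\<lambda>z. al^2 * (v (right_arg \<epsilon> z) / v (- al * right_arg \<epsilon> z))) has_field_derivative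
       al^2 * ((vd b * -1 * v (- al * b) - v b * (vd (- al * b) * (- al * -1))) / (v (- al * b) * v (- al * b)))) (at z)"
      unfolding b_def
      by (rule derivative_eq_intros dbb vb refl | (use vb in simp; fail))+
    also have "al^2 * ((vd b * -1 * v (- al * b) - v b * (vd (- al * b) * (- al * -1))) / (v (- al * b) * v (- al * b))) = D"
    proof -
      have num: "x * -1 * y - w * (u * (- a * -1)) = - (x * y + a * w * u)" for x y w u a :: complex
        by (simp add: algebra_simps)
      have "al^2 * (- W / (y * y)) = - (al^2 * (W / y\<^sup>2))" for W y :: complex
        by (simp only: power2_eq_square[of y] minus_divide_left[symmetric] mult_minus_right)
      then show ?thesis unfolding D_def num wronskian_al .
    qed
    finally have "(pert \<epsilon> has_field_derivative D) (at z)" unfolding pert_def[abs_def] .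
    moreover have "cmod D \<le> C * (p * cmod (right_dist t)) powr (1/2) * exp (- (\<epsilon> powr (-1/2) * phi_ext t))"
      using RC(5)[OF br(1-3)] unfolding e br(4)
      unfolding D_def norm_minus_cancel norm_mult[of "al^2"] nal by simp
    ultimately show "\<exists>D. (pert \<epsilon> has_field_derivative D) (at (of_real (\<epsilon> powr (-1/3)) * t)) \<and>
         cmod D \<le> C * (\<epsilon> powr (-1/3) * cmod (right_dist t)) powr (1/2) * exp (- (\<epsilon> powr (-1/2) * phi_ext t))"
      unfolding z_def p_def by blast
  qed
qed

lemma exp_Psi_airy_zero: "k \<ge> 1 \<Longrightarrow> exp (Psi (of_real (airy_zero k))) = be"
proof -
  assume k: "k \<ge> 1"
  have "Psi (of_real (airy_zero k)) = \<i> * of_real (- (pi/3)) + of_int (2 * int k) * of_real pi * \<i>"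
    using Psi_of_real[OF airy_zero(1)[OF k]] airy_zero(2)[OF k] by (simp add: algebra_simps)
  then have "exp (Psi (of_real (airy_zero k))) = exp (\<i> * of_real (- (pi/3)))"
    unfolding exp_eq by (intro exI[of _ "int k"]) simp
  then show ?thesis by (simp add: cis_conv_exp)
qed

text \<open>Two logarithms differ by 2 pi i n. As Im \<open>Psi\<close> >= 0 and |Ln (1 + h)| < 1 <
  pi/3, the integer n is positive and so numbers a zero.\<close>

lemma characteristic_log:
  assumes "z \<in> cone" "Im (Psi z) \<ge> 0" "cmod h < 1/2" "exp (Psi z) = be * (1 + h)"
  obtains k where "k \<ge> 1" "Psi z = Psi (of_real (airy_zero k)) + Ln (1 + h)"
proof -
  have h1: "1 + h \<noteq> 0" using assms(3) by (metis add.inverse_unique norm_minus_cancel norm_one not_less_iff_gr_or_eq one_less_numeral_iff add_eq_0_iff divide_less_eq_1_pos zero_less_numeral less_trans semiring_norm(76))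
  have ln: "cmod (Ln (1 + h)) < 1" using norm_Ln_le[OF assms(3)] assms(3) by linarith
  have "exp (Psi z) = exp (\<i> * of_real (- (pi/3)) + Ln (1 + h))"
  proof -
    have "exp (\<i> * of_real (- (pi/3))) = be" by (simp add: cis_conv_exp)
    then show ?thesis using h1 unfolding assms(4) exp_add by simp
  qed
  then obtain n :: int where n: "Psi z = \<i> * of_real (- (pi/3)) + Ln (1 + h) + (of_int (2 * n) * pi) * \<i>"
    unfolding exp_eq by auto
  have "Im (Psi z) = - (pi/3) + Im (Ln (1 + h)) + 2 * of_int n * pi" unfolding n by simp
  then have "2 * of_int n * pi > 0"
    using assms(2) ln abs_Im_le_cmod[of "Ln (1 + h)"] pi_gt3 by linarith
  then have "n > 0" by (simp add: zero_less_mult_iff)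
  then have k: "nat n \<ge> 1" "real (nat n) = of_int n" by auto
  have "Psi (of_real (airy_zero (nat n))) = \<i> * of_real (- (pi/3)) + (of_int (2 * n) * pi) * \<i>"
    using Psi_of_real[OF airy_zero(1)[OF k(1)]] airy_zero(2)[OF k(1)] k(2) by (simp add: algebra_simps)
  then show ?thesis using that[OF k(1)] n by simp
qed

text \<open>The phase grows by 2 pi between consecutive zeros and its slope at s is about 2 sqrt s,
  so for s of order \<open>\<epsilon> powr (-1/3)\<close> the spacing has order
  \<open>\<epsilon> powr (1/6)\<close>. A gap of order \<open>\<epsilon> powr (1/4)\<close> would
  change \<open>s powr (3/2)\<close> only by O(\<open>\<epsilon> powr (1/12)\<close>), too little
  for a phase of 2 pi.\<close>

lemma airy_zero_gap:
  "\<forall>\<^sub>F \<epsilon> in at_right 0. \<forall>k\<ge>1. \<epsilon> powr (-1/3) \<le> airy_zero k \<longrightarrow> airy_zero (Suc k) \<le> 2 * \<epsilon> powr (-1/3) \<longrightarrow>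
      K * \<epsilon> powr (1/4) < airy_zero (Suc k) - airy_zero k"
proof -
  obtain B where B: "B > 0" "\<And>s. s \<ge> 0 \<Longrightarrow> \<bar>phase s - (4/3 * s powr (3/2) + pi/6)\<bar> \<le> B / (1 + s powr (3/2))"
    using phase_asymp by blast
  have "\<forall>\<^sub>F \<epsilon> in at_right 0. \<epsilon> powr (- (1/3)) > max 1 (2 * B)"
    by (rule eventually_powr_large) auto
  moreover have "\<forall>\<^sub>F \<epsilon> in at_right 0. (8 * \<bar>K\<bar>) * \<epsilon> powr (1/12) < 1"
    by (rule eventually_powr_small) auto
  ultimately show ?thesis using eventually_at_right_less[of 0]
  proof eventually_elim
    case (elim \<epsilon>)
    define p where "p = \<epsilon> powr (-1/3)"
    have p: "p > 1" "p > 2 * B" using elim(1) by (auto simp: p_def)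
    show ?case
    proof (intro allI impI)
      fix k assume k: "k \<ge> 1" "\<epsilon> powr (-1/3) \<le> airy_zero k" "airy_zero (Suc k) \<le> 2 * \<epsilon> powr (-1/3)"
      define x where "x = airy_zero (Suc k)"
      define y where "y = airy_zero k"
      have xy: "p \<le> y" "y < x" "x \<le> 2 * p" using k airy_zero_less[of k "Suc k"] by (auto simp: p_def x_def y_def)
      have thx: "phase x - phase y = 2 * pi" using airy_zero(2)[of k] airy_zero(2)[of "Suc k"] k(1) by (simp add: x_def y_def algebra_simps)
      have small: "B / (1 + s powr (3/2)) \<le> 1/2" if "s \<ge> p" for s
      proof -
        have "s powr 1 \<le> s powr (3/2)" using that p by (intro powr_mono) auto
        then have "2 * B \<le> 1 + s powr (3/2)" using that p by simp
        then show ?thesis by (simp add: divide_le_eq add_pos_nonneg)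
      qed
      have e: "phase x - phase y \<le> 4/3 * (x powr (3/2) - y powr (3/2)) + 1"
      proof -
        have 0: "0 \<le> x" "0 \<le> y" "p \<le> x" using xy p by linarith+
        have "phase x - (4/3 * x powr (3/2) + pi/6) \<le> 1/2" "- (phase y - (4/3 * y powr (3/2) + pi/6)) \<le> 1/2"
          using B(2)[OF 0(1)] B(2)[OF 0(2)] small[OF 0(3)] small[OF xy(1)] unfolding abs_le_iff by linarith+
        then show ?thesis by (simp add: algebra_simps)
      qed
      show "K * \<epsilon> powr (1/4) < airy_zero (Suc k) - airy_zero k"
      proof (rule ccontr)
        assume "\<not> ?thesis"
        then have d: "x - y \<le> \<bar>K\<bar> * \<epsilon> powr (1/4)" 
          using mult_right_mono[OF abs_ge_self[of K], of "\<epsilon> powr (1/4)"] by (simp add: x_def y_def)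
        define a where "a = sqrt x"
        define b where "b = sqrt y"
        have ab: "0 \<le> b" "b \<le> a" "a^2 = x" "b^2 = y" using xy p by (auto simp: a_def b_def)
        have pw: "s powr (3/2) = (sqrt s)^3" if "s > 0" for s :: real
          using that by (simp add: powr_half_sqrt[symmetric] powr_powr flip: powr_realpow)
        have "x powr (3/2) - y powr (3/2) = a^3 - b^3" using xy p by (simp add: pw a_def b_def)
        also have "\<dots> = (a - b) * (a^2 + a * b + b^2)" by (simp add: algebra_simps power2_eq_square power3_eq_cube)
        also have "\<dots> \<le> (a - b) * (2 * a * (a + b))"
        proof (rule mult_left_mono)
          have "b^2 \<le> a^2" using ab by (intro power_mono) auto
          moreover have "0 \<le> a * b" using ab by simp
          ultimately show "a^2 + a * b + b^2 \<le> 2 * a * (a + b)" by (simp add: algebra_simps power2_eq_square)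
        qed (use ab in auto)
        also have "\<dots> = 2 * a * (x - y)" unfolding ab(3,4)[symmetric] by (simp add: algebra_simps power2_eq_square)
        also have "\<dots> \<le> 2 * (2 * \<epsilon> powr (-1/6)) * (\<bar>K\<bar> * \<epsilon> powr (1/4))"
        proof (rule mult_mono)
          show "x - y \<le> \<bar>K\<bar> * \<epsilon> powr (1/4)" by (rule d)
          have "a \<le> sqrt (4 * p)" unfolding a_def using xy p by (intro real_sqrt_le_mono) auto
          also have "\<dots> = 2 * sqrt p" by (simp add: real_sqrt_mult)
          also have "sqrt p = \<epsilon> powr (-1/6)" using p by (simp add: powr_half_sqrt[symmetric] p_def powr_powr)
          finally show "2 * a \<le> 2 * (2 * \<epsilon> powr (-1/6))" by simp
        qed (use xy in auto)
        also have "\<dots> = 4 * \<bar>K\<bar> * (\<epsilon> powr (-1/6) * \<epsilon> powr (1/4))" by simp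
        also have "\<epsilon> powr (-1/6) * \<epsilon> powr (1/4) = \<epsilon> powr (1/12)" by (simp flip: powr_add)
        finally have "x powr (3/2) - y powr (3/2) \<le> 1/2" using elim(2) by linarith
        then have "4/3 * (x powr (3/2) - y powr (3/2)) \<le> 4/3 * (1/2)" by (rule mult_left_mono) simp
        then have "phase x - phase y \<le> 4/3 * (1/2) + 1" using e by (meson add_right_mono order_trans)
        then show False using thx pi_gt3 by simp
      qed
    qed
  qed
qed

end

subsection \<open>Eigenvalues near the segment\<close>

text \<open>Collects the constants supplied by \<open>recip_prod_sector\<close> and
  \<open>pert_bound\<close>, so that the estimates below share one choice of them for all
  \<epsilon>.\<close>

locale airy_pert = airy +
  fixes \<delta> c R0 C0 \<theta> :: real
  assumes \<delta>: "0 < \<delta>" "\<delta> \<le> 1/100"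
    and c: "c > 0"
    and sec_lower: "\<And>z. \<bar>Im z\<bar> \<le> \<delta> * Re z \<Longrightarrow> c \<le> Re (recip_prod z)"
    and sec_arg: "\<And>z. \<bar>Im z\<bar> \<le> \<delta> * Re z \<Longrightarrow> \<bar>Im (recip_prod z)\<bar> \<le> Re (recip_prod z)"
    and R0: "R0 \<ge> 1" and C0: "C0 > 0"
    and v_right_arg_nz: "\<And>\<epsilon> t. 0 < \<epsilon> \<Longrightarrow> Re t < sqrt 3 \<Longrightarrow> Im t < 1 \<Longrightarrow> \<epsilon> powr (-1/3) * cmod (right_dist t) \<ge> R0 \<Longrightarrow>
       v (- al * right_arg \<epsilon> (of_real (\<epsilon> powr (-1/3)) * t)) \<noteq> 0"
    and pert_le: "\<And>\<epsilon> t. 0 < \<epsilon> \<Longrightarrow> Re t < sqrt 3 \<Longrightarrow> Im t < 1 \<Longrightarrow> \<epsilon> powr (-1/3) * cmod (right_dist t) \<ge> R0 \<Longrightarrow>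
       cmod (pert \<epsilon> (of_real (\<epsilon> powr (-1/3)) * t)) \<le> 3 * exp (- (\<epsilon> powr (-1/2) * phi_ext t))"
    and pert_deriv: "\<And>\<epsilon> t. 0 < \<epsilon> \<Longrightarrow> Re t < sqrt 3 \<Longrightarrow> Im t < 1 \<Longrightarrow> \<epsilon> powr (-1/3) * cmod (right_dist t) \<ge> R0 \<Longrightarrow>
       \<exists>D. (pert \<epsilon> has_field_derivative D) (at (of_real (\<epsilon> powr (-1/3)) * t)) \<and>
         cmod D \<le> C0 * (\<epsilon> powr (-1/3) * cmod (right_dist t)) powr (1/2) * exp (- (\<epsilon> powr (-1/2) * phi_ext t))"
    and \<theta>: "\<theta> \<ge> 1/4"
begin

definition decay :: "real \<Rightarrow> nat \<Rightarrow> real" where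
  "decay \<epsilon> k = exp (- (\<epsilon> powr (-1/2) * \<phi> (\<epsilon> powr (1/3) * airy_zero k)))"

text \<open>The margin is \<open>\<epsilon> powr (1/3)\<close> times the disc radius
  \<open>K * \<epsilon> powr (1/4)\<close>. It admits a zero just above \<open>t_max\<close> whose
  eigenvalue may have a coordinate below it.\<close>

definition admissible :: "real \<Rightarrow> real \<Rightarrow> nat \<Rightarrow> bool" where
  "admissible K \<epsilon> k \<longleftrightarrow> k \<ge> 1 \<and> \<epsilon> powr (1/3) * airy_zero k \<le> t_max \<theta> \<epsilon> + K * \<epsilon> powr (7/12)"

text \<open>The logarithm of the characteristic equation on the branch of the k-th zero; the index
  of an eigenvalue is part of this equation.\<close>

definition is_sol :: "real \<Rightarrow> nat \<Rightarrow> complex \<Rightarrow> bool" where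
  "is_sol \<epsilon> k z \<longleftrightarrow> Psi z = Psi (of_real (airy_zero k)) + Ln (1 + pert \<epsilon> z)"

lemma kc_pos: "kappa * c > 0" using kappa_pos c by simp

text \<open>In t the disc has radius \<open>K * \<epsilon> powr (7/12)\<close>, small against
  \<open>\<epsilon> powr (1/2)\<close>, so \<open>pert\<close> changes over it by a bounded factor.
  Its derivative gains a factor of order \<open>\<epsilon> powr (-1/6)\<close>, which the bound
  \<open>\<epsilon> powr (1/4)\<close> outweighs.\<close>

lemma near_zero:
  assumes K: "K \<ge> 0"
  shows "\<forall>\<^sub>F \<epsilon> in at_right 0. \<forall>k. admissible K \<epsilon> k \<longrightarrow> (\<forall>z. cmod (z - of_real (airy_zero k)) \<le> K * \<epsilon> powr (1/4) \<longrightarrow>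
     \<bar>Im z\<bar> < \<delta> * Re z \<and> v (- al * right_arg \<epsilon> z) \<noteq> 0 \<and> cmod (pert \<epsilon> z) \<le> 9 * decay \<epsilon> k \<and> decay \<epsilon> k \<le> 3 * \<epsilon> powr (1/4) \<and>
     (\<exists>D. (pert \<epsilon> has_field_derivative D) (at z) \<and> cmod D \<le> 18 * C0 * \<epsilon> powr (1/12)))"
proof -
  have s1: "airy_zero 1 > 0" by (rule airy_zero_pos) simp
  have "\<forall>\<^sub>F \<epsilon> in at_right 0. K * \<epsilon> powr (1/4) < \<delta> * airy_zero 1 / 4"
    using s1 \<delta> by (intro eventually_powr_small) auto
  moreover have "\<forall>\<^sub>F \<epsilon> in at_right 0. \<epsilon> powr (- (1/3)) > 2 * R0"
    by (rule eventually_powr_large) simp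
  moreover have "\<forall>\<^sub>F \<epsilon> in at_right 0. (8 * K) * \<epsilon> powr (1/12) < 1"
    by (rule eventually_powr_small) auto
  moreover have "\<forall>\<^sub>F \<epsilon> in at_right 0. \<epsilon> < exp (- 4 :: real)"
    by (rule eventually_at_rightI[of 0 "exp (-4)"]) auto
  ultimately show ?thesis using eventually_at_right_less[of 0]
  proof eventually_elim
    case (elim \<epsilon>)
    define p where "p = \<epsilon> powr (-1/3)"
    define u where "u = \<epsilon> powr (1/3)"
    define h where "h = \<epsilon> powr (1/2)"
    define e where "e = \<epsilon> powr (-1/2)"
    have pos: "p > 0" "u > 0" "h > 0" "e > 0" using elim by (auto simp: p_def u_def h_def e_def)
    have pu: "p * u = 1" and eh: "e * h = 1" using elim by (auto simp: p_def u_def e_def h_def simp flip: powr_add)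
    have e1: "\<epsilon> < 1" using elim(4) by (smt (verit) exp_less_one_iff)
    have h1: "h \<le> 1" unfolding h_def using elim e1 by (intro powr_le1) auto
    have p2: "p > 2 * R0" using elim(2) by (simp add: p_def)
    define \<kappa> where "\<kappa> = K * \<epsilon> powr (1/12)"
    have \<kappa>: "0 \<le> \<kappa>" "\<kappa> \<le> 1/8" using elim(3) K by (auto simp: \<kappa>_def)
    have K712: "K * \<epsilon> powr (7/12) = \<kappa> * h" by (simp add: \<kappa>_def h_def flip: powr_add)
    have uK: "u * (K * \<epsilon> powr (1/4)) = \<kappa> * h" unfolding K712[symmetric] by (simp add: u_def flip: powr_add)
    \<comment> \<open>For \<epsilon> < exp (-4) the product of \<theta> and ln (1/\<epsilon>) is at
      least 1, so \<open>t_max\<close> stays below 2 / sqrt 3 by at least \<open>h\<close>, more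
      than the margins used below.\<close>
    have "ln \<epsilon> < ln (exp (-4))" using elim by (subst ln_less_cancel_iff) auto
    then have "1/4 * 4 \<le> \<theta> * ln (1 / \<epsilon>)" using \<theta> elim by (intro mult_mono) (auto simp: ln_div)
    moreover have "t_max \<theta> \<epsilon> = 2 / sqrt 3 - h * (\<theta> * ln (1 / \<epsilon>))"
      using elim by (simp add: t_max_def h_def ln_powr ln_div)
    ultimately have tm: "t_max \<theta> \<epsilon> \<le> 2 / sqrt 3 - h"
      using mult_left_mono[of 1 "\<theta> * ln (1 / \<epsilon>)" h] pos by simp
    have \<kappa>h: "0 \<le> \<kappa> * h" "\<kappa> * h \<le> 1/8 * h" using \<kappa> pos by (auto intro: mult_right_mono)
    show ?case
    proof (intro allI impI)
      fix k z assume adm: "admissible K \<epsilon> k" and z: "cmod (z - of_real (airy_zero k)) \<le> K * \<epsilon> powr (1/4)"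
      have k: "k \<ge> 1" using adm by (simp add: admissible_def)
      define s where "s = airy_zero k"
      have s: "airy_zero 1 \<le> s" using airy_zero_less[of 1 k] k by (cases "k = 1") (auto simp: s_def)
      define t where "t = of_real u * z"
      define \<tau> where "\<tau> = u * s"
      have zt: "z = of_real p * t" unfolding t_def mult.assoc[symmetric] of_real_mult[symmetric] pu by simp
      have dz: "\<bar>Im z\<bar> \<le> K * \<epsilon> powr (1/4)" "\<bar>Re z - s\<bar> \<le> K * \<epsilon> powr (1/4)"
        using z abs_Im_le_cmod[of "z - of_real (airy_zero k)"] abs_Re_le_cmod[of "z - of_real (airy_zero k)"] by (auto simp: s_def)
      have "\<delta> * airy_zero 1 \<le> 1/100 * airy_zero 1" using \<delta> s1 by (intro mult_right_mono) auto
      then have Rez: "Re z \<ge> airy_zero 1 / 2" using dz(2) elim(1) s s1 by linarith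
      have "\<delta> * (airy_zero 1 / 2) \<le> \<delta> * Re z" using Rez \<delta> by (intro mult_left_mono) auto
      moreover have "0 < \<delta> * airy_zero 1" using \<delta> s1 by simp
      ultimately have sect: "\<bar>Im z\<bar> < \<delta> * Re z" using dz(1) elim(1) by simp
      have "cmod (t - of_real \<tau>) = u * cmod (z - of_real s)"
      proof -
        have "t - of_real \<tau> = of_real u * (z - of_real s)" by (simp add: t_def \<tau>_def algebra_simps)
        then show ?thesis using pos by (simp add: norm_mult)
      qed
      also have "\<dots> \<le> u * (K * \<epsilon> powr (1/4))" using z pos by (intro mult_left_mono) (auto simp: s_def)
      finally have dt: "cmod (t - of_real \<tau>) \<le> \<kappa> * h" unfolding uK .
      have dt': "\<bar>Re t - \<tau>\<bar> \<le> \<kappa> * h" "\<bar>Im t\<bar> \<le> \<kappa> * h"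
        using dt abs_Re_le_cmod[of "t - of_real \<tau>"] abs_Im_le_cmod[of "t - of_real \<tau>"] by auto
      have \<tau>le: "\<tau> \<le> t_max \<theta> \<epsilon> + \<kappa> * h" using adm by (simp add: admissible_def K712 \<tau>_def u_def s_def)
      have \<tau>0: "\<tau> > 0" using pos s s1 by (simp add: \<tau>_def)
      have Ret: "Re t > 0" using pos Rez s1 by (simp add: t_def)
      have up: "\<tau> \<le> 2 / sqrt 3" "Re t \<le> 2 / sqrt 3" using \<tau>le dt' tm \<kappa>h pos by linarith+
      have Imt: "\<bar>Im t\<bar> \<le> 1/2" using dt'(2) \<kappa>h h1 by linarith
      have rng: "Re t < sqrt 3" "Im t < 1" using up Imt sqrt3_bounds by linarith+
      have q1: "cmod (right_dist t) \<ge> 1/2" using abs_Im_le_cmod[of "right_dist t"] Imt by simp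
      have "p * (1/2) \<le> p * cmod (right_dist t)" using q1 pos by (intro mult_left_mono) auto
      then have big: "\<epsilon> powr (-1/3) * cmod (right_dist t) \<ge> R0" using p2 by (simp add: p_def)
      have q4: "cmod (right_dist t) \<le> 4" using cmod_le[of "right_dist t"] Imt Ret up sqrt3_bounds by simp
      have EEeq: "decay \<epsilon> k = exp (- (e * phi_ext (of_real \<tau>)))"
        by (simp add: decay_def e_def \<phi>_eq_phi_ext \<tau>_def u_def s_def)
      have EEle: "decay \<epsilon> k \<le> 3 * \<epsilon> powr (1/4)"
      proof -
        have "decay \<epsilon> k \<le> \<epsilon> powr (1/4) * exp (\<kappa> + 2 * (\<epsilon> powr (-1/2) * max 0 (- Im (of_real \<tau>))))"
          unfolding EEeq e_def
          by (rule phi_ext_exp_bound[OF elim(5) e1 \<theta>]) (use up(1) \<tau>le in \<open>auto simp: h_def\<close>)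
        also have "\<dots> = \<epsilon> powr (1/4) * exp \<kappa>" by simp
        also have "\<dots> \<le> \<epsilon> powr (1/4) * 3"
        proof (rule mult_left_mono)
          have "exp \<kappa> \<le> exp 1" using \<kappa> by simp
          then show "exp \<kappa> \<le> 3" using exp_le by linarith
        qed simp
        finally show ?thesis by simp
      qed
      \<comment> \<open>The Lipschitz constant 4 times \<kappa> <= 1/8 limits the change of the
        exponent over the disc to 1/2.\<close>
      have "\<bar>phi_ext t - phi_ext (of_real \<tau>)\<bar> \<le> 4 * cmod (t - of_real \<tau>)"
        by (rule phi_ext_lipschitz) (use up Ret \<tau>0 Imt sqrt3_bounds in auto)
      then have "phi_ext (of_real \<tau>) - phi_ext t \<le> 1/2 * h" using dt \<kappa>h by linarith
      then have "e * (phi_ext (of_real \<tau>) - phi_ext t) \<le> e * (1/2 * h)" using pos by (intro mult_left_mono) auto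
      also have "e * (1/2 * h) = 1/2" using eh by simp
      finally have "- (e * phi_ext t) \<le> - (e * phi_ext (of_real \<tau>)) + 1" by (simp add: right_diff_distrib)
      then have "exp (- (e * phi_ext t)) \<le> exp (- (e * phi_ext (of_real \<tau>)) + 1)" by simp
      also have "\<dots> = decay \<epsilon> k * exp 1" unfolding EEeq by (rule exp_add)
      also have "\<dots> \<le> decay \<epsilon> k * 3" using exp_le by (intro mult_left_mono) (auto simp: decay_def)
      finally have expt: "exp (- (e * phi_ext t)) \<le> 3 * decay \<epsilon> k" by simp
      have nz: "v (- al * right_arg \<epsilon> z) \<noteq> 0"
        unfolding zt p_def by (rule v_right_arg_nz[OF elim(5) rng big])
      have hle: "cmod (pert \<epsilon> z) \<le> 9 * decay \<epsilon> k"
        using pert_le[OF elim(5) rng big] expt unfolding zt p_def e_def by linarith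
      obtain D where D: "(pert \<epsilon> has_field_derivative D) (at z)" 
        "cmod D \<le> C0 * (p * cmod (right_dist t)) powr (1/2) * exp (- (e * phi_ext t))"
        using pert_deriv[OF elim(5) rng big] unfolding zt p_def e_def by blast
      note D(2)
      also have "C0 * (p * cmod (right_dist t)) powr (1/2) * exp (- (e * phi_ext t)) \<le> C0 * (2 * \<epsilon> powr (-1/6)) * (9 * \<epsilon> powr (1/4))"
      proof (rule mult_mono)
        have "(p * cmod (right_dist t)) powr (1/2) \<le> (p * 4) powr (1/2)"
          using q4 pos by (intro powr_mono2 mult_left_mono) auto
        also have "\<dots> = 2 * p powr (1/2)" using pos by (simp add: powr_mult powr_half_sqrt)
        also have "p powr (1/2) = \<epsilon> powr (-1/6)" by (simp add: p_def powr_powr)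
        finally show "C0 * (p * cmod (right_dist t)) powr (1/2) \<le> C0 * (2 * \<epsilon> powr (-1/6))"
          using C0 by (intro mult_left_mono) auto
        show "exp (- (e * phi_ext t)) \<le> 9 * \<epsilon> powr (1/4)" using expt EEle by linarith
      qed (use C0 in auto)
      also have "\<dots> = 18 * C0 * (\<epsilon> powr (-1/6) * \<epsilon> powr (1/4))" by simp
      also have "\<epsilon> powr (-1/6) * \<epsilon> powr (1/4) = \<epsilon> powr (1/12)" by (simp flip: powr_add)
      finally have "\<exists>D. (pert \<epsilon> has_field_derivative D) (at z) \<and> cmod D \<le> 18 * C0 * \<epsilon> powr (1/12)"
        using D(1) by blast
      then show "\<bar>Im z\<bar> < \<delta> * Re z \<and> v (- al * right_arg \<epsilon> z) \<noteq> 0 \<and> cmod (pert \<epsilon> z) \<le> 9 * decay \<epsilon> k \<and> decay \<epsilon> k \<le> 3 * \<epsilon> powr (1/4) \<and>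
         (\<exists>D. (pert \<epsilon> has_field_derivative D) (at z) \<and> cmod D \<le> 18 * C0 * \<epsilon> powr (1/12))"
        using sect nz hle EEle by blast
    qed
  qed
qed

lemma airy_zero_in_sector: "k \<ge> 1 \<Longrightarrow> \<bar>Im (of_real (airy_zero k))\<bar> \<le> \<delta> * Re (of_real (airy_zero k))"
  using airy_zero(1)[of k] \<delta> by simp

lemma sol_near:
  assumes "k \<ge> 1" "is_sol \<epsilon> k z" "\<bar>Im z\<bar> \<le> \<delta> * Re z" "cmod (pert \<epsilon> z) < 1/2"
  shows "cmod (z - of_real (airy_zero k)) \<le> 2 * cmod (pert \<epsilon> z) / (kappa * c)"
proof -
  have "kappa * c * cmod (z - of_real (airy_zero k)) \<le> cmod (Psi z - Psi (of_real (airy_zero k)))"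
    by (rule Psi_expand[OF \<delta> sec_lower assms(3) airy_zero_in_sector[OF assms(1)]])
  also have "\<dots> = cmod (Ln (1 + pert \<epsilon> z))" using assms(2) by (simp add: is_sol_def)
  also have "\<dots> \<le> 2 * cmod (pert \<epsilon> z)" by (rule norm_Ln_le[OF assms(4)])
  finally show ?thesis using kc_pos by (simp add: pos_le_divide_eq mult.commute)
qed

lemma Ln_pert_deriv:
  assumes "(pert \<epsilon> has_field_derivative D) (at z)" "cmod (pert \<epsilon> z) < 1/2"
  shows "((\<lambda>z. Ln (1 + pert \<epsilon> z)) has_field_derivative D / (1 + pert \<epsilon> z)) (at z)"
    "cmod (D / (1 + pert \<epsilon> z)) \<le> 2 * cmod D"
proof -
  have "Re (1 + pert \<epsilon> z) > 0" using assms(2) abs_Re_le_cmod[of "pert \<epsilon> z"] by simp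
  then have "1 + pert \<epsilon> z \<notin> \<real>\<^sub>\<le>\<^sub>0" by (auto simp: complex_nonpos_Reals_iff)
  then show "((\<lambda>z. Ln (1 + pert \<epsilon> z)) has_field_derivative D / (1 + pert \<epsilon> z)) (at z)"
    using assms(1) by (auto intro!: derivative_eq_intros simp: divide_inverse mult.commute)
  have "cmod (1 + pert \<epsilon> z) \<ge> 1/2" using norm_triangle_ineq4[of "1 + pert \<epsilon> z" "pert \<epsilon> z"] assms(2) by simp
  then have "cmod D / cmod (1 + pert \<epsilon> z) \<le> cmod D / (1/2)" by (intro divide_left_mono) auto
  then show "cmod (D / (1 + pert \<epsilon> z)) \<le> 2 * cmod D" by (simp add: norm_divide)
qed

text \<open>With E = \<open>decay \<epsilon> k\<close>, the equation function has modulus at most 18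
  E at the zero. On the circle of radius 40 E / (kappa c) expansion gives 40 E, of which the
  logarithm takes at most 18 E. A holomorphic function smaller at the centre than on the circle has
  a zero inside. Since E <= 3 \<open>\<epsilon> powr (1/4)\<close>, the value 120 / (kappa c)
  suffices for K.\<close>

lemma sol_exists:
  assumes K: "K \<ge> 120 / (kappa * c)"
  shows "\<forall>\<^sub>F \<epsilon> in at_right 0. \<forall>k. admissible K \<epsilon> k \<longrightarrow>
     (\<exists>z. is_sol \<epsilon> k z \<and> cmod (z - of_real (airy_zero k)) \<le> 40 / (kappa * c) * decay \<epsilon> k \<and>
        cmod (z - of_real (airy_zero k)) \<le> K * \<epsilon> powr (1/4))"
proof -
  have K0: "K \<ge> 0" using K kc_pos by (meson divide_nonneg_pos order_trans zero_le_numeral)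
  have "\<forall>\<^sub>F \<epsilon> in at_right 0. 54 * \<epsilon> powr (1/4) < (1::real)"
    by (rule eventually_powr_small) auto
  with near_zero[OF K0] show ?thesis
  proof eventually_elim
    case (elim \<epsilon>)
    show ?case
    proof (intro allI impI)
      fix k assume adm: "admissible K \<epsilon> k"
      then have k: "k \<ge> 1" by (simp add: admissible_def)
      define s where "s = complex_of_real (airy_zero k)"
      define E where "E = decay \<epsilon> k"
      have N: "\<bar>Im z\<bar> < \<delta> * Re z" "cmod (pert \<epsilon> z) \<le> 9 * E" "E \<le> 3 * \<epsilon> powr (1/4)"
         "\<exists>D. (pert \<epsilon> has_field_derivative D) (at z)" if "cmod (z - s) \<le> K * \<epsilon> powr (1/4)" for z
        using elim(1) adm that unfolding E_def s_def by blast+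
      have E0: "E > 0" by (simp add: E_def decay_def)
      have E: "E \<le> 3 * \<epsilon> powr (1/4)" using N(3)[of s] K0 by simp
      define r where "r = 40 / (kappa * c) * E"
      have r: "r > 0" using E0 kc_pos by (simp add: r_def)
      have "r \<le> 40 / (kappa * c) * (3 * \<epsilon> powr (1/4))" unfolding r_def using kc_pos E by (intro mult_left_mono) auto
      also have "\<dots> = 120 / (kappa * c) * \<epsilon> powr (1/4)" by simp
      also have "\<dots> \<le> K * \<epsilon> powr (1/4)" using K by (intro mult_right_mono) auto
      finally have rK: "r \<le> K * \<epsilon> powr (1/4)" .
      have E9: "9 * E < 1/2" using E elim(2) by linarith
      have h: "cmod (pert \<epsilon> z) < 1/2" "cmod (Ln (1 + pert \<epsilon> z)) \<le> 18 * E" if "cmod (z - s) \<le> r" for z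
      proof -
        have 1: "cmod (pert \<epsilon> z) \<le> 9 * E" using N(2)[of z] that rK by linarith
        then show 2: "cmod (pert \<epsilon> z) < 1/2" using E9 by linarith
        show "cmod (Ln (1 + pert \<epsilon> z)) \<le> 18 * E" using norm_Ln_le[OF 2] 1 by linarith
      qed
      define f where "f z = Psi z - Psi s - Ln (1 + pert \<epsilon> z)" for z
      have df: "\<exists>D. (f has_field_derivative D) (at z)" if z: "cmod (z - s) \<le> r" for z
      proof -
        have z': "cmod (z - s) \<le> K * \<epsilon> powr (1/4)" using z rK by linarith
        obtain D where D: "(pert \<epsilon> has_field_derivative D) (at z)" using N(4)[OF z'] by blast
        have "z \<in> cone" using in_cone[OF _ \<delta>] N(1)[OF z'] by simp
        from DERIV_diff[OF DERIV_diff[OF Psi_deriv'[OF this] DERIV_const] Ln_pert_deriv(1)[OF D h(1)[OF z]], of "Psi s"]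
        show ?thesis unfolding f_def by blast
      qed
      obtain z where zz: "z \<in> ball s r" "f z = 0"
      proof (rule holomorphic_contract_to_zero)
        show "continuous_on (cball s r) f"
        proof (rule continuous_at_imp_continuous_on, rule ballI)
          fix z assume "z \<in> cball s r"
          then show "isCont f z" using df[of z] DERIV_isCont by (auto simp: dist_norm norm_minus_commute)
        qed
        have "\<forall>z\<in>ball s r. \<exists>D. (f has_field_derivative D) (at z)"
          using df by (auto simp: dist_norm norm_minus_commute)
        then show "f holomorphic_on ball s r"
          by (subst holomorphic_on_open) auto
        show "0 < r" by (rule r)
        fix z assume zr: "cmod (s - z) = r"
        then have z: "cmod (z - s) \<le> r" by (simp add: norm_minus_commute)
        have zs: "\<bar>Im z\<bar> \<le> \<delta> * Re z" using N(1)[of z] z rK by auto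
        have "f s = - Ln (1 + pert \<epsilon> s)" by (simp add: f_def)
        then have 1: "cmod (f s) \<le> 18 * E" using h(2)[of s] r by simp
        have "kappa * c * cmod (z - s) \<le> cmod (Psi z - Psi s)"
          unfolding s_def by (rule Psi_expand[OF \<delta> sec_lower zs airy_zero_in_sector[OF k]])
        moreover have "kappa * c * cmod (z - s) = 40 * E"
          unfolding norm_minus_commute[of z] zr r_def using kappa_pos c by simp
        moreover have "cmod (Psi z - Psi s) - cmod (Ln (1 + pert \<epsilon> z)) \<le> cmod (f z)"
          unfolding f_def by (rule norm_triangle_ineq2)
        ultimately have "cmod (f z) \<ge> 22 * E" using h(2)[OF z] by linarith
        then show "cmod (f s) < cmod (f z)" using 1 E0 by linarith
      qed
      have "cmod (z - s) \<le> r" using zz(1) by (auto simp: dist_norm norm_minus_commute)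
      moreover have "is_sol \<epsilon> k z" using zz(2) by (simp add: is_sol_def f_def s_def algebra_simps)
      ultimately have "is_sol \<epsilon> k z \<and> cmod (z - of_real (airy_zero k)) \<le> 40 / (kappa * c) * decay \<epsilon> k \<and>
        cmod (z - of_real (airy_zero k)) \<le> K * \<epsilon> powr (1/4)"
        using rK unfolding r_def E_def s_def by auto
      then show "\<exists>z. is_sol \<epsilon> k z \<and> cmod (z - of_real (airy_zero k)) \<le> 40 / (kappa * c) * decay \<epsilon> k \<and>
        cmod (z - of_real (airy_zero k)) \<le> K * \<epsilon> powr (1/4)" by blast
    qed
  qed
qed

text \<open>\<open>Psi\<close> expands distances by kappa c, while Ln (1 + \<open>pert\<close>) has
  a Lipschitz constant of order \<open>\<epsilon> powr (1/12)\<close>, eventually below kappa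
  c.\<close>

lemma sol_unique:
  assumes K: "K \<ge> 0"
  shows "\<forall>\<^sub>F \<epsilon> in at_right 0. \<forall>k z1 z2. admissible K \<epsilon> k \<longrightarrow> is_sol \<epsilon> k z1 \<longrightarrow> is_sol \<epsilon> k z2 \<longrightarrow>
     cmod (z1 - of_real (airy_zero k)) \<le> K * \<epsilon> powr (1/4) \<longrightarrow> cmod (z2 - of_real (airy_zero k)) \<le> K * \<epsilon> powr (1/4) \<longrightarrow> z1 = z2"
proof -
  have "\<forall>\<^sub>F \<epsilon> in at_right 0. 54 * \<epsilon> powr (1/4) < (1::real)"
    by (rule eventually_powr_small) auto
  moreover have "\<forall>\<^sub>F \<epsilon> in at_right 0. (36 * C0) * \<epsilon> powr (1/12) < kappa * c"
    using kc_pos by (intro eventually_powr_small) auto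
  ultimately show ?thesis using near_zero[OF K]
  proof eventually_elim
    case (elim \<epsilon>)
    show ?case
    proof (intro allI impI)
      fix k z1 z2 assume adm: "admissible K \<epsilon> k" and sol: "is_sol \<epsilon> k z1" "is_sol \<epsilon> k z2"
        and z: "cmod (z1 - of_real (airy_zero k)) \<le> K * \<epsilon> powr (1/4)" "cmod (z2 - of_real (airy_zero k)) \<le> K * \<epsilon> powr (1/4)"
      have N: "\<bar>Im z\<bar> < \<delta> * Re z" "cmod (pert \<epsilon> z) < 1/2" 
         "\<exists>D. (pert \<epsilon> has_field_derivative D) (at z) \<and> cmod D \<le> 18 * C0 * \<epsilon> powr (1/12)" 
         if "cmod (z - of_real (airy_zero k)) \<le> K * \<epsilon> powr (1/4)" for z
      proof -
        have *: "\<bar>Im z\<bar> < \<delta> * Re z" "cmod (pert \<epsilon> z) \<le> 9 * decay \<epsilon> k" "decay \<epsilon> k \<le> 3 * \<epsilon> powr (1/4)"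
         "\<exists>D. (pert \<epsilon> has_field_derivative D) (at z) \<and> cmod D \<le> 18 * C0 * \<epsilon> powr (1/12)"
          using elim(3) adm that by blast+
        show "\<bar>Im z\<bar> < \<delta> * Re z" by (rule *(1))
        show "cmod (pert \<epsilon> z) < 1/2" using *(2,3) elim(1) by linarith
        show "\<exists>D. (pert \<epsilon> has_field_derivative D) (at z) \<and> cmod D \<le> 18 * C0 * \<epsilon> powr (1/12)" by (rule *(4))
      qed
      have "cmod (Ln (1 + pert \<epsilon> z1) - Ln (1 + pert \<epsilon> z2)) \<le> (36 * C0) * \<epsilon> powr (1/12) * cmod (z1 - z2)"
      proof (rule has_field_derivative_lipschitz_cball[OF _ z])
        fix z assume zz: "cmod (z - of_real (airy_zero k)) \<le> K * \<epsilon> powr (1/4)"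
        obtain D where D: "(pert \<epsilon> has_field_derivative D) (at z)" "cmod D \<le> 18 * C0 * \<epsilon> powr (1/12)"
          using N(3)[OF zz] by blast
        show "\<exists>D. ((\<lambda>a. Ln (1 + pert \<epsilon> a)) has_field_derivative D) (at z) \<and> cmod D \<le> 36 * C0 * \<epsilon> powr (1/12)"
          using Ln_pert_deriv[OF D(1) N(2)[OF zz]] D(2) by (intro exI[of _ "D / (1 + pert \<epsilon> z)"]) auto
      qed
      moreover have "kappa * c * cmod (z1 - z2) \<le> cmod (Psi z1 - Psi z2)"
        by (rule Psi_expand[OF \<delta> sec_lower]) (use N(1)[OF z(1)] N(1)[OF z(2)] in auto)
      moreover have "Psi z1 - Psi z2 = Ln (1 + pert \<epsilon> z1) - Ln (1 + pert \<epsilon> z2)"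
        using sol by (simp add: is_sol_def)
      ultimately have le: "kappa * c * cmod (z1 - z2) \<le> (36 * C0) * \<epsilon> powr (1/12) * cmod (z1 - z2)" by simp
      show "z1 = z2"
      proof (rule ccontr)
        assume "z1 \<noteq> z2"
        then have "(36 * C0) * \<epsilon> powr (1/12) * cmod (z1 - z2) < kappa * c * cmod (z1 - z2)"
          using elim(2) by (intro mult_strict_right_mono) auto
        then show False using le by linarith
      qed
    qed
  qed
qed


section \<open>Every eigenvalue near the segment lies close to a zero\<close>

definition near_segment :: "complex \<Rightarrow> bool" where
  "near_segment t \<longleftrightarrow> cmod t < 1/25 \<or> \<bar>Im t\<bar> < \<delta> * Re t"

text \<open>Write e = \<open>\<epsilon> powr (-1/2)\<close>. The radius 1/25 keeps
  \<open>phi_ext\<close> at least 1, so h is at most 3 exp (- e), while the Airy factors at z can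
  contribute at most exp (2 |z|^(3/2)) in the comparison, which is at most exp (e/2).\<close>

lemma not_eigenvalue_outside_sector:
  "\<forall>\<^sub>F \<epsilon> in at_right 0. \<forall>t. cmod t < 1/25 \<longrightarrow> \<not> \<bar>Im t\<bar> < \<delta> * Re t \<longrightarrow>
     \<not> eigenvalue \<epsilon> (cis (- (pi/6)) * t - 1)"
proof -
  obtain cL where cL: "cL > 0" "\<And>z. \<not> \<bar>Im z\<bar> < \<delta> * Re z \<Longrightarrow> cmod (v (- z)) \<ge> cL * exp (- (cmod z powr (3/2)))"
    using v_lower[OF \<delta>(1)] by blast
  obtain CU where CU: "CU > 0" "\<And>\<xi>. cmod (v \<xi>) \<le> CU * exp (cmod \<xi> powr (3/2))"
    using v_upper by blast
  have "\<forall>\<^sub>F \<epsilon> in at_right 0. (3 * CU) * exp (- (1/2 * \<epsilon> powr (-1/2))) < cL * \<epsilon> powr (1/4)"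
    using cL by (intro eventually_exp_small) auto
  moreover have "\<forall>\<^sub>F \<epsilon> in at_right 0. 1 * \<epsilon> powr (1/4) < (1::real)"
    by (rule eventually_powr_small) auto
  moreover have "\<forall>\<^sub>F \<epsilon> in at_right 0. \<epsilon> powr (- (1/3)) > 2 * R0"
    by (rule eventually_powr_large) simp
  ultimately show ?thesis using eventually_at_right_less[of 0]
  proof eventually_elim
    case (elim \<epsilon>)
    define p where "p = \<epsilon> powr (-1/3)"
    define e where "e = \<epsilon> powr (-1/2)"
    have pos: "p > 0" "e > 0" using elim by (auto simp: p_def e_def)
    have pe: "p powr (3/2) = e" by (simp add: p_def e_def powr_powr)
    show ?case
    proof (intro allI impI notI)
      fix t assume t: "cmod t < 1/25" "\<not> \<bar>Im t\<bar> < \<delta> * Re t" "eigenvalue \<epsilon> (cis (- (pi/6)) * t - 1)"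
      define z where "z = of_real p * t"
      define b where "b = right_arg \<epsilon> z"
      have tt: "\<bar>Re t\<bar> < 1/25" "\<bar>Im t\<bar> < 1/25" using t(1) abs_Re_le_cmod[of t] abs_Im_le_cmod[of t] by linarith+
      have rng: "Re t < sqrt 3" "Im t < 1" using tt sqrt3_bounds by linarith+
      have q1: "cmod (right_dist t) \<ge> 1/2" using abs_Im_le_cmod[of "right_dist t"] tt by simp
      have "p * (1/2) \<le> p * cmod (right_dist t)" using q1 pos by (intro mult_left_mono) auto
      then have big: "\<epsilon> powr (-1/3) * cmod (right_dist t) \<ge> R0" using elim(3) by (simp add: p_def)
      have "phi_ext t \<ge> (2 / sqrt 3 - Re t) - 2 * max 0 (- Im t)"
        by (rule phi_ext_lower_lin) (use tt sqrt3_bounds in auto)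
      then have F1: "phi_ext t \<ge> 1" using tt sqrt3_bounds by (simp add: max_def split: if_splits)
      have nz: "v (- al * b) \<noteq> 0"
        using v_right_arg_nz[OF elim(4) rng big] by (simp add: b_def z_def p_def)
      have "cmod (pert \<epsilon> z) \<le> 3 * exp (- (e * phi_ext t))"
        using pert_le[OF elim(4) rng big] by (simp add: z_def p_def e_def)
      also have "\<dots> \<le> 3 * exp (- e)" using F1 pos by simp
      finally have "cmod (pert \<epsilon> z) \<le> 3 * exp (- e)" .
      moreover have "cmod (al^2) = 1" by (simp add: norm_power)
      ultimately have h: "cmod (v b / v (- al * b)) \<le> 3 * exp (- e)"
        by (simp only: pert_def b_def norm_mult mult_1)
      have "v (- z) * v (- al * b) = v b * v (al * z)"
        using t(3) unfolding eigenvalue_iff_z[OF elim(4)] by (simp add: z_def p_def b_def)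
      then have "v (- z) = v b / v (- al * b) * v (al * z)" using nz by (simp add: field_simps)
      then have "cmod (v (- z)) = cmod (v b / v (- al * b)) * cmod (v (al * z))" by (simp only: norm_mult)
      also have "\<dots> \<le> 3 * exp (- e) * (CU * exp (cmod z powr (3/2)))"
        using h CU(2)[of "al * z"] by (intro mult_mono) auto
      finally have up: "cmod (v (- z)) \<le> 3 * exp (- e) * (CU * exp (cmod z powr (3/2)))" .
      have "\<not> \<bar>Im z\<bar> < \<delta> * Re z"
        using t(2) pos by (simp add: z_def abs_mult mult.left_commute[of \<delta>])
      moreover have "3 * exp (- e) * (CU * exp (cmod z powr (3/2))) = 3 * CU * exp (- e + cmod z powr (3/2))"
        unfolding exp_add by simp
      ultimately have "cL * exp (- (cmod z powr (3/2))) \<le> 3 * CU * exp (- e + cmod z powr (3/2))"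
        using cL(2)[of z] up by linarith
      then have "cL * exp (- (cmod z powr (3/2))) * exp (cmod z powr (3/2)) \<le> 3 * CU * exp (- e + cmod z powr (3/2)) * exp (cmod z powr (3/2))"
        by (rule mult_right_mono) simp
      then have 1: "cL \<le> 3 * CU * exp (- e + 2 * cmod z powr (3/2))"
        by (simp add: mult.assoc flip: exp_add)
      \<comment> \<open>The scale \<open>p\<close> contributes exactly e, and the 3/2 power of |t| <
        1/25 is at most 1/25.\<close>
      have "cmod z powr (3/2) \<le> 1/4 * e"
      proof -
        have "cmod z powr (3/2) = e * cmod t powr (3/2)" using pos by (simp add: z_def norm_mult powr_mult pe)
        also have "cmod t powr (3/2) \<le> (1/25) powr (3/2)" using t(1) by (intro powr_mono2) auto
        also have "(1/25 :: real) powr (3/2) \<le> (1/25) powr 1" by (intro powr_mono') auto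
        finally show ?thesis using pos by simp
      qed
      then have "exp (- e + 2 * cmod z powr (3/2)) \<le> exp (- (1/2 * e))" by simp
      then have "3 * CU * exp (- e + 2 * cmod z powr (3/2)) \<le> 3 * CU * exp (- (1/2 * e))"
        using CU by (intro mult_left_mono) auto
      also have "\<dots> < cL * \<epsilon> powr (1/4)" using elim(1) by (simp add: e_def)
      also have "\<dots> \<le> cL * 1" using elim(2) cL by (intro mult_left_mono) auto
      finally show False using 1 by simp
    qed
  qed
qed

text \<open>Above the axis the bound on h is immediate. Below it the bound grows with the depth, and
  the eigenvalue equation is used to control that depth.\<close>

lemma pert_small_in_sector:
  "\<forall>\<^sub>F \<epsilon> in at_right 0. \<forall>t. \<bar>Im t\<bar> < \<delta> * Re t \<longrightarrow> Re t < t_max \<theta> \<epsilon> \<longrightarrow>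
     eigenvalue \<epsilon> (cis (- (pi/6)) * t - 1) \<longrightarrow>
     cmod (pert \<epsilon> (of_real (\<epsilon> powr (-1/3)) * t)) \<le> 12 * \<epsilon> powr (1/4) \<and>
     exp (Psi (of_real (\<epsilon> powr (-1/3)) * t)) = be * (1 + pert \<epsilon> (of_real (\<epsilon> powr (-1/3)) * t))"
proof -
  obtain R1 where R1: "R1 \<ge> 1" 
    "\<And>z. Re z > 0 \<Longrightarrow> cmod z \<ge> R1 \<Longrightarrow> cmod (v (be * z) / v (al * z)) \<ge> 1/2 * exp (- (4/3) * Im (z powr (3/2)))"
    using exp_Psi_lower by blast
  have "\<forall>\<^sub>F \<epsilon> in at_right 0. 12 * \<epsilon> powr (1/4) < (1::real)"
    by (rule eventually_powr_small) auto
  moreover have "\<forall>\<^sub>F \<epsilon> in at_right 0. \<epsilon> powr (- (1/3)) > max R1 (2 * R0)"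
    by (rule eventually_powr_large) simp
  moreover have "\<forall>\<^sub>F \<epsilon> in at_right (0::real). 3 * exp (- (1/10 * \<epsilon> powr (-1/2))) < 3 * \<epsilon> powr (1/4)"
    by (rule eventually_exp_small) auto
  moreover have "\<forall>\<^sub>F \<epsilon> in at_right 0. \<epsilon> < (1 :: real)"
    by (rule eventually_at_rightI[of 0 1]) auto
  ultimately show ?thesis using eventually_at_right_less[of 0]
  proof eventually_elim
    case (elim \<epsilon>)
    define p where "p = \<epsilon> powr (-1/3)"
    define e where "e = \<epsilon> powr (-1/2)"
    have pos: "p > 0" "e > 0" using elim by (auto simp: p_def e_def)
    have pe: "p powr (3/2) = e" by (simp add: p_def e_def powr_powr)
    have tm: "t_max \<theta> \<epsilon> \<le> 2 / sqrt 3"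
      using elim \<theta> by (simp add: t_max_def ln_powr mult_nonneg_nonpos2 mult_nonneg_nonpos)
    show ?case
    proof (intro allI impI)
      fix t assume t: "\<bar>Im t\<bar> < \<delta> * Re t" "Re t < t_max \<theta> \<epsilon>" "eigenvalue \<epsilon> (cis (- (pi/6)) * t - 1)"
      define z where "z = of_real p * t"
      have "0 < \<delta> * Re t" using t(1) by linarith
      then have Ret: "Re t > 0" using \<delta> by (simp add: zero_less_mult_iff)
      have up: "Re t \<le> 2 / sqrt 3" using t(2) tm by linarith
      have "\<delta> * Re t \<le> 1/100 * Re t" using \<delta> Ret by (intro mult_right_mono) auto
      then have Imt: "\<bar>Im t\<bar> \<le> 1/50" using t(1) up sqrt3_bounds by linarith
      have rng: "Re t < sqrt 3" "Im t < 1" using up Imt sqrt3_bounds by linarith+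
      have q1: "cmod (right_dist t) \<ge> 1/2" using abs_Im_le_cmod[of "right_dist t"] Imt by simp
      have "p * (1/2) \<le> p * cmod (right_dist t)" using q1 pos by (intro mult_left_mono) auto
      then have big: "\<epsilon> powr (-1/3) * cmod (right_dist t) \<ge> R0" using elim(2) by (simp add: p_def)
      have nz: "v (- al * right_arg \<epsilon> z) \<noteq> 0"
        using v_right_arg_nz[OF elim(5) rng big] by (simp add: z_def p_def)
      have zsec: "\<bar>Im z\<bar> \<le> \<delta> * Re z"
        using t(1) pos by (simp add: z_def abs_mult mult.left_commute[of \<delta>])
      have zS: "z \<in> cone" by (rule in_cone[OF zsec \<delta>])
      have "v (- z) * v (- al * right_arg \<epsilon> z) = v (right_arg \<epsilon> z) * v (al * z)"
        using t(3) unfolding eigenvalue_iff_z[OF elim(5)] by (simp add: z_def p_def)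
      then have eq: "exp (Psi z) = be * (1 + pert \<epsilon> z)"
        unfolding characteristic_sector[OF zS nz] by (simp add: pert_def)
      have hF: "cmod (pert \<epsilon> z) \<le> 3 * exp (- (e * phi_ext t))"
        using pert_le[OF elim(5) rng big] by (simp add: z_def p_def e_def)
      define X where "X = e * max 0 (- Im t)"
      have hX: "cmod (pert \<epsilon> z) \<le> 3 * (\<epsilon> powr (1/4) * exp (2 * X))"
      proof -
        have "exp (- (e * phi_ext t)) \<le> \<epsilon> powr (1/4) * exp (0 + 2 * (\<epsilon> powr (-1/2) * max 0 (- Im t)))"
          unfolding e_def by (rule phi_ext_exp_bound[OF elim(5,4) \<theta> up]) (use Imt t(2) in auto)
        then show ?thesis using hF unfolding X_def e_def by simp
      qed
      have "cmod (pert \<epsilon> z) \<le> 12 * \<epsilon> powr (1/4)"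
      proof -
        consider "Im t \<ge> 0" | "Im t < 0" "Re t \<ge> 1" | "Im t < 0" "Re t < 1" by linarith
        then show ?thesis
        proof cases
          case 1
          then have "X = 0" by (simp add: X_def)
          then show ?thesis using hX by (simp add: order_trans)
        next
          \<comment> \<open>Here |exp \<open>Psi\<close>| is at least 1/2 exp (2 X), while the
            equation bounds it by 1 + |h| <= 1 + 1/4 exp (2 X). Hence exp (2 X) <= 4, which turns
            the a priori bound on h into 12 \<open>\<epsilon> powr (1/4)\<close>.\<close>
          case 2
          have X: "X = - (e * Im t)" using 2 by (simp add: X_def)
          have t0: "t \<noteq> 0" using Ret by auto
          have "p * 1 \<le> p * cmod t" using 2(2) complex_Re_le_cmod[of t] pos by (intro mult_left_mono) auto
          moreover have "cmod z = p * cmod t" using pos by (simp add: z_def norm_mult)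
          moreover have "p > R1" using elim(2) by (simp add: p_def)
          ultimately have "cmod z \<ge> R1" by linarith
          moreover have "Re z > 0" using pos Ret by (simp add: z_def)
          ultimately have "1/2 * exp (- (4/3) * Im (z powr (3/2))) \<le> cmod (exp (Psi z))"
            using R1(2)[of z] unfolding exp_Psi[OF zS] by blast
          also have "\<dots> \<le> 1 + cmod (pert \<epsilon> z)"
            unfolding eq norm_mult using norm_triangle_ineq[of 1 "pert \<epsilon> z"] by simp
          finally have 3: "1/2 * exp (- (4/3) * Im (z powr (3/2))) \<le> 1 + cmod (pert \<epsilon> z)" .
          have "Im (z powr (3/2)) = e * Im (t powr (3/2))"
            unfolding z_def powr_scale[OF pos(1) t0] pe by simp
          also have "\<dots> \<le> e * (3/2 * Im t)"
            using Im_powr_three_halves_lower[OF 2(2)] 2(1) pos by (intro mult_left_mono) auto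
          finally have "2 * X \<le> - (4/3) * Im (z powr (3/2))" unfolding X by simp
          then have "1/2 * exp (2 * X) \<le> 1/2 * exp (- (4/3) * Im (z powr (3/2)))" by simp
          also note 3
          also have "1 + cmod (pert \<epsilon> z) \<le> 1 + 1/4 * exp (2 * X)"
          proof -
            have "3 * (\<epsilon> powr (1/4) * exp (2 * X)) \<le> 1/4 * exp (2 * X)"
              unfolding mult.assoc[symmetric] using elim(1) by (intro mult_right_mono) auto
            then show ?thesis using hX by linarith
          qed
          finally have "exp (2 * X) \<le> 4" by simp
          then have "3 * (\<epsilon> powr (1/4) * exp (2 * X)) \<le> 3 * (\<epsilon> powr (1/4) * 4)"
            by (intro mult_left_mono) auto
          then show ?thesis using hX by linarith
        next
          \<comment> \<open>The distance of Re t from 2 / sqrt 3 exceeds 15/100 and the depth costs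
            at most 4/100, so the exponent stays above 1/10 and h is exponentially small.\<close>
          case 3
          have "phi_ext t \<ge> (2 / sqrt 3 - Re t) - 2 * max 0 (- Im t)"
            by (rule phi_ext_lower_lin) (use up Imt in auto)
          then have "phi_ext t \<ge> 1/10" using 3 Imt sqrt3_bounds by simp
          then have "e * (1/10) \<le> e * phi_ext t" using pos by (intro mult_left_mono) auto
          then have "3 * exp (- (e * phi_ext t)) \<le> 3 * exp (- (1/10 * e))" by simp
          also have "\<dots> < 3 * \<epsilon> powr (1/4)" using elim(3) by (simp add: e_def)
          finally have "cmod (pert \<epsilon> z) \<le> 3 * \<epsilon> powr (1/4)" using hF by linarith
          then show ?thesis using powr_ge_zero[of \<epsilon> "1/4"] by linarith
        qed
      qed
      then show "cmod (pert \<epsilon> (of_real (\<epsilon> powr (-1/3)) * t)) \<le> 12 * \<epsilon> powr (1/4) \<and>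
         exp (Psi (of_real (\<epsilon> powr (-1/3)) * t)) = be * (1 + pert \<epsilon> (of_real (\<epsilon> powr (-1/3)) * t))"
        using eq by (simp add: z_def p_def)
    qed
  qed
qed


lemma eigenvalue_localized:
  "\<forall>\<^sub>F \<epsilon> in at_right 0. \<forall>t. near_segment t \<longrightarrow> Re t < t_max \<theta> \<epsilon> \<longrightarrow>
     eigenvalue \<epsilon> (cis (- (pi/6)) * t - 1) \<longrightarrow>
     (\<exists>k\<ge>1. is_sol \<epsilon> k (of_real (\<epsilon> powr (-1/3)) * t) \<and>
        cmod (of_real (\<epsilon> powr (-1/3)) * t - of_real (airy_zero k)) \<le> 120 / (kappa * c) * \<epsilon> powr (1/4))"
proof -
  have "\<forall>\<^sub>F \<epsilon> in at_right 0. 24 * \<epsilon> powr (1/4) < (1::real)"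
    by (rule eventually_powr_small) auto
  then show ?thesis
    using not_eigenvalue_outside_sector pert_small_in_sector eventually_at_right_less[of 0]
  proof eventually_elim
    case (elim \<epsilon>)
    show ?case
    proof (intro allI impI)
      fix t assume t: "near_segment t" "Re t < t_max \<theta> \<epsilon>" "eigenvalue \<epsilon> (cis (- (pi/6)) * t - 1)"
      define z where "z = of_real (\<epsilon> powr (-1/3)) * t"
      have sec: "\<bar>Im t\<bar> < \<delta> * Re t" using elim(2) t unfolding near_segment_def by blast
      have zsec: "\<bar>Im z\<bar> \<le> \<delta> * Re z"
        using sec elim(4) by (simp add: z_def abs_mult mult.left_commute[of \<delta>])
      have h: "cmod (pert \<epsilon> z) \<le> 12 * \<epsilon> powr (1/4)" and eq: "exp (Psi z) = be * (1 + pert \<epsilon> z)"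
        using elim(3) sec t(2,3) unfolding z_def by blast+
      have h2: "cmod (pert \<epsilon> z) < 1/2" using h elim(1) by linarith
      obtain k where k: "k \<ge> 1" "Psi z = Psi (of_real (airy_zero k)) + Ln (1 + pert \<epsilon> z)"
        by (rule characteristic_log[OF in_cone[OF zsec \<delta>] Im_Psi_nonneg[OF \<delta> sec_arg zsec] h2 eq])
      then have sol: "is_sol \<epsilon> k z" by (simp add: is_sol_def)
      have "cmod (z - of_real (airy_zero k)) \<le> 2 * cmod (pert \<epsilon> z) / (kappa * c)"
        by (rule sol_near[OF k(1) sol zsec h2])
      \<comment> \<open>Rounding 24 up to 120 gives the same radius as in \<open>sol_exists\<close>,
        so that uniqueness applies to both.\<close>
      also have "\<dots> \<le> 120 * \<epsilon> powr (1/4) / (kappa * c)"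
      proof (rule divide_right_mono)
        show "2 * cmod (pert \<epsilon> z) \<le> 120 * \<epsilon> powr (1/4)" using h powr_ge_zero[of \<epsilon> "1/4"] by linarith
      qed (use kc_pos in simp)
      finally show "\<exists>k\<ge>1. is_sol \<epsilon> k (of_real (\<epsilon> powr (-1/3)) * t) \<and>
        cmod (of_real (\<epsilon> powr (-1/3)) * t - of_real (airy_zero k)) \<le> 120 / (kappa * c) * \<epsilon> powr (1/4)"
        using k(1) sol unfolding z_def by auto
    qed
  qed
qed

section \<open>Numbering the eigenvalues by the zeros\<close>

lemma sol_is_eigenvalue:
  assumes "\<epsilon> > 0" "k \<ge> 1" "is_sol \<epsilon> k z" "\<bar>Im z\<bar> < \<delta> * Re z" "v (- al * right_arg \<epsilon> z) \<noteq> 0" "cmod (pert \<epsilon> z) < 1/2"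
  shows "eigenvalue \<epsilon> (cis (- (pi/6)) * (of_real (\<epsilon> powr (1/3)) * z) - 1)"
proof -
  have "1 + pert \<epsilon> z \<noteq> 0" 
    using assms(6) norm_triangle_ineq4[of "1 + pert \<epsilon> z" "pert \<epsilon> z"] by auto
  then have "exp (Psi z) = be * (1 + pert \<epsilon> z)"
    using assms(3) unfolding is_sol_def by (simp add: exp_add exp_Psi_airy_zero[OF assms(2)])
  then have "v (- z) * v (- al * right_arg \<epsilon> z) = v (right_arg \<epsilon> z) * v (al * z)"
    using characteristic_sector[OF in_cone[OF less_imp_le[OF assms(4)] \<delta>] assms(5)] by (simp add: pert_def)
  moreover have "\<epsilon> powr (-1/3) * \<epsilon> powr (1/3) = 1"
    using assms(1) by (simp flip: powr_add)
  then have zeq: "of_real (\<epsilon> powr (-1/3)) * (of_real (\<epsilon> powr (1/3)) * z) = z"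
    unfolding mult.assoc[symmetric] of_real_mult[symmetric] by simp
  ultimately show ?thesis unfolding eigenvalue_iff_z[OF assms(1)] zeq by simp
qed

lemma exists_index_beyond: "\<exists>k. x \<le> airy_zero (Suc k)"
proof (rule ccontr)
  assume "\<not> ?thesis"
  then have less: "airy_zero (Suc k) < x" for k by (simp add: not_le)
  then have x: "0 \<le> x" using airy_zero(1)[of 1] by (metis One_nat_def le_refl less_imp_le order_trans)
  obtain n where n: "phase x < real n" using reals_Archimedean2 by blast
  have "2 * pi * real (Suc n) - pi / 3 < phase x"
    using phase_strict_iff[of "airy_zero (Suc n)" x] airy_zero[of "Suc n"] less[of n] x by auto
  moreover have "2 * 3 * real (Suc n) \<le> 2 * pi * real (Suc n)" using pi_gt3 by (intro mult_right_mono) auto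
  ultimately show False using n pi_less_4 by auto
qed

text \<open>\<open>N\<close> counts the zeros below \<open>t_max\<close>, and n is \<open>N\<close>
  unless the solution of the next zero falls below \<open>t_max\<close>. The constant 80 / (kappa c)
  is 40 / (kappa c) from \<open>sol_exists\<close>, doubled because |lam0| >= 1/2.\<close>

lemma segment_asymptotics_holds:
  "\<forall>\<^sub>F \<epsilon> in at_right 0. segment_asymptotics {\<mu>. near_segment (cis (pi/6) * (\<mu> + 1))} (80 / (kappa * c)) \<theta> \<epsilon>
     (\<lambda>k. \<epsilon> powr (1/3) * airy_zero k)"
proof -
  define K where "K = 120 / (kappa * c)"
  have K: "K \<ge> 0" "K \<ge> 120 / (kappa * c)" using kc_pos by (auto simp: K_def)
  have "\<forall>\<^sub>F \<epsilon> in at_right 0. \<epsilon> powr (- (1/3)) > 2 * K"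
    by (rule eventually_powr_large) simp
  moreover have "\<forall>\<^sub>F \<epsilon> in at_right 0. 54 * \<epsilon> powr (1/4) < (1::real)"
    by (rule eventually_powr_small) auto
  moreover have "\<forall>\<^sub>F \<epsilon> in at_right 0. (40 * \<bar>\<theta>\<bar>) * \<epsilon> powr (1/4) < 1"
    by (rule eventually_powr_small) auto
  moreover have "\<forall>\<^sub>F \<epsilon> in at_right 0. \<epsilon> < (1 :: real)"
    by (rule eventually_at_rightI[of 0 1]) auto
  ultimately show ?thesis
    using near_zero[OF K(1)] sol_exists[OF K(2)] sol_unique[OF K(1)]
      eigenvalue_localized[folded K_def] airy_zero_gap[of K] eventually_at_right_less[of 0]
  proof eventually_elim
    case (elim \<epsilon>)
    note ex = elim(6) and uniq = elim(7) and loc = elim(8) and gap = elim(9) and \<epsilon>0 = elim(10)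
    define p where "p = \<epsilon> powr (-1/3)"
    define u where "u = \<epsilon> powr (1/3)"
    define q where "q = \<epsilon> powr (1/4)"
    have pos: "p > 0" "u > 0" "q > 0" using \<epsilon>0 by (auto simp: p_def u_def q_def)
    have pu: "p * u = 1" "u * p = 1" using \<epsilon>0 by (auto simp: p_def u_def simp flip: powr_add)
    have u1: "u \<le> 1" and q1: "q \<le> 1" unfolding u_def q_def using \<epsilon>0 elim(4) by (auto intro!: powr_le1)
    have uq: "u * q = \<epsilon> powr (7/12)" by (simp add: u_def q_def flip: powr_add)
    have p1: "p > 2 * K" using elim(1) by (simp add: p_def)
    have tmle: "t_max \<theta> \<epsilon> \<le> 2 / sqrt 3"
      using \<epsilon>0 elim(4) \<theta> by (simp add: t_max_def ln_powr mult_nonneg_nonpos2 mult_nonneg_nonpos)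
    \<comment> \<open>With \<open>t_max\<close> at least 1, all zeros beyond it lie above
      \<open>\<epsilon> powr (-1/3)\<close>, as \<open>airy_zero_gap\<close> demands.\<close>
    have tmge: "t_max \<theta> \<epsilon> \<ge> 1"
    proof -
      have "ln (1 / q) \<le> 1 / q - 1" using pos by (intro ln_le_minus_one) auto
      then have "ln (1 / \<epsilon>) \<le> 4 * (1 / q)" using \<epsilon>0 pos by (simp add: q_def ln_div ln_powr)
      then have "\<theta> * ln (1 / \<epsilon>) \<le> \<theta> * (4 * (1 / q))" using \<theta> by (intro mult_left_mono) auto
      then have "\<epsilon> powr (1/2) * (\<theta> * ln (1 / \<epsilon>)) \<le> \<epsilon> powr (1/2) * (\<theta> * (4 * (1 / q)))" by (rule mult_left_mono) auto
      also have hq: "\<epsilon> powr (1/2) = q * q" by (simp add: q_def flip: powr_add)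
      also have "q * q * (\<theta> * (4 * (1 / q))) = 4 * \<theta> * q" using pos by simp
      also have "\<dots> \<le> 1/10" using elim(3) \<theta> by (simp add: q_def)
      finally have "\<epsilon> powr (1/2) * (\<theta> * ln (1 / \<epsilon>)) \<le> 1/10" unfolding hq .
      moreover have "t_max \<theta> \<epsilon> = 2 / sqrt 3 - \<epsilon> powr (1/2) * (\<theta> * ln (1 / \<epsilon>))"
        using \<epsilon>0 by (simp add: t_max_def ln_powr ln_div)
      ultimately show ?thesis using sqrt3_bounds by linarith
    qed
    define N where "N = (LEAST k. t_max \<theta> \<epsilon> \<le> u * airy_zero (Suc k))"
    have "\<exists>k. t_max \<theta> \<epsilon> \<le> u * airy_zero (Suc k)"
    proof -
      obtain k where "p * t_max \<theta> \<epsilon> \<le> airy_zero (Suc k)" using exists_index_beyond by blast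
      then have "u * (p * t_max \<theta> \<epsilon>) \<le> u * airy_zero (Suc k)" using pos by (intro mult_left_mono) auto
      then show ?thesis using pu(2) by (auto simp flip: mult.assoc)
    qed
    then have N1: "t_max \<theta> \<epsilon> \<le> u * airy_zero (Suc N)" unfolding N_def by (rule LeastI_ex)
    have N2: "u * airy_zero k < t_max \<theta> \<epsilon>" if "1 \<le> k" "k \<le> N" for k
    proof -
      have "k - 1 < N" using that by linarith
      then have "\<not> t_max \<theta> \<epsilon> \<le> u * airy_zero (Suc (k - 1))" unfolding N_def by (rule not_less_Least)
      then show ?thesis using that(1) by simp
    qed
    have N3: "t_max \<theta> \<epsilon> \<le> u * airy_zero k" if "Suc N \<le> k" for k
    proof -
      have "airy_zero (Suc N) \<le> airy_zero k" using airy_zero_less[of "Suc N" k] that by (cases "k = Suc N") auto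
      then have "u * airy_zero (Suc N) \<le> u * airy_zero k" using pos by simp
      then show ?thesis using N1 by linarith
    qed
    define near where "near k z \<longleftrightarrow> is_sol \<epsilon> k z \<and> cmod (z - of_real (airy_zero k)) \<le> K * q" for k z
    \<comment> \<open>Decides whether the one index beyond \<open>t_max\<close> belongs to the
      list.\<close>
    define ext where "ext \<longleftrightarrow> (\<exists>z. near (Suc N) z \<and> u * Re z < t_max \<theta> \<epsilon>)"
    define n where "n = (if ext then Suc N else N)"
    have adm: "admissible K \<epsilon> k" if k: "k \<in> {1..n}" for k
    proof (cases "k \<le> N")
      case True
      have "u * airy_zero k < t_max \<theta> \<epsilon>" using N2 k True by auto
      moreover have "0 \<le> K * \<epsilon> powr (7/12)" using K by simp
      ultimately show ?thesis using k unfolding admissible_def u_def by auto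
    next
      case False
      then have kk: "k = Suc N" "ext" using k by (auto simp: n_def split: if_splits)
      then obtain z where z: "near k z" "u * Re z < t_max \<theta> \<epsilon>" by (auto simp: ext_def)
      have "airy_zero k - Re z \<le> K * q"
        using z(1) abs_Re_le_cmod[of "z - of_real (airy_zero k)"] by (auto simp: near_def)
      then have "u * (airy_zero k - Re z) \<le> u * (K * q)" using pos by (intro mult_left_mono) auto
      then have "u * airy_zero k \<le> t_max \<theta> \<epsilon> + K * (u * q)" using z(2) by (simp add: algebra_simps)
      then have "u * airy_zero k \<le> t_max \<theta> \<epsilon> + K * \<epsilon> powr (7/12)" unfolding uq .
      then show ?thesis using kk(1) unfolding admissible_def u_def by simp
    qed
    define zz where "zz k = (SOME z. near k z)" for k
    have zz: "near k (zz k)" "cmod (zz k - of_real (airy_zero k)) \<le> 40 / (kappa * c) * decay \<epsilon> k" if k: "k \<in> {1..n}" for k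
    proof -
      obtain z where z: "is_sol \<epsilon> k z" "cmod (z - of_real (airy_zero k)) \<le> 40 / (kappa * c) * decay \<epsilon> k" 
         "cmod (z - of_real (airy_zero k)) \<le> K * q"
        using ex adm[OF k] unfolding q_def by blast
      then have nz: "near k z" by (simp add: near_def)
      then show n: "near k (zz k)" unfolding zz_def by (rule someI)
      have "zz k = z" using uniq adm[OF k] n nz unfolding near_def q_def by blast
      then show "cmod (zz k - of_real (airy_zero k)) \<le> 40 / (kappa * c) * decay \<epsilon> k" using z(2) by simp
    qed
    define lam where "lam k = cis (- (pi/6)) * (of_real u * zz k) - 1" for k
    define lam0 where "lam0 k = exp (- \<i> * of_real (pi / 6)) * of_real (u * airy_zero k) - 1" for k
    define r where "r k = lam k / lam0 k - 1" for k
    have ee: "exp (- \<i> * of_real (pi / 6)) = cis (- (pi/6))" by (simp add: cis_conv_exp)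
    have T: "cis (pi/6) * (cis (- (pi/6)) * t - 1 + 1) = t" for t
      by (simp add: cis_mult flip: mult.assoc)
    have T': "cis (- (pi/6)) * (cis (pi/6) * (\<mu> + 1)) - 1 = \<mu>" for \<mu>
      by (simp add: cis_mult flip: mult.assoc)
    have sc: "seg_coord \<mu> = Re (cis (pi/6) * (\<mu> + 1))" for \<mu> by (simp only: seg_coord_def cis_conv_exp)
    \<comment> \<open>Rotated by 30 degrees, \<open>lam0\<close> becomes a real number minus cis
      (pi/6), with imaginary part -1/2.\<close>
    have lam0: "cmod (lam0 k) \<ge> 1/2" for k
    proof -
      have "cmod (lam0 k) = cmod (cis (pi/6) * lam0 k)" by (simp add: norm_mult)
      also have "cis (pi/6) * lam0 k = of_real (u * airy_zero k) - cis (pi/6)"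
        unfolding lam0_def ee by (simp add: right_diff_distrib cis_mult flip: mult.assoc)
      finally show ?thesis
        using abs_Im_le_cmod[of "of_real (u * airy_zero k) - cis (pi/6)"] by (simp add: sin_30)
    qed
    have facts: "eigenvalue \<epsilon> (lam k) \<and> near_segment (cis (pi/6) * (lam k + 1)) \<and>
        lam k = lam0 k * (1 + r k) \<and> cmod (r k) \<le> 80 / (kappa * c) * decay \<epsilon> k" if k: "k \<in> {1..n}" for k
    proof (intro conjI)
      have k1: "k \<ge> 1" using k by simp
      have NZ: "\<bar>Im (zz k)\<bar> < \<delta> * Re (zz k)" "v (- al * right_arg \<epsilon> (zz k)) \<noteq> 0"
        "cmod (pert \<epsilon> (zz k)) \<le> 9 * decay \<epsilon> k" "decay \<epsilon> k \<le> 3 * \<epsilon> powr (1/4)"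
        using elim(5) adm[OF k] zz(1)[OF k] unfolding near_def q_def by blast+
      have "cmod (pert \<epsilon> (zz k)) < 1/2" using NZ(3,4) elim(2) by linarith
      then show "eigenvalue \<epsilon> (lam k)"
        unfolding lam_def u_def using sol_is_eigenvalue[OF \<epsilon>0 k1 _ NZ(1,2)] zz(1)[OF k] by (simp add: near_def)
      have "\<bar>Im (of_real u * zz k)\<bar> < \<delta> * Re (of_real u * zz k)"
        using NZ(1) pos by (simp add: abs_mult mult.left_commute[of \<delta>])
      then show "near_segment (cis (pi/6) * (lam k + 1))"
        unfolding lam_def T near_segment_def by blast
      have l0: "lam0 k \<noteq> 0" using lam0[of k] by auto
      then show "lam k = lam0 k * (1 + r k)" by (simp add: r_def)
      have "r k = (lam k - lam0 k) / lam0 k" using l0 by (simp add: r_def field_simps)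
      also have "lam k - lam0 k = cis (- (pi/6)) * (of_real u * (zz k - of_real (airy_zero k)))"
        unfolding lam_def lam0_def ee by (simp add: algebra_simps)
      finally have "cmod (r k) = u * cmod (zz k - of_real (airy_zero k)) / cmod (lam0 k)"
        using pos by (simp add: norm_mult norm_divide)
      also have "\<dots> \<le> 1 * (40 / (kappa * c) * decay \<epsilon> k) / (1/2)"
        using u1 zz(2)[OF k] order_trans[OF norm_ge_zero zz(2)[OF k]] lam0[of k] pos
        by (intro frac_le mult_mono) auto
      finally show "cmod (r k) \<le> 80 / (kappa * c) * decay \<epsilon> k" by simp
    qed
    have inj: "inj_on lam {1..n}"
    proof (rule inj_onI)
      fix j k assume jk: "j \<in> {1..n}" "k \<in> {1..n}" "lam j = lam k"
      have "zz j = zz k" using jk(3) pos by (simp add: lam_def)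
      then have "Psi (of_real (airy_zero j)) = Psi (of_real (airy_zero k))"
        using zz(1)[OF jk(1)] zz(1)[OF jk(2)] by (simp add: near_def is_sol_def)
      then have "phase (airy_zero j) = phase (airy_zero k)" by (simp add: phase_def)
      then show "j = k" using airy_zero(2)[of j] airy_zero(2)[of k] jk by auto
    qed
    have cover: "\<mu> \<in> lam ` {1..n}"
      if \<mu>: "near_segment (cis (pi/6) * (\<mu> + 1))" "eigenvalue \<epsilon> \<mu>" "seg_coord \<mu> < t_max \<theta> \<epsilon>" for \<mu>
    proof -
      define t where "t = cis (pi/6) * (\<mu> + 1)"
      define z where "z = of_real p * t"
      have \<mu>t: "cis (- (pi/6)) * t - 1 = \<mu>" unfolding t_def by (rule T')
      have Ret: "Re t < t_max \<theta> \<epsilon>" using \<mu>(3) by (simp add: sc t_def)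
      have tz: "t = of_real u * z" unfolding z_def mult.assoc[symmetric] of_real_mult[symmetric] pu by simp
      have Rez: "u * Re z < t_max \<theta> \<epsilon>" using Ret unfolding tz by simp
      obtain k where k: "k \<ge> 1" "is_sol \<epsilon> k z" "cmod (z - of_real (airy_zero k)) \<le> K * q"
        using loc \<mu>(1,2) Ret \<mu>t unfolding t_def[symmetric] z_def p_def q_def by metis
      have nk: "near k z" using k by (simp add: near_def)
      have "k \<le> n"
      proof (rule ccontr)
        assume "\<not> k \<le> n"
        moreover have "ext" if "k = Suc N" using nk that Rez unfolding ext_def by blast
        \<comment> \<open>For an index past N + 1 the preceding zero is still beyond
          \<open>t_max\<close>, hence to the right of z. Then z would be within K q of the k-th zero
          although the whole gap lies between them.\<close>
        ultimately have k2: "Suc N < k" by (cases "k = Suc N") (auto simp: n_def split: if_splits)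
        define j where "j = k - 1"
        have j: "Suc j = k" "j \<ge> 1" "Suc N \<le> j" using k2 by (auto simp: j_def)
        have tj: "t_max \<theta> \<epsilon> \<le> u * airy_zero j" by (rule N3[OF j(3)])
        have d: "airy_zero k - Re z \<le> K * q"
          using k(3) abs_Re_le_cmod[of "z - of_real (airy_zero k)"] by auto
        have "u * Re z < u * airy_zero j" using Rez tj by linarith
        then have rj: "Re z < airy_zero j" using pos by simp
        have "p * 1 \<le> p * t_max \<theta> \<epsilon>" using tmge pos by (intro mult_left_mono) auto
        also have "\<dots> \<le> p * (u * airy_zero j)" using tj pos by (intro mult_left_mono) auto
        also have "\<dots> = airy_zero j" unfolding mult.assoc[symmetric] pu by simp
        finally have 1: "p \<le> airy_zero j" by simp
        have "p * (u * Re z) \<le> p * t_max \<theta> \<epsilon>" using Rez pos by (intro mult_left_mono) auto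
        also have "p * (u * Re z) = Re z" unfolding mult.assoc[symmetric] pu by simp
        also have "p * t_max \<theta> \<epsilon> \<le> p * (12/10)" using tmle sqrt3_bounds pos by (intro mult_left_mono) auto
        finally have "Re z \<le> 12/10 * p" by simp
        moreover have "K * q \<le> K * 1" using K q1 by (intro mult_left_mono) auto
        ultimately have 2: "airy_zero k \<le> 12/10 * p + K" using d by linarith
        show False
        proof (cases "airy_zero k \<le> 2 * p")
          case True
          have "K * q < airy_zero k - airy_zero j" using gap j 1 True unfolding p_def q_def by auto
          then show False using d rj by linarith
        next
          \<comment> \<open>Since Re z <= 1.2 p, the k-th zero is at most 1.2 p + K; exceeding 2 p
            would contradict p > 2 K.\<close>
          case False
          then have "8/10 * p < K" using 2 by linarith
          then show False using p1 pos by linarith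
        qed
      qed
      then have kn: "k \<in> {1..n}" using k(1) by simp
      have "z = zz k" using uniq adm[OF kn] nk zz(1)[OF kn] unfolding near_def q_def by blast
      then have "\<mu> = lam k" unfolding lam_def \<mu>t[symmetric] tz by simp
      then show ?thesis using kn by blast
    qed
    have EEk: "exp (- (\<epsilon> powr (-1/2)) * \<phi> (u * airy_zero k)) = decay \<epsilon> k" for k by (simp add: decay_def u_def)
    show ?case
      unfolding segment_asymptotics_def u_def[symmetric]
    proof (rule exI[of _ n], rule exI[of _ lam], rule exI[of _ r], intro conjI)
      show "\<forall>k\<ge>1. u * airy_zero k < t_max \<theta> \<epsilon> \<longrightarrow> k \<le> n"
        using N3 by (force simp: n_def not_le[symmetric] not_less_eq_eq)
      show "\<forall>k\<in>{1..<n}. u * airy_zero k < t_max \<theta> \<epsilon>"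
        using N2 by (auto simp: n_def split: if_splits)
      show "inj_on lam {1..n}" by (rule inj)
      show "\<forall>k\<in>{1..n}. eigenvalue \<epsilon> (lam k) \<and> lam k \<in> {\<mu>. near_segment (cis (pi/6) * (\<mu> + 1))} \<and>
          lam k = (exp (- \<i> * of_real (pi / 6)) * of_real (u * airy_zero k) - 1) * (1 + r k) \<and>
          cmod (r k) \<le> 80 / (kappa * c) * exp (- (\<epsilon> powr (-1/2)) * \<phi> (u * airy_zero k))"
        using facts unfolding EEk lam0_def mem_Collect_eq by blast
      show "\<forall>\<mu>\<in>{\<mu>. near_segment (cis (pi/6) * (\<mu> + 1))}. eigenvalue \<epsilon> \<mu> \<and> seg_coord \<mu> < t_max \<theta> \<epsilon> \<longrightarrow> \<mu> \<in> lam ` {1..n}"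
        using cover by blast
    qed
  qed
qed

lemma near_segment_open: "open {\<mu>. near_segment (cis (pi/6) * (\<mu> + 1))}"
  unfolding near_segment_def by (intro open_Collect_disj open_Collect_less continuous_intros)

text \<open>In the rotated coordinate the segment is the real interval from 0 to 2 / sqrt 3. The
  open cone contains all of it except 0, the image of -1, which the disc in
  \<open>near_segment\<close> supplies.\<close>

lemma near_segment_contains:
  "closed_segment (-1) (- \<i> / of_real (sqrt 3)) \<subseteq> {\<mu>. near_segment (cis (pi/6) * (\<mu> + 1))}"
proof
  fix \<mu> assume "\<mu> \<in> closed_segment (-1) (- \<i> / of_real (sqrt 3))"
  then obtain s where s: "0 \<le> s" "s \<le> 1" "\<mu> = (1 - s) *\<^sub>R (-1) + s *\<^sub>R (- \<i> / of_real (sqrt 3))"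
    by (auto simp: closed_segment_def)
  have eq: "cis (pi/6) * (\<mu> + 1) = of_real (s * (2 / sqrt 3))"
  proof -
    have c: "cis (pi/6) = Complex (sqrt 3 / 2) (1/2)" by (simp add: complex_eq_iff cos_30 sin_30)
    have i: "\<i> / of_real (sqrt 3) = Complex 0 (1 / sqrt 3)" by (simp add: complex_eq_iff Im_divide_of_real)
    have q: "sqrt 3 * sqrt 3 = 3" by simp
    show ?thesis unfolding c s(3) minus_divide_left[symmetric] i
      using q by (auto simp: complex_eq_iff field_simps)
  qed
  have near: "near_segment (of_real x)" if "x \<ge> 0" for x
    using that \<delta> by (cases "x = 0") (auto simp: near_segment_def)
  have "near_segment (of_real (s * (2 / sqrt 3)))" by (rule near) (use s in simp)
  then show "\<mu> \<in> {\<mu>. near_segment (cis (pi/6) * (\<mu> + 1))}"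
    unfolding mem_Collect_eq eq .
qed

end

theorem mainTheorem4:
  fixes v :: "complex \<Rightarrow> complex" and \<theta> :: real
  assumes v: "airy_fock v"
    and \<theta>: "\<theta> > 1/3 * (3/4) powr (3/4)"
  shows "(\<forall>\<epsilon>>0. \<forall>\<mu>. eigenvalue \<epsilon> \<mu> \<longleftrightarrow> eigenvalue \<epsilon> (- cnj \<mu>)) \<and>
    (\<exists>t :: real \<Rightarrow> nat \<Rightarrow> real.
       (\<forall>\<epsilon>>0. enumerates_zeros v \<epsilon> (t \<epsilon>)) \<and>
       (\<exists>U C. open U \<and> closed_segment (-1) (- \<i> / of_real (sqrt 3)) \<subseteq> U \<and>
          (\<forall>\<^sub>F \<epsilon> in at_right 0. segment_asymptotics U C \<theta> \<epsilon> (t \<epsilon>))) \<and>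
       (\<exists>B. \<forall>\<epsilon>>0. \<forall>k\<ge>1.
          \<bar>(\<epsilon> powr (-1/3) * t \<epsilon> k) powr (3/2) - 3 * pi / 2 * (real k - 1/4)\<bar> \<le> B / real k))"
proof -
  interpret airy v by unfold_locales (rule v)
  \<comment> \<open>The power (3/4)^(3/4) is at least 3/4, so the hypothesis gives \<theta> >= 1/4,
    the value at which h becomes O(\<open>\<epsilon> powr (1/4)\<close>).\<close>
  have "(3/4 :: real) powr 1 \<le> (3/4) powr (3/4)" by (rule powr_mono') auto
  then have \<theta>': "\<theta> \<ge> 1/4" using \<theta> by simp
  obtain \<delta> c where \<delta>c: "0 < \<delta>" "\<delta> \<le> 1/100" "c > 0"
    "\<And>z. \<bar>Im z\<bar> \<le> \<delta> * Re z \<Longrightarrow> c \<le> Re (recip_prod z)"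
    "\<And>z. \<bar>Im z\<bar> \<le> \<delta> * Re z \<Longrightarrow> \<bar>Im (recip_prod z)\<bar> \<le> Re (recip_prod z)"
    by (rule recip_prod_sector) (rule that, assumption+)
  obtain R0 C0 where RC: "R0 \<ge> 1" "C0 > 0"
    "\<And>\<epsilon> t. 0 < \<epsilon> \<Longrightarrow> Re t < sqrt 3 \<Longrightarrow> Im t < 1 \<Longrightarrow> \<epsilon> powr (-1/3) * cmod (right_dist t) \<ge> R0 \<Longrightarrow>
       v (- al * right_arg \<epsilon> (of_real (\<epsilon> powr (-1/3)) * t)) \<noteq> 0"
    "\<And>\<epsilon> t. 0 < \<epsilon> \<Longrightarrow> Re t < sqrt 3 \<Longrightarrow> Im t < 1 \<Longrightarrow> \<epsilon> powr (-1/3) * cmod (right_dist t) \<ge> R0 \<Longrightarrow>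
       cmod (pert \<epsilon> (of_real (\<epsilon> powr (-1/3)) * t)) \<le> 3 * exp (- (\<epsilon> powr (-1/2) * phi_ext t))"
    "\<And>\<epsilon> t. 0 < \<epsilon> \<Longrightarrow> Re t < sqrt 3 \<Longrightarrow> Im t < 1 \<Longrightarrow> \<epsilon> powr (-1/3) * cmod (right_dist t) \<ge> R0 \<Longrightarrow>
       \<exists>D. (pert \<epsilon> has_field_derivative D) (at (of_real (\<epsilon> powr (-1/3)) * t)) \<and>
         cmod D \<le> C0 * (\<epsilon> powr (-1/3) * cmod (right_dist t)) powr (1/2) * exp (- (\<epsilon> powr (-1/2) * phi_ext t))"
    by (rule pert_bound) (rule that, assumption+)
  interpret airy_pert v \<delta> c R0 C0 \<theta>
    by unfold_locales (fact \<delta>c RC \<theta>')+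
  obtain B where B: "\<And>k. k \<ge> 1 \<Longrightarrow> \<bar>airy_zero k powr (3/2) - 3 * pi / 2 * (real k - 1/4)\<bar> \<le> B / real k"
    using airy_zero_asymp by blast
  define t where "t \<epsilon> k = \<epsilon> powr (1/3) * airy_zero k" for \<epsilon> k
  have pt: "\<epsilon> powr (-1/3) * t \<epsilon> k = airy_zero k" if "\<epsilon> > 0" for \<epsilon> k
    using that by (simp add: t_def flip: mult.assoc powr_add)
  have "enumerates_zeros v \<epsilon> (t \<epsilon>)" if \<epsilon>: "\<epsilon> > 0" for \<epsilon>
    unfolding enumerates_zeros_def
  proof
    show "strict_mono_on {1..} (t \<epsilon>)"
      using \<epsilon> by (auto simp: strict_mono_on_def t_def intro!: airy_zero_less)
    have *: "v (of_real (- (\<epsilon> powr (-1/3)) * x)) = 0 \<longleftrightarrow> (\<exists>k\<ge>1. \<epsilon> powr (-1/3) * x = airy_zero k)" if "x \<ge> 0" for x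
      using zero_iff[of "\<epsilon> powr (-1/3) * x"] that by simp
    show "t \<epsilon> ` {1..} = {x. 0 \<le> x \<and> v (of_real (- (\<epsilon> powr (-1/3)) * x)) = 0}"
    proof (intro equalityI subsetI)
      fix x assume "x \<in> t \<epsilon> ` {1..}"
      then obtain k where k: "k \<ge> 1" "x = t \<epsilon> k" by auto
      then have "x \<ge> 0" using airy_zero(1)[OF k(1)] by (simp add: t_def)
      then show "x \<in> {x. 0 \<le> x \<and> v (of_real (- (\<epsilon> powr (-1/3)) * x)) = 0}"
        using *[of x] k pt[OF \<epsilon>] by blast
    next
      fix x assume "x \<in> {x. 0 \<le> x \<and> v (of_real (- (\<epsilon> powr (-1/3)) * x)) = 0}"
      then obtain k where k: "k \<ge> 1" "\<epsilon> powr (-1/3) * x = airy_zero k" using *[of x] by blast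
      then have "\<epsilon> powr (-1/3) * x = \<epsilon> powr (-1/3) * t \<epsilon> k" by (simp only: pt[OF \<epsilon>])
      then have "x = t \<epsilon> k" using \<epsilon> by simp
      then show "x \<in> t \<epsilon> ` {1..}" using k by auto
    qed
  qed
  moreover have "\<exists>U C. open U \<and> closed_segment (-1) (- \<i> / of_real (sqrt 3)) \<subseteq> U \<and>
          (\<forall>\<^sub>F \<epsilon> in at_right 0. segment_asymptotics U C \<theta> \<epsilon> (t \<epsilon>))"
    unfolding t_def[abs_def]
    using near_segment_open near_segment_contains segment_asymptotics_holds by blast
  moreover have "\<exists>B. \<forall>\<epsilon>>0. \<forall>k\<ge>1.
          \<bar>(\<epsilon> powr (-1/3) * t \<epsilon> k) powr (3/2) - 3 * pi / 2 * (real k - 1/4)\<bar> \<le> B / real k"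
    using B pt by (intro exI[of _ B]) simp
  ultimately show ?thesis using eigenvalue_reflect_iff by blast
qed

end
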